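(* Up to isomorphism, there are exactly $39$ combinatorial $3$-manifolds on $8$ vertices, all of which are combinatorial $3$-spheres.
   Context: All simplicial complexes are finite; isomorphic complexes are identified. A $d$-dimensional complex is pure if every face is contained in a $d$-face; its $d$-faces are then called facets. A weak $d$-pseudomanifold is a $d$-dimensional pure complex in which each $(d-1)$-face is in exactly two facets. A normal $d$-pseudomanifold ($d\ge1$) is a connected weak $d$-pseudomanifold in which the links of all simplices of dimension $\le d-2$ are connected. A combinatorial $3$-manifold is a normal $3$-pseudomanifold in which the link of each vertex triangulates the $2$-sphere. A combinatorial $3$-sphere is a combinatorial $3$-manifold whose geometric carrier is homeomorphic to the $3$-sphere. *)

theory Defs
  imports "HOL-Analysis.Analysis"
begin

text \<open>
  Complexes are abstract and finite, and are identified with their set of simplices.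
  The empty simplex (of dimension \<open>-1\<close>) belongs to every complex, so a simplex of dimension
  \<open>i\<close> is one with \<open>i + 1\<close> elements, and the vertex set of \<open>K\<close> is \<open>\<Union>K\<close>.
\<close>

definition abstract_complex :: "'v set set \<Rightarrow> bool" where
  "abstract_complex K \<longleftrightarrow>
     finite K \<and> {} \<in> K \<and> (\<forall>\<sigma>\<in>K. finite \<sigma>) \<and> (\<forall>\<sigma>\<in>K. \<forall>\<tau>. \<tau> \<subseteq> \<sigma> \<longrightarrow> \<tau> \<in> K)"

definition faces_of_dim :: "nat \<Rightarrow> 'v set set \<Rightarrow> 'v set set" where
  "faces_of_dim i K = {\<sigma> \<in> K. card \<sigma> = Suc i}"

definition complex_dim :: "nat \<Rightarrow> 'v set set \<Rightarrow> bool" where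
  "complex_dim d K \<longleftrightarrow> faces_of_dim d K \<noteq> {} \<and> (\<forall>\<sigma>\<in>K. card \<sigma> \<le> Suc d)"

definition pure_complex :: "nat \<Rightarrow> 'v set set \<Rightarrow> bool" where
  "pure_complex d K \<longleftrightarrow>
     abstract_complex K \<and> complex_dim d K \<and> (\<forall>\<sigma>\<in>K. \<exists>F\<in>faces_of_dim d K. \<sigma> \<subseteq> F)"

definition link_complex :: "'v set \<Rightarrow> 'v set set \<Rightarrow> 'v set set" where
  "link_complex \<sigma> K = {\<tau> \<in> K. \<tau> \<inter> \<sigma> = {} \<and> \<tau> \<union> \<sigma> \<in> K}"

text \<open>
  Points of the carrier are given by their barycentric coordinates. The topology is that of the
  function type, i.e. the product topology; since all points are supported in the finite set
  \<open>\<Union>K\<close>, this is the Euclidean topology of the standard realization.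
\<close>

definition geometric_carrier :: "'v set set \<Rightarrow> ('v \<Rightarrow> real) set" where
  "geometric_carrier K =
     {x. (\<forall>v. 0 \<le> x v) \<and> {v. x v \<noteq> 0} \<in> K \<and> (\<Sum>v\<in>\<Union>K. x v) = 1}"

definition connected_complex :: "'v set set \<Rightarrow> bool" where
  "connected_complex K \<longleftrightarrow> connected (geometric_carrier K)"

text \<open>In the next definition, \<open>card \<rho> = d\<close> says that \<open>\<rho>\<close> has dimension \<open>d - 1\<close>.\<close>

definition weak_pseudomanifold :: "nat \<Rightarrow> 'v set set \<Rightarrow> bool" where
  "weak_pseudomanifold d K \<longleftrightarrow>
     pure_complex d K \<and>
     (\<forall>\<rho>\<in>K. card \<rho> = d \<longrightarrow> card {F \<in> faces_of_dim d K. \<rho> \<subseteq> F} = 2)"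

text \<open>Here \<open>card \<sigma> < d\<close> says that \<open>\<sigma>\<close> has dimension at most \<open>d - 2\<close>.\<close>

definition normal_pseudomanifold :: "nat \<Rightarrow> 'v set set \<Rightarrow> bool" where
  "normal_pseudomanifold d K \<longleftrightarrow>
     1 \<le> d \<and> weak_pseudomanifold d K \<and> connected_complex K \<and>
     (\<forall>\<sigma>\<in>K. card \<sigma> < d \<longrightarrow> connected_complex (link_complex \<sigma> K))"

definition combinatorial_3_manifold :: "'v set set \<Rightarrow> bool" where
  "combinatorial_3_manifold K \<longleftrightarrow>
     normal_pseudomanifold 3 K \<and>
     (\<forall>v\<in>\<Union>K. geometric_carrier (link_complex {v} K) homeomorphic sphere (0 :: real^3) 1)"

definition combinatorial_3_sphere :: "'v set set \<Rightarrow> bool" where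
  "combinatorial_3_sphere K \<longleftrightarrow>
     combinatorial_3_manifold K \<and> geometric_carrier K homeomorphic sphere (0 :: real^4) 1"

definition complex_isomorphic :: "'v set set \<Rightarrow> 'w set set \<Rightarrow> bool" where
  "complex_isomorphic K L \<longleftrightarrow> (\<exists>f. bij_betw f (\<Union>K) (\<Union>L) \<and> L = (\<lambda>\<sigma>. f ` \<sigma>) ` K)"

lemma equiv_complex_isomorphic:
  "equiv UNIV {(K :: 'v set set, L :: 'v set set). complex_isomorphic K L}"
proof (rule equivI)
  show "refl {(K :: 'v set set, L). complex_isomorphic K L}"
    unfolding refl_on_def complex_isomorphic_def
    by (auto intro!: exI[of _ id])
  show "sym {(K :: 'v set set, L). complex_isomorphic K L}"
  proof (rule symI, clarsimp)
    fix K L :: "'v set set"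
    assume "complex_isomorphic K L"
    then obtain f where f: "bij_betw f (\<Union>K) (\<Union>L)" "L = (\<lambda>\<sigma>. f ` \<sigma>) ` K"
      unfolding complex_isomorphic_def by blast
    let ?g = "inv_into (\<Union>K) f"
    have "?g ` f ` \<sigma> = \<sigma>" if "\<sigma> \<in> K" for \<sigma>
      using f(1) that by (intro inv_into_image_cancel) (auto simp: bij_betw_def)
    then have "(\<lambda>\<sigma>. ?g ` \<sigma>) ` L = K"
      unfolding f(2) image_image by simp
    then show "complex_isomorphic L K"
      unfolding complex_isomorphic_def using bij_betw_inv_into[OF f(1)] by blast
  qed
  show "trans {(K :: 'v set set, L). complex_isomorphic K L}"
  proof (rule transI, clarsimp)
    fix K L M :: "'v set set"
    assume "complex_isomorphic K L" "complex_isomorphic L M"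
    then obtain f g where
      "bij_betw f (\<Union>K) (\<Union>L)" "L = (\<lambda>\<sigma>. f ` \<sigma>) ` K"
      "bij_betw g (\<Union>L) (\<Union>M)" "M = (\<lambda>\<sigma>. g ` \<sigma>) ` L"
      unfolding complex_isomorphic_def by blast
    then have "bij_betw (g \<circ> f) (\<Union>K) (\<Union>M)" "M = (\<lambda>\<sigma>. (g \<circ> f) ` \<sigma>) ` K"
      by (auto intro: bij_betw_trans simp: image_comp image_image)
    then show "complex_isomorphic K M"
      unfolding complex_isomorphic_def by blast
  qed
qed auto

end

theory Submission
  imports Defs
begin

text \<open>
  A bistellar flip does not change the homeomorphism type of the carrier: both carriers are graphs
  over the same ball, seen along one direction. Hence every complex obtained by flips from the
  boundary of the 4-simplex is a combinatorial 3-sphere, which yields 39 spheres on 8 vertices; an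
  integer invariant, computed from the sizes of the intersections of facets, tells them apart.

  Conversely, a normal pseudomanifold is determined by any closed subsystem of its facets, so it can
  be found by a backtracking search that repeatedly chooses the second facet at a ridge. On
  surfaces with at most 7 vertices the search gives 9 spheres and 5 other surfaces, and the latter
  are excluded as vertex links since they contain a triangle that does not separate, against the
  Jordan--Brouwer theorem. Starting from the star of a vertex in the largest number of facets, whose
  link is one of the 9 spheres, the search then gives the spheres above and one pseudomanifold that
  is not a manifold. A branch of the search dies when a ridge lies in three facets, when the link of
  a codimension-2 face properly contains a cycle, or when a vertex has too many facets.
\<close>

subsection \<open>Carriers\<close>

text \<open>Sphericity is never recognised, only transported, and it has to be transported for all
  links together; this works because links of faces before and after a flip differ again by a flip,
  or are boundaries of simplices. In the negative direction one obstruction serves orientable and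
  non-orientable surfaces alike, and no homology is involved. Surfaces have to be classified first
  because links supply the start in dimension 3: a link has at most 7 vertices, and a 2-sphere with
  m vertices has 2m - 4 triangles, so the initial star has 4, 6, 8 or 10 facets. Putting the centre
  at a vertex in most facets turns this number into a bound for all vertices. A leaf of the search
  needs no isomorphism test: a closed catalogue entry found inside the partial complex is already
  everything. The search sees only pseudomanifolds, hence the one catalogue entry that is not a
  manifold, and it cannot force all labels to be used, hence the 8 catalogue spheres with fewer than
  8 vertices.\<close>

lemma carrier_memI_superset:
  assumes "finite W" "\<Union>K \<subseteq> W"
  shows "x \<in> geometric_carrier K \<longleftrightarrow>
    (\<forall>v. 0 \<le> x v) \<and> {v. x v \<noteq> 0} \<in> K \<and> (\<Sum>v\<in>W. x v) = 1"
proof -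
  have "(\<Sum>v\<in>\<Union>K. x v) = (\<Sum>v\<in>W. x v)" if "{v. x v \<noteq> 0} \<in> K"
    using assms that by (intro sum.mono_neutral_left) auto
  then show ?thesis unfolding geometric_carrier_def by auto
qed

lemma homeomorphicI_maps:
  assumes "\<And>x. x \<in> S \<Longrightarrow> f x \<in> T" "\<And>y. y \<in> T \<Longrightarrow> g y \<in> S"
    and "\<And>x. x \<in> S \<Longrightarrow> g (f x) = x" "\<And>y. y \<in> T \<Longrightarrow> f (g y) = y"
    and "continuous_on S f" "continuous_on T g"
  shows "S homeomorphic T"
proof -
  have "f ` S = T" "g ` T = S" using assms(1-4) by force+
  then have "homeomorphism S T f g" unfolding homeomorphism_def using assms(3-6) by simp
  then show ?thesis unfolding homeomorphic_def by blast
qed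

lemma abstract_complex_finite_vertices: "abstract_complex K \<Longrightarrow> finite (\<Union>K)"
  unfolding abstract_complex_def by auto

lemma continuous_on_coordinate: "continuous_on S (\<lambda>x :: 'a \<Rightarrow> real. x v)"
  by (rule continuous_on_subset[OF continuous_on_product_coordinates]) simp

lemma complex_isomorphic_obtain:
  assumes "complex_isomorphic K L"
  obtains f g where "bij_betw f (\<Union>K) (\<Union>L)" "bij_betw g (\<Union>L) (\<Union>K)"
    "\<And>v. v \<in> \<Union>K \<Longrightarrow> g (f v) = v" "\<And>w. w \<in> \<Union>L \<Longrightarrow> f (g w) = w"
    "\<And>\<sigma>. \<sigma> \<in> K \<Longrightarrow> f ` \<sigma> \<in> L" "\<And>\<tau>. \<tau> \<in> L \<Longrightarrow> g ` \<tau> \<in> K"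
proof -
  obtain f where f: "bij_betw f (\<Union>K) (\<Union>L)" "L = (\<lambda>\<sigma>. f ` \<sigma>) ` K"
    using assms unfolding complex_isomorphic_def by blast
  define g where "g = inv_into (\<Union>K) f"
  have gf: "g (f v) = v" if "v \<in> \<Union>K" for v
    using f(1) that unfolding g_def by (meson bij_betw_inv_into_left)
  have gfs: "g ` f ` \<sigma> = \<sigma>" if "\<sigma> \<in> K" for \<sigma>
  proof -
    have "\<And>v. v \<in> \<sigma> \<Longrightarrow> g (f v) = v" using gf that by blast
    then show ?thesis by (simp add: image_image)
  qed
  show thesis
  proof (rule that[of f g])
    show "f (g w) = w" if "w \<in> \<Union>L" for w
      using f(1) that unfolding g_def by (meson bij_betw_inv_into_right)
    show "g ` \<tau> \<in> K" if "\<tau> \<in> L" for \<tau> using that gfs unfolding f(2) by auto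
    show "bij_betw g (\<Union>L) (\<Union>K)" unfolding g_def by (rule bij_betw_inv_into[OF f(1)])
  qed (use f gf in auto)
qed

text \<open>An isomorphism acts on points by precomposition with the inverse vertex map. The cut-off
  is there because \<open>g\<close> is arbitrary off \<open>W\<close>, whereas the points of a
  carrier vanish off its vertices.\<close>

definition pull_coords :: "('w \<Rightarrow> 'v) \<Rightarrow> 'w set \<Rightarrow> ('v \<Rightarrow> real) \<Rightarrow> 'w \<Rightarrow> real" where
  "pull_coords g W x = (\<lambda>w. if w \<in> W then x (g w) else 0)"

lemma continuous_on_pull_coords: "continuous_on S (pull_coords g W)" unfolding pull_coords_def
proof (rule continuous_on_coordinatewise_then_product)
  fix w
  show "continuous_on S (\<lambda>x. if w \<in> W then x (g w) else 0)"
    by (cases "w \<in> W") (simp_all add: continuous_on_coordinate)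
qed

lemma pull_coords_carrier:
  assumes g: "bij_betw g (\<Union>L) (\<Union>K)"
    and f: "\<And>\<sigma>. \<sigma> \<in> K \<Longrightarrow> f ` \<sigma> \<in> L" "\<And>w. w \<in> \<Union>L \<Longrightarrow> f (g w) = w"
      "\<And>v. v \<in> \<Union>K \<Longrightarrow> g (f v) = v"
    and x: "x \<in> geometric_carrier K"
  shows "pull_coords g (\<Union>L) x \<in> geometric_carrier L"
proof -
  let ?y = "pull_coords g (\<Union>L) x"
  have supp: "{v. x v \<noteq> 0} \<in> K" and sum: "(\<Sum>v\<in>\<Union>K. x v) = 1" and nn: "\<And>v. 0 \<le> x v"
    using x unfolding geometric_carrier_def by auto
  have vK: "v \<in> \<Union>K" if "x v \<noteq> 0" for v using supp that by blast
  have "{w. ?y w \<noteq> 0} = f ` {v. x v \<noteq> 0}"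
  proof (intro equalityI subsetI)
    fix w assume "w \<in> {w. ?y w \<noteq> 0}"
    then have "w \<in> \<Union>L" "x (g w) \<noteq> 0"
      by (auto simp: pull_coords_def split: if_splits)
    then show "w \<in> f ` {v. x v \<noteq> 0}"
      using f(2)[of w] by (intro image_eqI[of _ _ "g w"]) auto
  next
    fix w assume "w \<in> f ` {v. x v \<noteq> 0}"
    then obtain v where v: "w = f v" "x v \<noteq> 0" by auto
    moreover have "f v \<in> \<Union>L" using f(1)[OF supp] v by blast
    ultimately show "w \<in> {w. ?y w \<noteq> 0}"
      using f(3)[OF vK[OF v(2)]] by (simp add: pull_coords_def)
  qed
  then have "{w. ?y w \<noteq> 0} \<in> L" using f(1)[OF supp] by simp
  moreover have "(\<Sum>w\<in>\<Union>L. ?y w) = 1"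
    using sum.reindex_bij_betw[OF g, of x] sum by (simp add: pull_coords_def)
  ultimately show ?thesis using nn unfolding geometric_carrier_def by (simp add: pull_coords_def)
qed

lemma pull_coords_inverse:
  assumes "bij_betw f (\<Union>K) (\<Union>L)" "\<And>v. v \<in> \<Union>K \<Longrightarrow> g (f v) = v"
    and x: "x \<in> geometric_carrier K"
  shows "pull_coords f (\<Union>K) (pull_coords g (\<Union>L) x) = x"
proof
  fix v
  have "x v = 0" if "v \<notin> \<Union>K" using x that unfolding geometric_carrier_def by blast
  then show "pull_coords f (\<Union>K) (pull_coords g (\<Union>L) x) v = x v"
    using assms(1,2) unfolding pull_coords_def bij_betw_def by auto
qed

lemma complex_isomorphic_carrier:
  assumes "complex_isomorphic K L"
  shows "geometric_carrier K homeomorphic geometric_carrier L"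
proof -
  obtain f g where fg: "bij_betw f (\<Union>K) (\<Union>L)" "bij_betw g (\<Union>L) (\<Union>K)"
    "\<And>v. v \<in> \<Union>K \<Longrightarrow> g (f v) = v" "\<And>w. w \<in> \<Union>L \<Longrightarrow> f (g w) = w"
    "\<And>\<sigma>. \<sigma> \<in> K \<Longrightarrow> f ` \<sigma> \<in> L" "\<And>\<tau>. \<tau> \<in> L \<Longrightarrow> g ` \<tau> \<in> K"
    using complex_isomorphic_obtain[OF assms] by blast
  note 1 = pull_coords_carrier[OF fg(2,5,4,3)] pull_coords_carrier[OF fg(1,6,3,4)]
  note 2 = pull_coords_inverse[OF fg(1,3)] pull_coords_inverse[OF fg(2,4)]
  show ?thesis
    by (rule homeomorphicI_maps[of _ "pull_coords g (\<Union>L)" _ "pull_coords f (\<Union>K)"])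
       (use 1 2 in \<open>simp_all add: continuous_on_pull_coords\<close>)
qed

subsection \<open>Bistellar flips\<close>

definition bdry :: "'v set \<Rightarrow> 'v set set" where
  "bdry V = {\<sigma>. \<sigma> \<subset> V}"

text \<open>The star of \<open>A\<close>, the join of \<open>A\<close> with \<open>bdry B\<close>,
  is exchanged for the join of \<open>bdry A\<close> with \<open>B\<close>. Only faces containing
  \<open>B\<close> are added: for a flippable pair all other faces of the new ball are in
  \<open>K\<close> already.\<close>

definition flip :: "'v set \<Rightarrow> 'v set \<Rightarrow> 'v set set \<Rightarrow> 'v set set" where
  "flip A B K = {\<sigma> \<in> K. \<not> A \<subseteq> \<sigma>} \<union> {\<sigma>. \<sigma> \<subseteq> A \<union> B \<and> B \<subseteq> \<sigma> \<and> \<not> A \<subseteq> \<sigma>}"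

definition flippable :: "'v set \<Rightarrow> 'v set \<Rightarrow> 'v set set \<Rightarrow> bool" where
  "flippable A B K \<longleftrightarrow> abstract_complex K \<and> finite A \<and> finite B \<and> A \<noteq> {} \<and> B \<noteq> {} \<and>
     A \<inter> B = {} \<and> A \<in> K \<and> B \<notin> K \<and> link_complex A K = bdry B"

text \<open>Faces containing \<open>A\<close> correspond to elements of the link by removing
  \<open>A\<close>. The condition on the link thereby becomes plain inclusions, to which the later
  set identities about flips reduce.\<close>

lemma flippable_star:
  assumes "flippable A B K" "A \<subseteq> \<sigma>"
  shows "\<sigma> \<in> K \<longleftrightarrow> \<sigma> \<subseteq> A \<union> B \<and> \<not> B \<subseteq> \<sigma>"
proof -
  have lk: "link_complex A K = bdry B" and disj: "A \<inter> B = {}"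
    and sub: "\<And>\<sigma> \<tau>. \<sigma> \<in> K \<Longrightarrow> \<tau> \<subseteq> \<sigma> \<Longrightarrow> \<tau> \<in> K"
    using assms(1) unfolding flippable_def abstract_complex_def by blast+
  have "\<sigma> - A \<in> link_complex A K \<longleftrightarrow> \<sigma> \<in> K"
    using assms(2) sub[of \<sigma> "\<sigma> - A"] unfolding link_complex_def
    by (auto simp: Un_absorb2)
  then have "\<sigma> \<in> K \<longleftrightarrow> \<sigma> - A \<subset> B"
    unfolding lk bdry_def by simp
  then show ?thesis using assms(2) disj by blast
qed

lemma abstract_complex_flip:
  assumes "flippable A B K"
  shows "abstract_complex (flip A B K)"
proof -
  have *: "finite K" "{} \<in> K" "\<And>\<sigma>. \<sigma> \<in> K \<Longrightarrow> finite \<sigma>" "\<And>\<sigma> \<tau>. \<sigma> \<in> K \<Longrightarrow> \<tau> \<subseteq> \<sigma> \<Longrightarrow> \<tau> \<in> K"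
    "finite A" "finite B" "A \<noteq> {}" "B \<noteq> {}"
    using assms unfolding flippable_def abstract_complex_def by blast+
  \<comment> \<open>\<open>A \<union> \<tau>\<close> still misses a vertex of \<open>B\<close>, so
    it is a face of \<open>K\<close>, and then so is \<open>\<tau>\<close>.\<close>
  have new: "\<tau> \<in> K" if "\<not> B \<subseteq> \<tau>" "\<tau> \<subseteq> A \<union> B" for \<tau>
    using flippable_star[OF assms, of "A \<union> \<tau>"] that *(4)[of "A \<union> \<tau>" \<tau>]
      assms unfolding flippable_def by blast
  show ?thesis unfolding abstract_complex_def
  proof (intro conjI ballI allI impI)
    show "finite (flip A B K)"
      using * unfolding flip_def by (auto intro: finite_subset[of _ "Pow (A \<union> B)"])
    show "{} \<in> flip A B K" using * unfolding flip_def by blast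
    show "finite \<sigma>" if "\<sigma> \<in> flip A B K" for \<sigma>
      using * that unfolding flip_def by (auto intro: finite_subset[of _ "A \<union> B"])
    show "\<tau> \<in> flip A B K" if "\<sigma> \<in> flip A B K" "\<tau> \<subseteq> \<sigma>" for \<sigma> \<tau>
      using that *(4)[of \<sigma> \<tau>] new[of \<tau>] unfolding flip_def by blast
  qed
qed

lemma flippable_flip:
  assumes "flippable A B K"
  shows "flippable B A (flip A B K)"
proof -
  have disj: "A \<inter> B = {}" "A \<noteq> {}" "B \<noteq> {}" and BK: "B \<notin> K"
    and sub: "\<And>\<sigma> \<tau>. \<sigma> \<in> K \<Longrightarrow> \<tau> \<subseteq> \<sigma> \<Longrightarrow> \<tau> \<in> K"
    using assms unfolding flippable_def abstract_complex_def by blast+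
  have new: "\<tau> \<in> K" if "\<not> B \<subseteq> \<tau>" "\<tau> \<subseteq> A \<union> B" for \<tau>
    using flippable_star[OF assms, of "A \<union> \<tau>"] that sub[of "A \<union> \<tau>" \<tau>]
      assms unfolding flippable_def by blast
  have nB: "\<not> B \<subseteq> \<sigma>" if "\<sigma> \<in> K" for \<sigma>
    using BK sub that by blast
  have in1: "\<tau> \<in> flip A B K" if "\<tau> \<subset> A" for \<tau>
    using that new[of \<tau>] disj unfolding flip_def by blast
  have in2: "\<tau> \<union> B \<in> flip A B K" if "\<tau> \<subset> A" for \<tau>
    using that disj unfolding flip_def by blast
  have "\<tau> \<subset> A" if "\<tau> \<inter> B = {}" "\<tau> \<union> B \<in> flip A B K" for \<tau>
    using that nB unfolding flip_def by blast
  then have "link_complex B (flip A B K) = bdry A"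
    using in1 in2 disj unfolding link_complex_def bdry_def by blast
  then show ?thesis using assms abstract_complex_flip[OF assms]
    unfolding flippable_def by (auto simp: flip_def)
qed

lemma flip_flip:
  assumes "flippable A B K"
  shows "flip B A (flip A B K) = K"
proof -
  have sub: "\<And>\<sigma> \<tau>. \<sigma> \<in> K \<Longrightarrow> \<tau> \<subseteq> \<sigma> \<Longrightarrow> \<tau> \<in> K" and BK: "B \<notin> K"
    using assms unfolding flippable_def abstract_complex_def by blast+
  have nB: "\<not> B \<subseteq> \<sigma>" if "\<sigma> \<in> K" for \<sigma>
    using BK sub that by blast
  show ?thesis using flippable_star[OF assms] nB unfolding flip_def by blast
qed

text \<open>
  The carriers of a complex and of its flip are the lower and the upper hull of the simplex on
  \<open>A \<union> B\<close> in the direction \<open>1\<^sub>A/|A| - 1\<^sub>B/|B|\<close>; the homeomorphism is the projection along it.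
\<close>

definition flip_map :: "'v set \<Rightarrow> 'v set \<Rightarrow> ('v \<Rightarrow> real) \<Rightarrow> 'v \<Rightarrow> real" where
  "flip_map A B x = (\<lambda>v. x v - (if v \<in> A then Min (x ` A) else 0)
     + (if v \<in> B then Min (x ` A) * (card A / card B) else 0))"

lemma continuous_on_Min_coordinates:
  assumes "finite A" "A \<noteq> {}"
  shows "continuous_on S (\<lambda>x :: 'v \<Rightarrow> real. Min (x ` A))" using assms
proof (induction rule: finite_ne_induct)
  case (singleton a)
  then show ?case by (simp add: continuous_on_coordinate)
next
  case (insert a F)
  then have eq: "(\<lambda>x :: 'v \<Rightarrow> real. Min (x ` insert a F)) = (\<lambda>x. min (x a) (Min (x ` F)))"
    by auto
  show ?case unfolding eq by (intro continuous_on_min continuous_on_coordinate insert.IH)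
qed

lemma continuous_on_flip_map:
  assumes "finite A" "A \<noteq> {}"
  shows "continuous_on S (flip_map A B)"
proof -
  have "continuous_on S (\<lambda>x. flip_map A B x v)" for v unfolding flip_map_def
    by (cases "v \<in> A"; cases "v \<in> B"; simp only: if_True if_False;
        intro continuous_on_add continuous_on_diff continuous_on_mult continuous_on_const
          continuous_on_coordinate continuous_on_Min_coordinates[OF assms])
  then show ?thesis by (rule continuous_on_coordinatewise_then_product)
qed

text \<open>With m the minimum over \<open>A\<close>, a total mass m |A| moves from \<open>A\<close>
  to \<open>B\<close>, evenly on each side, so the sum of the coordinates is kept. The minimum over
  \<open>B\<close> afterwards is exactly what each vertex of \<open>B\<close> received, hence the
  same formula with \<open>A\<close> and \<open>B\<close> exchanged undoes the move.\<close>

lemma flip_map_carrier: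
  assumes fl: "flippable A B K" and x: "x \<in> geometric_carrier K"
  shows "flip_map A B x \<in> geometric_carrier (flip A B K)"
    and "flip_map B A (flip_map A B x) = x"
proof -
  have fin: "finite A" "finite B" "A \<noteq> {}" "B \<noteq> {}" and disj: "A \<inter> B = {}" and BK: "B \<notin> K"
    and cx: "abstract_complex K" using fl unfolding flippable_def by blast+
  then have cards: "card A > 0" "card B > 0" by (auto simp: card_gt_0_iff)
  let ?m = "Min (x ` A)" and ?y = "flip_map A B x"
  have nn: "\<And>v. 0 \<le> x v" and supp: "{v. x v \<noteq> 0} \<in> K"
    using x unfolding geometric_carrier_def by auto
  have "?m \<ge> 0" using fin nn by auto
  have minA: "?m \<le> x a" if "a \<in> A" for a using fin that by simp
  \<comment> \<open>Since \<open>B\<close> is not a face, some coordinate over \<open>B\<close>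
    vanishes; this is why the new minimum over \<open>B\<close> equals the amount added.\<close>
  have "\<not> B \<subseteq> {v. x v \<noteq> 0}"
    using BK supp cx unfolding abstract_complex_def by blast
  then obtain b where b: "b \<in> B" "x b = 0" by blast
  obtain a where a: "a \<in> A" "x a = ?m" using Min_in[of "x ` A"] fin by fastforce
  \<comment> \<open>A common vertex set for both complexes: a flip may add a vertex
    (\<open>B\<close> a single new point) or remove one (\<open>A\<close> a single point).\<close>
  define W where "W = \<Union>K \<union> A \<union> B"
  have W: "finite W" "\<Union>K \<subseteq> W" "A \<subseteq> W" "B \<subseteq> W"
    using abstract_complex_finite_vertices[OF cx] fin unfolding W_def by auto
  have W': "\<Union>(flip A B K) \<subseteq> W" unfolding W_def flip_def by blast
  have sumx: "(\<Sum>v\<in>W. x v) = 1" using carrier_memI_superset[OF W(1,2)] x by auto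
  have "(\<Sum>v\<in>W. if v \<in> A then ?m else 0) = card A * ?m"
    using W by (simp add: sum.If_cases Int_absorb1)
  moreover have "(\<Sum>v\<in>W. if v \<in> B then ?m * (card A / card B) else 0) = card A * ?m"
    using W cards by (simp add: sum.If_cases Int_absorb1)
  ultimately have sumy: "(\<Sum>v\<in>W. ?y v) = 1"
    using sumx unfolding flip_map_def by (simp add: sum.distrib sum_subtractf)
  have nny: "\<And>v. 0 \<le> ?y v"
    using nn minA \<open>?m \<ge> 0\<close> unfolding flip_map_def by auto
  have ya: "?y a = 0" using a disj unfolding flip_map_def by auto
  \<comment> \<open>If the minimum is 0, the point lies outside the open star of \<open>A\<close>
    and is fixed. Otherwise its support contains \<open>A\<close>, hence lies in
    \<open>A \<union> B\<close>; the move then empties a vertex of \<open>A\<close> and makes all of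
    \<open>B\<close> positive.\<close>
  have suppy: "{v. ?y v \<noteq> 0} \<in> flip A B K"
  proof (cases "?m = 0")
    case True
    then have "?y = x" unfolding flip_map_def by auto
    then show ?thesis using supp a True unfolding flip_def by auto
  next
    case False
    then have pos: "?m > 0" using \<open>?m \<ge> 0\<close> by simp
    then have "A \<subseteq> {v. x v \<noteq> 0}" using minA by force
    then have sub: "{v. x v \<noteq> 0} \<subseteq> A \<union> B"
      using flippable_star[OF fl] supp by blast
    have "?y v = 0" if "v \<notin> A \<union> B" for v using sub that unfolding flip_map_def by auto
    moreover have "?y v \<noteq> 0" if "v \<in> B" for v
    proof -
      have "?m * (card A / card B) > 0" using pos cards by simp
      then show ?thesis using nn[of v] that disj unfolding flip_map_def by auto
    qed
    ultimately show ?thesis using ya a unfolding flip_def by blast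
  qed
  show "?y \<in> geometric_carrier (flip A B K)"
    using carrier_memI_superset[OF W(1) W'] nny suppy sumy by blast
  have "Min (?y ` B) = ?m * (card A / card B)"
  proof (rule Min_eqI)
    show "?m * (card A / card B) \<in> ?y ` B"
      using b disj unfolding flip_map_def by (intro image_eqI[of _ _ b]) auto
    fix z assume "z \<in> ?y ` B"
    then obtain v where v: "v \<in> B" "z = ?y v" by blast
    then have "v \<notin> A" using disj by blast
    then show "?m * (card A / card B) \<le> z" using v nn[of v] by (simp add: flip_map_def)
  qed (use fin in simp)
  then show "flip_map B A ?y = x" using cards disj by (auto simp: flip_map_def fun_eq_iff)
qed

theorem flip_carrier_homeomorphic:
  assumes "flippable A B K"
  shows "geometric_carrier K homeomorphic geometric_carrier (flip A B K)"
proof -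
  have fin: "finite A" "finite B" "A \<noteq> {}" "B \<noteq> {}"
    using assms unfolding flippable_def by blast+
  note 1 = flip_map_carrier[OF assms]
  note 2 = flip_map_carrier[OF flippable_flip[OF assms], unfolded flip_flip[OF assms]]
  show ?thesis by (rule homeomorphicI_maps[of _ "flip_map A B" _ "flip_map B A"])
       (use 1 2 continuous_on_flip_map fin in simp_all)
qed

subsection \<open>The boundary of a simplex\<close>

lemma abstract_complex_bdry:
  assumes "finite V" "V \<noteq> {}"
  shows "abstract_complex (bdry V)" using assms unfolding abstract_complex_def bdry_def
  by (auto intro: finite_subset[of _ "Pow V"] finite_subset)

lemma complex_isomorphic_bdry:
  assumes "finite V" "finite W" "card V = card W"
  shows "complex_isomorphic (bdry V) (bdry W)"
proof -
  obtain f where f: "bij_betw f V W" using assms finite_same_card_bij by blast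
  have inj: "inj_on f V" and im: "f ` V = W" using f unfolding bij_betw_def by auto
  have eq: "bdry W = (\<lambda>\<sigma>. f ` \<sigma>) ` bdry V"
  proof
    show "(\<lambda>\<sigma>. f ` \<sigma>) ` bdry V \<subseteq> bdry W"
      using inj im unfolding bdry_def
      by (auto simp: psubset_eq) (metis inj_on_image_eq_iff order_refl)
    show "bdry W \<subseteq> (\<lambda>\<sigma>. f ` \<sigma>) ` bdry V"
    proof
      fix \<tau> assume "\<tau> \<in> bdry W"
      then have "\<tau> \<subset> f ` V" using im unfolding bdry_def by simp
      then obtain \<sigma> where "\<sigma> \<subseteq> V" "\<tau> = f ` \<sigma>"
        by (metis psubset_imp_subset subset_image_iff)
      then show "\<tau> \<in> (\<lambda>\<sigma>. f ` \<sigma>) ` bdry V"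
        using \<open>\<tau> \<subset> f ` V\<close> unfolding bdry_def by blast
    qed
  qed
  have "\<Union>(bdry W) = f ` \<Union>(bdry V)" unfolding eq by blast
  moreover have "\<Union>(bdry V) \<subseteq> V" unfolding bdry_def by blast
  ultimately have "bij_betw f (\<Union>(bdry V)) (\<Union>(bdry W))"
    using inj_on_subset[OF inj] unfolding bij_betw_def by auto
  then show ?thesis using eq unfolding complex_isomorphic_def by blast
qed

lemma frontier_std_simplex:
  "frontier (convex hull (insert 0 Basis)) =
    {x::'a::euclidean_space. (\<forall>i\<in>Basis. 0 \<le> x \<bullet> i) \<and> sum (\<lambda>i. x \<bullet> i) Basis \<le> 1 \<and>
      ((\<exists>i\<in>Basis. x \<bullet> i = 0) \<or> sum (\<lambda>i. x \<bullet> i) Basis = 1)}"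
proof -
  have "closed (convex hull (insert 0 (Basis :: 'a set)))"
    by (intro compact_imp_closed compact_convex_hull finite_imp_compact) simp
  then show ?thesis unfolding frontier_def interior_std_simplex
    by (auto simp: std_simplex order_less_le)
qed

text \<open>\<open>None\<close> stands for the vertex 0 of the standard simplex. Its barycentric
  coordinate is determined by the others, so forgetting it gives Cartesian coordinates; the frontier
  is where some barycentric coordinate vanishes.\<close>

lemma bdry_option_carrier:
  "geometric_carrier (bdry (insert None (Some ` (Basis :: 'a::euclidean_space set))))
     homeomorphic frontier (convex hull (insert 0 (Basis :: 'a set)))"
  (is "geometric_carrier (bdry ?V) homeomorphic ?F")
proof -
  define h :: "('a option \<Rightarrow> real) \<Rightarrow> 'a" where "h x = (\<Sum>b\<in>Basis. x (Some b) *\<^sub>R b)" for x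
  define k :: "'a \<Rightarrow> 'a option \<Rightarrow> real" where
    "k y = (\<lambda>v. case v of None \<Rightarrow> 1 - (\<Sum>i\<in>Basis. y \<bullet> i) | Some b \<Rightarrow> if b \<in> Basis then y \<bullet> b else 0)"
    for y
  have fin: "finite ?V" by simp
  have sub: "\<Union>(bdry ?V) \<subseteq> ?V" unfolding bdry_def by blast
  have sumV: "(\<Sum>v\<in>?V. x v) = x None + (\<Sum>b\<in>Basis. x (Some b))" for x :: "'a option \<Rightarrow> real"
    by (simp add: sum.reindex)
  have mem: "x \<in> geometric_carrier (bdry ?V) \<longleftrightarrow> (\<forall>v. 0 \<le> x v) \<and> (\<forall>v. v \<notin> ?V \<longrightarrow> x v = 0) \<and>
      (x None = 0 \<or> (\<exists>b\<in>Basis. x (Some b) = 0)) \<and> x None + (\<Sum>b\<in>Basis. x (Some b)) = 1" for x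
  proof -
    have "{v. x v \<noteq> 0} \<subset> ?V \<longleftrightarrow> (\<forall>v. v \<notin> ?V \<longrightarrow> x v = 0) \<and> (\<exists>v\<in>?V. x v = 0)"
      by blast
    also have "(\<exists>v\<in>?V. x v = 0) \<longleftrightarrow> x None = 0 \<or> (\<exists>b\<in>Basis. x (Some b) = 0)"
      by simp
    finally show ?thesis unfolding carrier_memI_superset[OF fin sub] sumV by (simp add: bdry_def)
  qed
  have hb: "h x \<bullet> b = x (Some b)" if "b \<in> Basis" for x b
    using that unfolding h_def by (simp add: inner_sum_left inner_Basis if_distrib sum.delta cong: if_cong)
  show ?thesis
  proof (rule homeomorphicI_maps[of _ h _ k])
    show "h x \<in> ?F" if x: "x \<in> geometric_carrier (bdry ?V)" for x
    proof -
      have nn: "\<And>v. 0 \<le> x v" and sum: "x None + (\<Sum>b\<in>Basis. x (Some b)) = 1"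
        and z: "x None = 0 \<or> (\<exists>b\<in>Basis. x (Some b) = 0)"
        using x unfolding mem by blast+
      have "(\<Sum>b\<in>Basis. h x \<bullet> b) = (\<Sum>b\<in>Basis. x (Some b))"
        by (rule sum.cong) (simp_all add: hb)
      then have s: "(\<Sum>b\<in>Basis. h x \<bullet> b) = 1 - x None" using sum by linarith
      show ?thesis unfolding frontier_std_simplex mem_Collect_eq s using nn z by (auto simp: hb)
    qed
    show "k y \<in> geometric_carrier (bdry ?V)" if y: "y \<in> ?F" for y
    proof -
      have nn: "\<And>i. i \<in> Basis \<Longrightarrow> 0 \<le> y \<bullet> i" and le: "(\<Sum>i\<in>Basis. y \<bullet> i) \<le> 1"
        and z: "(\<exists>i\<in>Basis. y \<bullet> i = 0) \<or> (\<Sum>i\<in>Basis. y \<bullet> i) = 1"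
        using y unfolding frontier_std_simplex by blast+
      have None: "k y None = 1 - (\<Sum>i\<in>Basis. y \<bullet> i)"
        and Some: "\<And>b. k y (Some b) = (if b \<in> Basis then y \<bullet> b else 0)"
        unfolding k_def by simp_all
      have "0 \<le> k y v" for v using nn le by (cases v) (simp_all add: None Some)
      moreover have "k y v = 0" if "v \<notin> ?V" for v using that by (cases v) (auto simp: Some)
      moreover have "k y None = 0 \<or> (\<exists>b\<in>Basis. k y (Some b) = 0)"
        using z by (auto simp: None Some)
      moreover have "(\<Sum>b\<in>Basis. k y (Some b)) = (\<Sum>i\<in>Basis. y \<bullet> i)"
        by (rule sum.cong) (simp_all add: Some)
      then have "k y None + (\<Sum>b\<in>Basis. k y (Some b)) = 1" by (simp add: None)
      ultimately show ?thesis unfolding mem by blast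
    qed
    show "k (h x) = x" if x: "x \<in> geometric_carrier (bdry ?V)" for x
    proof
      fix v
      have sum: "x None + (\<Sum>b\<in>Basis. x (Some b)) = 1" and z: "\<And>v. v \<notin> ?V \<Longrightarrow> x v = 0"
        using x unfolding mem by blast+
      have "(\<Sum>b\<in>Basis. h x \<bullet> b) = (\<Sum>b\<in>Basis. x (Some b))"
        by (rule sum.cong) (simp_all add: hb)
      then show "k (h x) v = x v" using sum z[of v] by (cases v) (auto simp: k_def hb)
    qed
    show "h (k y) = y" if "y \<in> ?F" for y
    proof -
      have "h (k y) = (\<Sum>b\<in>Basis. (y \<bullet> b) *\<^sub>R b)"
        unfolding h_def k_def by (rule sum.cong) simp_all
      then show ?thesis by (simp add: euclidean_representation)
    qed
    show "continuous_on (geometric_carrier (bdry ?V)) h"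
      unfolding h_def by (intro continuous_intros continuous_on_coordinate)
    show "continuous_on ?F k"
    proof (rule continuous_on_coordinatewise_then_product)
      fix v show "continuous_on ?F (\<lambda>y. k y v)" unfolding k_def
        by (cases v; cases "the v \<in> Basis") (auto intro!: continuous_intros)
    qed
  qed
qed

lemma bdry_carrier_sphere:
  assumes "finite V" "card V = Suc (DIM('a::euclidean_space))"
  shows "geometric_carrier (bdry V) homeomorphic sphere (0 :: 'a) 1"
proof -
  let ?S = "convex hull (insert 0 (Basis :: 'a set))"
  have "card (insert None (Some ` (Basis :: 'a set))) = Suc (DIM('a))" by (simp add: card_image)
  then have 1: "geometric_carrier (bdry V) homeomorphic
      geometric_carrier (bdry (insert None (Some ` (Basis :: 'a set))))"
    using assms by (intro complex_isomorphic_carrier complex_isomorphic_bdry) auto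
  obtain c where "c \<in> interior ?S" by (rule interior_std_simplex_nonempty)
  then have ne: "interior ?S \<noteq> {}" by auto
  \<comment> \<open>Bounded convex sets of equal affine dimension have homeomorphic relative
    frontiers; as the simplex has interior points, its relative frontier is its frontier.\<close>
  have "rel_frontier ?S homeomorphic rel_frontier (cball (0::'a) 1)"
  proof (rule homeomorphic_rel_frontiers_convex_bounded_sets)
    show "bounded ?S" by (intro bounded_convex_hull finite_imp_bounded) simp
    show "aff_dim ?S = aff_dim (cball (0::'a) 1)"
      using ne by (simp add: aff_dim_nonempty_interior aff_dim_cball)
  qed (simp_all add: convex_convex_hull)
  then have "frontier ?S homeomorphic sphere (0::'a) 1"
    using ne by (simp add: rel_frontier_nonempty_interior)
  then show ?thesis by (rule homeomorphic_trans[OF homeomorphic_trans[OF 1 bdry_option_carrier]])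
qed

subsection \<open>Combinatorial spheres\<close>

lemma mem_link_complex:
  assumes "abstract_complex K"
  shows "\<tau> \<in> link_complex \<sigma> K \<longleftrightarrow> \<tau> \<inter> \<sigma> = {} \<and> \<tau> \<union> \<sigma> \<in> K"
proof -
  have "\<tau> \<in> K" if "\<tau> \<union> \<sigma> \<in> K"
    using assms that unfolding abstract_complex_def by (meson sup_ge1)
  then show ?thesis unfolding link_complex_def by blast
qed

lemma abstract_complex_link:
  assumes K: "abstract_complex K" and "\<sigma> \<in> K"
  shows "abstract_complex (link_complex \<sigma> K)" unfolding abstract_complex_def
proof (intro conjI ballI allI impI)
  have sub: "link_complex \<sigma> K \<subseteq> K" unfolding link_complex_def by blast
  show "finite (link_complex \<sigma> K)"
    using K sub finite_subset unfolding abstract_complex_def by metis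
  show "{} \<in> link_complex \<sigma> K" using assms by (simp add: mem_link_complex)
  show "finite \<tau>" if "\<tau> \<in> link_complex \<sigma> K" for \<tau>
    using K sub that unfolding abstract_complex_def by auto
  show "\<rho> \<in> link_complex \<sigma> K" if "\<tau> \<in> link_complex \<sigma> K" "\<rho> \<subseteq> \<tau>" for \<tau> \<rho>
  proof -
    have "\<rho> \<union> \<sigma> \<subseteq> \<tau> \<union> \<sigma>" "\<tau> \<union> \<sigma> \<in> K" "\<rho> \<inter> \<sigma> = {}"
      using that unfolding mem_link_complex[OF K] by auto
    then show ?thesis using K unfolding mem_link_complex[OF K] abstract_complex_def by metis
  qed
qed

lemma link_complex_empty [simp]: "link_complex {} K = K" unfolding link_complex_def by auto

text \<open>\<open>bdry {..<n}\<close> is a model of the sphere of dimension n - 2, so one formula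
  covers all faces: \<open>\<sigma> = {}\<close> gives the d-sphere, a ridge gives two points, and a
  facet gives \<open>bdry {0} = {{}}\<close>, whose carrier is empty. Imposing the condition on all
  links is what makes it survive flips.\<close>

definition sphere_complex :: "nat \<Rightarrow> 'v set set \<Rightarrow> bool" where
  "sphere_complex d K \<longleftrightarrow> abstract_complex K \<and>
     (\<forall>\<sigma>\<in>K. card \<sigma> \<le> Suc d \<and>
       geometric_carrier (link_complex \<sigma> K) homeomorphic
         geometric_carrier (bdry {..<Suc (Suc d) - card \<sigma>}))"

lemma link_bdry:
  assumes "\<sigma> \<in> bdry V"
  shows "link_complex \<sigma> (bdry V) = bdry (V - \<sigma>)"
  using assms unfolding link_complex_def bdry_def by auto

lemma sphere_complex_bdry:
  assumes "card V = Suc (Suc d)"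
  shows "sphere_complex d (bdry V)"
proof -
  have V: "finite V" "V \<noteq> {}" using assms card.infinite by fastforce+
  have "card \<sigma> \<le> Suc d \<and> geometric_carrier (link_complex \<sigma> (bdry V)) homeomorphic
         geometric_carrier (bdry {..<Suc (Suc d) - card \<sigma>})" if \<sigma>: "\<sigma> \<in> bdry V" for \<sigma>
  proof
    have "\<sigma> \<subset> V" using \<sigma> unfolding bdry_def by simp
    then have "card \<sigma> < card V" "card (V - \<sigma>) = card V - card \<sigma>"
      using V by (auto simp: psubset_card_mono card_Diff_subset finite_subset)
    then show "card \<sigma> \<le> Suc d" using assms by simp
    show "geometric_carrier (link_complex \<sigma> (bdry V)) homeomorphic
         geometric_carrier (bdry {..<Suc (Suc d) - card \<sigma>})" unfolding link_bdry[OF \<sigma>]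
      using V \<open>card (V - \<sigma>) = _\<close> assms
      by (intro complex_isomorphic_carrier complex_isomorphic_bdry) auto
  qed
  then show ?thesis unfolding sphere_complex_def using abstract_complex_bdry[OF V] by blast
qed

section \<open>Links under bistellar flips\<close>

lemma link_flip_old:
  assumes fl: "flippable A B K" and \<sigma>: "\<sigma> \<in> K" "\<not> A \<subseteq> \<sigma>" "\<sigma> \<subseteq> A \<union> B"
  shows "flippable (A - \<sigma>) (B - \<sigma>) (link_complex \<sigma> K)"
    and "link_complex \<sigma> (flip A B K) = flip (A - \<sigma>) (B - \<sigma>) (link_complex \<sigma> K)"
proof -
  have cx: "abstract_complex K" and disj: "A \<inter> B = {}" and BK: "B \<notin> K"
    and sub: "\<And>\<sigma> \<tau>. \<sigma> \<in> K \<Longrightarrow> \<tau> \<subseteq> \<sigma> \<Longrightarrow> \<tau> \<in> K" and fin: "finite A" "finite B"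
    using fl unfolding flippable_def abstract_complex_def by blast+
  note lk = mem_link_complex[OF cx] and lk' = mem_link_complex[OF abstract_complex_flip[OF fl]]
  note star = flippable_star[OF fl]
  have nB: "\<not> B \<subseteq> \<rho>" if "\<rho> \<in> K" for \<rho>
    using sub[OF that] BK by blast
  have "(A - \<sigma>) \<union> \<sigma> \<in> K"
    using star[of "A \<union> \<sigma>"] nB[OF \<sigma>(1)] disj \<sigma>(3) by (auto simp: Un_Diff_cancel2)
  then have 1: "A - \<sigma> \<in> link_complex \<sigma> K" unfolding lk by blast
  have "B \<subseteq> (B - \<sigma>) \<union> \<sigma>" by blast
  then have 2: "B - \<sigma> \<notin> link_complex \<sigma> K" using nB unfolding lk by blast
  \<comment> \<open>The star of \<open>A\<close> is the join of \<open>A\<close> with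
    \<open>bdry B\<close>; passing to the link of \<open>\<sigma>\<close>, which contains neither
    \<open>A\<close> nor \<open>B\<close>, removes its vertices from both factors.\<close>
  have 3: "link_complex (A - \<sigma>) (link_complex \<sigma> K) = bdry (B - \<sigma>)"
  proof (intro set_eqI)
    fix \<tau>
    have "\<tau> \<in> link_complex (A - \<sigma>) (link_complex \<sigma> K) \<longleftrightarrow>
      \<tau> \<inter> (A - \<sigma>) = {} \<and> (\<tau> \<union> (A - \<sigma>)) \<inter> \<sigma> = {} \<and> (\<tau> \<union> (A - \<sigma>)) \<union> \<sigma> \<in> K"
      unfolding mem_link_complex[OF abstract_complex_link[OF cx \<sigma>(1)]] lk by blast
    also have "(\<tau> \<union> (A - \<sigma>)) \<union> \<sigma> = A \<union> (\<tau> \<union> \<sigma>)" by blast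
    also have "A \<union> (\<tau> \<union> \<sigma>) \<in> K \<longleftrightarrow> \<tau> \<union> \<sigma> \<subseteq> A \<union> B \<and> \<not> B \<subseteq> \<tau> \<union> \<sigma>"
      using star[of "A \<union> (\<tau> \<union> \<sigma>)"] disj by blast
    finally show "\<tau> \<in> link_complex (A - \<sigma>) (link_complex \<sigma> K) \<longleftrightarrow> \<tau> \<in> bdry (B - \<sigma>)"
      using \<sigma> disj unfolding bdry_def by blast
  qed
  show "flippable (A - \<sigma>) (B - \<sigma>) (link_complex \<sigma> K)" unfolding flippable_def
    using abstract_complex_link[OF cx \<sigma>(1)] 1 2 3 fin disj \<sigma>(2) nB[OF \<sigma>(1)] by blast
  show "link_complex \<sigma> (flip A B K) = flip (A - \<sigma>) (B - \<sigma>) (link_complex \<sigma> K)"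
  proof (intro set_eqI)
    fix \<tau>
    show "\<tau> \<in> link_complex \<sigma> (flip A B K) \<longleftrightarrow> \<tau> \<in> flip (A - \<sigma>) (B - \<sigma>) (link_complex \<sigma> K)"
      unfolding lk' unfolding flip_def Un_iff mem_Collect_eq lk using \<sigma> by blast
  qed
qed

lemma link_flip_other:
  assumes fl: "flippable A B K" and \<sigma>: "\<not> \<sigma> \<subseteq> A \<union> B"
  shows "link_complex \<sigma> (flip A B K) = link_complex \<sigma> K"
proof (intro set_eqI)
  fix \<tau>
  have cx: "abstract_complex K" using fl unfolding flippable_def by blast
  show "\<tau> \<in> link_complex \<sigma> (flip A B K) \<longleftrightarrow> \<tau> \<in> link_complex \<sigma> K"
    unfolding mem_link_complex[OF abstract_complex_flip[OF fl]] mem_link_complex[OF cx]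
    using flippable_star[OF fl, of "\<tau> \<union> \<sigma>"] \<sigma> unfolding flip_def by blast
qed

text \<open>As \<open>B\<close> was not a face of \<open>K\<close>, every face of the flip that
  contains \<open>\<sigma>\<close> lies in the new ball, the join of \<open>bdry A\<close> with
  \<open>B\<close>; the link is therefore that of \<open>\<sigma> \<inter> A\<close> in
  \<open>bdry A\<close>.\<close>

lemma link_flip_new:
  assumes fl: "flippable A B K" and \<sigma>: "B \<subseteq> \<sigma>" "\<sigma> \<subseteq> A \<union> B"
  shows "link_complex \<sigma> (flip A B K) = bdry (A - \<sigma>)"
proof (intro set_eqI)
  fix \<tau>
  have BK: "B \<notin> K" and disj: "A \<inter> B = {}" and cx: "abstract_complex K"
    using fl unfolding flippable_def by blast+
  have "B \<subseteq> \<tau> \<union> \<sigma>" using \<sigma>(1) by blast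
  then have old: "\<tau> \<union> \<sigma> \<notin> K"
    using BK cx unfolding abstract_complex_def by metis
  have "\<tau> \<inter> \<sigma> = {} \<and> \<tau> \<union> \<sigma> \<subseteq> A \<union> B \<and> \<not> A \<subseteq> \<tau> \<union> \<sigma> \<longleftrightarrow> \<tau> \<subset> A - \<sigma>"
    using \<sigma> disj by blast
  then show "\<tau> \<in> link_complex \<sigma> (flip A B K) \<longleftrightarrow> \<tau> \<in> bdry (A - \<sigma>)"
    unfolding mem_link_complex[OF abstract_complex_flip[OF fl]] unfolding flip_def bdry_def
    using old \<open>B \<subseteq> \<tau> \<union> \<sigma>\<close> by simp
qed

text \<open>Old faces inside \<open>A \<union> B\<close> have their links flipped, old faces
  elsewhere keep them, and new faces have boundaries of simplices as links. The size condition on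
  \<open>A\<close> and \<open>B\<close> gives the latter the right dimension.\<close>

lemma sphere_complex_flip:
  assumes K: "sphere_complex d K" and fl: "flippable A B K" and AB: "card A + card B = Suc (Suc d)"
  shows "sphere_complex d (flip A B K)" unfolding sphere_complex_def
proof (intro conjI ballI)
  show "abstract_complex (flip A B K)" by (rule abstract_complex_flip[OF fl])
  fix \<sigma> assume \<sigma>: "\<sigma> \<in> flip A B K"
  have fin: "finite A" "finite B" and disj: "A \<inter> B = {}"
    using fl unfolding flippable_def by blast+
  let ?S = "geometric_carrier (bdry {..<Suc (Suc d) - card \<sigma>})"
  have "card \<sigma> \<le> Suc d \<and> geometric_carrier (link_complex \<sigma> (flip A B K)) homeomorphic ?S"
  proof (cases "\<sigma> \<in> K")
    case True
    then have old: "card \<sigma> \<le> Suc d" "geometric_carrier (link_complex \<sigma> K) homeomorphic ?S"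
      using K unfolding sphere_complex_def by auto
    show ?thesis
    proof (cases "\<sigma> \<subseteq> A \<union> B")
      case sub: True
      have "\<not> A \<subseteq> \<sigma>" using \<sigma> unfolding flip_def by blast
      note lf = link_flip_old[OF fl True this sub]
      have "geometric_carrier (link_complex \<sigma> (flip A B K)) homeomorphic
          geometric_carrier (link_complex \<sigma> K)"
        unfolding lf(2) by (subst homeomorphic_sym) (rule flip_carrier_homeomorphic[OF lf(1)])
      then show ?thesis using old homeomorphic_trans by blast
    next
      case False
      then show ?thesis using link_flip_other[OF fl] old by simp
    qed
  next
    case False
    then have s: "B \<subseteq> \<sigma>" "\<sigma> \<subseteq> A \<union> B" "\<not> A \<subseteq> \<sigma>"
      using \<sigma> unfolding flip_def by blast+
    then have "\<sigma> = B \<union> (\<sigma> \<inter> A)" by blast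
    then have c: "card \<sigma> = card B + card (\<sigma> \<inter> A)"
      using fin disj by (metis card_Un_disjoint finite_Int inf_commute inf_assoc inf_bot_right)
    have "card (A - \<sigma>) = card A - card (\<sigma> \<inter> A)"
      using fin by (metis card_Diff_subset_Int finite_Int inf_commute)
    moreover have "card (\<sigma> \<inter> A) < card A"
      using s fin by (intro psubset_card_mono) auto
    ultimately have cA: "card (A - \<sigma>) = Suc (Suc d) - card \<sigma>" and "card \<sigma> \<le> Suc d"
      using c AB by linarith+
    moreover have "geometric_carrier (bdry (A - \<sigma>)) homeomorphic ?S"
      using fin cA by (intro complex_isomorphic_carrier complex_isomorphic_bdry) auto
    ultimately show ?thesis using link_flip_new[OF fl s(1,2)] by simp
  qed
  then show "card \<sigma> \<le> Suc d"
    "geometric_carrier (link_complex \<sigma> (flip A B K)) homeomorphic ?S" by blast+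
qed

lemma complex_isomorphic_link:
  assumes f: "bij_betw f (\<Union>K) (\<Union>L)" "L = (\<lambda>\<sigma>. f ` \<sigma>) ` K" and \<sigma>: "\<sigma> \<in> K"
  shows "complex_isomorphic (link_complex \<sigma> K) (link_complex (f ` \<sigma>) L)"
proof -
  have inj: "inj_on f (\<Union>K)" using f(1) unfolding bij_betw_def by blast
  have lk: "link_complex (f ` \<sigma>) L = (\<lambda>\<rho>. f ` \<rho>) ` link_complex \<sigma> K"
  proof (intro equalityI subsetI)
    fix \<rho> assume "\<rho> \<in> link_complex (f ` \<sigma>) L"
    then have r: "\<rho> \<inter> f ` \<sigma> = {}" "\<rho> \<union> f ` \<sigma> \<in> L" "\<rho> \<in> L"
      unfolding link_complex_def by blast+
    then obtain \<alpha> \<beta> where ab: "\<alpha> \<in> K" "\<rho> = f ` \<alpha>" "\<beta> \<in> K" "\<rho> \<union> f ` \<sigma> = f ` \<beta>"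
      unfolding f(2) by blast
    have "f ` (\<alpha> \<union> \<sigma>) = f ` \<beta>" using ab by (simp add: image_Un)
    then have "\<alpha> \<union> \<sigma> = \<beta>"
      using ab(1,3) \<sigma> by (subst (asm) inj_on_image_eq_iff[OF inj]) auto
    moreover have "\<alpha> \<inter> \<sigma> = {}" using r(1) ab(2) by blast
    ultimately show "\<rho> \<in> (\<lambda>\<rho>. f ` \<rho>) ` link_complex \<sigma> K"
      using ab unfolding link_complex_def by blast
  next
    fix \<rho> assume "\<rho> \<in> (\<lambda>\<rho>. f ` \<rho>) ` link_complex \<sigma> K"
    then obtain \<alpha> where a: "\<alpha> \<in> K" "\<alpha> \<inter> \<sigma> = {}" "\<alpha> \<union> \<sigma> \<in> K" "\<rho> = f ` \<alpha>"
      unfolding link_complex_def by blast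
    have "f ` \<alpha> \<inter> f ` \<sigma> = f ` (\<alpha> \<inter> \<sigma>)"
      using a(1) \<sigma> by (intro inj_on_image_Int[OF inj, symmetric]) auto
    moreover have "f ` \<alpha> \<union> f ` \<sigma> \<in> L"
      unfolding image_Un[symmetric] f(2) using a(3) by (rule imageI)
    ultimately show "\<rho> \<in> link_complex (f ` \<sigma>) L"
      using a f(2) unfolding link_complex_def by simp
  qed
  have "\<Union>(link_complex \<sigma> K) \<subseteq> \<Union>K" unfolding link_complex_def by blast
  moreover have "\<Union>(link_complex (f ` \<sigma>) L) = f ` \<Union>(link_complex \<sigma> K)"
    unfolding lk by blast
  ultimately have "bij_betw f (\<Union>(link_complex \<sigma> K)) (\<Union>(link_complex (f ` \<sigma>) L))"
    using inj_on_subset[OF inj] unfolding bij_betw_def by simp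
  then show ?thesis using lk unfolding complex_isomorphic_def by blast
qed

lemma sphere_complex_isomorphic:
  assumes K: "sphere_complex d K" and iso: "complex_isomorphic K L"
  shows "sphere_complex d L"
proof -
  obtain f where f: "bij_betw f (\<Union>K) (\<Union>L)" "L = (\<lambda>\<sigma>. f ` \<sigma>) ` K"
    using iso unfolding complex_isomorphic_def by blast
  have inj: "inj_on f (\<Union>K)" using f(1) unfolding bij_betw_def by blast
  have cx: "abstract_complex K" using K unfolding sphere_complex_def by blast
  have cL: "abstract_complex L" unfolding abstract_complex_def
  proof (intro conjI ballI allI impI)
    show "\<rho> \<in> L" if "\<tau> \<in> L" "\<rho> \<subseteq> \<tau>" for \<tau> \<rho>
    proof -
      obtain \<sigma> where s: "\<sigma> \<in> K" "\<tau> = f ` \<sigma>" using f(2) \<open>\<tau> \<in> L\<close> by blast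
      then obtain \<sigma>' where "\<sigma>' \<subseteq> \<sigma>" "\<rho> = f ` \<sigma>'"
        using \<open>\<rho> \<subseteq> \<tau>\<close> by (metis subset_image_iff)
      moreover have "\<sigma>' \<in> K"
        using cx s \<open>\<sigma>' \<subseteq> \<sigma>\<close> unfolding abstract_complex_def by blast
      ultimately show ?thesis unfolding f(2) by blast
    qed
  qed (use cx f(2) in \<open>auto simp: abstract_complex_def\<close>)
  have "card \<tau> \<le> Suc d \<and> geometric_carrier (link_complex \<tau> L) homeomorphic
         geometric_carrier (bdry {..<Suc (Suc d) - card \<tau>})" if "\<tau> \<in> L" for \<tau>
  proof -
    obtain \<sigma> where s: "\<sigma> \<in> K" "\<tau> = f ` \<sigma>" using f(2) \<open>\<tau> \<in> L\<close> by blast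
    have "inj_on f \<sigma>" using inj_on_subset[OF inj] s(1) by blast
    then have card: "card \<tau> = card \<sigma>" unfolding s(2) by (rule card_image)
    have "complex_isomorphic (link_complex \<sigma> K) (link_complex \<tau> L)"
      unfolding s(2) by (rule complex_isomorphic_link[OF f s(1)])
    then have "geometric_carrier (link_complex \<tau> L) homeomorphic geometric_carrier (link_complex \<sigma> K)"
      by (subst homeomorphic_sym) (rule complex_isomorphic_carrier)
    moreover have "card \<sigma> \<le> Suc d \<and> geometric_carrier (link_complex \<sigma> K) homeomorphic
         geometric_carrier (bdry {..<Suc (Suc d) - card \<sigma>})"
      using K s(1) unfolding sphere_complex_def by blast
    ultimately show ?thesis unfolding card using homeomorphic_trans by blast
  qed
  then show ?thesis using cL unfolding sphere_complex_def by blast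
qed

section \<open>Purity and ridges of complexes with spherical links\<close>

lemma sphere_complex_extend:
  assumes K: "sphere_complex d K" and \<sigma>: "\<sigma> \<in> K" "card \<sigma> \<le> d"
  obtains v where "v \<notin> \<sigma>" "insert v \<sigma> \<in> K"
proof -
  have cx: "abstract_complex K"
    and hom: "geometric_carrier (link_complex \<sigma> K) homeomorphic
         geometric_carrier (bdry {..<Suc (Suc d) - card \<sigma>})"
    using K \<sigma> unfolding sphere_complex_def by blast+
  \<comment> \<open>The vertex 0 of the model sphere, as a point. It shows that the model has a
    nonempty carrier when \<open>card \<sigma> \<le> d\<close>, so the link has a point and
    therefore a vertex.\<close>
  let ?e = "\<lambda>v :: nat. if v = 0 then 1 else (0 :: real)"
  have "{v. ?e v \<noteq> 0} = {0}" by auto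
  moreover have "{0} \<in> bdry {..<Suc (Suc d) - card \<sigma>}"
  proof -
    have "0 \<in> {..<Suc (Suc d) - card \<sigma>}" "1 \<in> {..<Suc (Suc d) - card \<sigma>}" "(1 :: nat) \<notin> {0}"
      using \<sigma>(2) by auto
    then show ?thesis unfolding bdry_def by blast
  qed
  moreover have "\<Union>(bdry {..<Suc (Suc d) - card \<sigma>}) \<subseteq> {..<Suc (Suc d) - card \<sigma>}"
    unfolding bdry_def by blast
  ultimately have "?e \<in> geometric_carrier (bdry {..<Suc (Suc d) - card \<sigma>})"
    using \<sigma>(2) by (subst carrier_memI_superset[of "{..<Suc (Suc d) - card \<sigma>}"]) simp_all
  then obtain x where x: "x \<in> geometric_carrier (link_complex \<sigma> K)"
    using homeomorphic_empty(2) hom by fastforce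
  then have "(\<Sum>v\<in>\<Union>(link_complex \<sigma> K). x v) = 1" and s: "{v. x v \<noteq> 0} \<in> link_complex \<sigma> K"
    unfolding geometric_carrier_def by auto
  then have "\<not> (\<forall>v\<in>\<Union>(link_complex \<sigma> K). x v = 0)"
    by (metis sum.neutral zero_neq_one)
  then obtain v where "x v \<noteq> 0" by blast
  then have "{v} \<subseteq> {v. x v \<noteq> 0}" by simp
  then have "{v} \<in> link_complex \<sigma> K"
    using abstract_complex_link[OF cx \<sigma>(1)] s unfolding abstract_complex_def by metis
  then show thesis by (intro that[of v]) (simp_all add: mem_link_complex[OF cx])
qed

lemma sphere_complex_facet:
  assumes K: "sphere_complex d K" and "\<sigma> \<in> K"
  shows "\<exists>F\<in>faces_of_dim d K. \<sigma> \<subseteq> F" using assms(2)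
proof (induction "Suc d - card \<sigma>" arbitrary: \<sigma>)
  case 0
  then have "card \<sigma> = Suc d" using K unfolding sphere_complex_def by fastforce
  then show ?case using 0 unfolding faces_of_dim_def by auto
next
  case (Suc n)
  have "card \<sigma> \<le> d" using Suc.hyps(2) by linarith
  then obtain v where v: "v \<notin> \<sigma>" "insert v \<sigma> \<in> K"
    by (rule sphere_complex_extend[OF K Suc.prems])
  have "finite \<sigma>"
    using K Suc.prems unfolding sphere_complex_def abstract_complex_def by blast
  then have "\<exists>F\<in>faces_of_dim d K. insert v \<sigma> \<subseteq> F"
    using v Suc.hyps by (intro Suc.hyps(1)) auto
  then show ?case by blast
qed

text \<open>A complex consisting of isolated vertices has these vertices as its points; thus a
  homeomorphism, being a bijection, can count vertices.\<close>

lemma carrier_of_points: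
  assumes "finite V" and L: "{} \<in> L" "\<And>\<tau>. \<tau> \<in> L \<Longrightarrow> \<tau> = {} \<or> (\<exists>v\<in>V. \<tau> = {v})"
    "\<And>v. v \<in> V \<Longrightarrow> {v} \<in> L"
  shows "bij_betw (\<lambda>v w. if w = v then 1 else (0::real)) V (geometric_carrier L)"
  unfolding bij_betw_def
proof
  show "inj_on (\<lambda>v w. if w = v then 1 else (0::real)) V"
    by (rule inj_onI) (metis zero_neq_one)
  have UL: "\<Union>L = V" using L by blast
  show "(\<lambda>v w. if w = v then 1 else (0::real)) ` V = geometric_carrier L"
  proof (intro equalityI subsetI)
    fix x assume "x \<in> geometric_carrier L"
    then have x: "(\<Sum>v\<in>V. x v) = 1" "{v. x v \<noteq> 0} \<in> L"
      unfolding geometric_carrier_def UL by auto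
    have "{v. x v \<noteq> 0} \<noteq> {}"
    proof
      assume "{v. x v \<noteq> 0} = {}"
      then have "\<And>v. x v = 0" by blast
      then show False using x(1) by simp
    qed
    then obtain v where v: "v \<in> V" "{v. x v \<noteq> 0} = {v}" using L(2)[OF x(2)] by blast
    then have z: "x w = 0" if "w \<noteq> v" for w using that by blast
    have "(\<Sum>w\<in>V. x w) = (\<Sum>w\<in>{v}. x w)"
      using v(1) z \<open>finite V\<close> by (intro sum.mono_neutral_right) auto
    then have "x = (\<lambda>w. if w = v then 1 else 0)" using z x(1) by auto
    then show "x \<in> (\<lambda>v w. if w = v then 1 else (0::real)) ` V" using v(1) by blast
  next
    fix x assume "x \<in> (\<lambda>v w. if w = v then 1 else (0::real)) ` V"
    then obtain v where v: "v \<in> V" "x = (\<lambda>w. if w = v then 1 else 0)" by blast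
    then show "x \<in> geometric_carrier L"
      using \<open>finite V\<close> L(3)[OF v(1)] unfolding geometric_carrier_def UL by (simp add: sum.delta)
  qed
qed

text \<open>The link of a ridge is homeomorphic to the boundary of an edge, which has two points. So
  the link has two vertices, and each completes the ridge to one facet.\<close>

lemma sphere_complex_ridge:
  assumes K: "sphere_complex d K" and \<sigma>: "\<sigma> \<in> K" "card \<sigma> = d"
  shows "card {F \<in> faces_of_dim d K. \<sigma> \<subseteq> F} = 2"
proof -
  have cx: "abstract_complex K" and le: "\<And>\<sigma>. \<sigma> \<in> K \<Longrightarrow> card \<sigma> \<le> Suc d"
    and fin: "finite \<sigma>" "\<And>\<sigma>. \<sigma> \<in> K \<Longrightarrow> finite \<sigma>"
    and hom: "geometric_carrier (link_complex \<sigma> K) homeomorphic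
         geometric_carrier (bdry {..<Suc (Suc d) - card \<sigma>})"
    using K \<sigma> unfolding sphere_complex_def abstract_complex_def by blast+
  define V where "V = {v. {v} \<in> link_complex \<sigma> K}"
  have "V \<subseteq> \<Union>K" unfolding V_def link_complex_def by blast
  then have finV: "finite V" using abstract_complex_finite_vertices[OF cx] finite_subset by blast
  have "bij_betw (\<lambda>v w. if w = v then 1 else (0::real)) V (geometric_carrier (link_complex \<sigma> K))"
  proof (rule carrier_of_points[OF finV])
    show "{} \<in> link_complex \<sigma> K" using \<sigma> by (simp add: mem_link_complex[OF cx])
    fix \<tau> assume \<tau>: "\<tau> \<in> link_complex \<sigma> K"
    then have t: "\<tau> \<inter> \<sigma> = {}" "\<tau> \<union> \<sigma> \<in> K" "\<tau> \<in> K"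
      unfolding link_complex_def by blast+
    then have "card \<tau> + card \<sigma> \<le> Suc d"
      using le[OF t(2)] fin by (simp add: card_Un_disjoint)
    then have "card \<tau> \<le> 1" using \<sigma> by simp
    then have "card \<tau> = 0 \<or> card \<tau> = 1" by linarith
    then have "\<tau> = {} \<or> (\<exists>v. \<tau> = {v})"
      using fin(2)[OF t(3)] by (auto simp: card_1_singleton_iff)
    then show "\<tau> = {} \<or> (\<exists>v\<in>V. \<tau> = {v})"
      using \<tau> unfolding V_def by blast
  qed (simp add: V_def)
  moreover have "bij_betw (\<lambda>v w. if w = v then 1 else (0::real)) {0, Suc 0}
      (geometric_carrier (bdry {..<Suc (Suc d) - card \<sigma>}))"
  proof (rule carrier_of_points)
    have "{..<Suc (Suc d) - card \<sigma>} = {0, Suc 0}" using \<sigma> by auto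
    then show "{} \<in> bdry {..<Suc (Suc d) - card \<sigma>}"
      and "\<And>\<tau>. \<tau> \<in> bdry {..<Suc (Suc d) - card \<sigma>} \<Longrightarrow> \<tau> = {} \<or> (\<exists>v\<in>{0, Suc 0}. \<tau> = {v})"
      and "\<And>v. v \<in> {0, Suc 0} \<Longrightarrow> {v} \<in> bdry {..<Suc (Suc d) - card \<sigma>}"
      unfolding bdry_def by auto
  qed simp
  moreover obtain h k where hk: "homeomorphism (geometric_carrier (link_complex \<sigma> K))
      (geometric_carrier (bdry {..<Suc (Suc d) - card \<sigma>})) h k"
    using hom unfolding homeomorphic_def by blast
  have "bij_betw h (geometric_carrier (link_complex \<sigma> K))
      (geometric_carrier (bdry {..<Suc (Suc d) - card \<sigma>}))"
    by (rule bij_betw_byWitness[of _ k]) (use hk in \<open>auto simp: homeomorphism_def\<close>)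
  ultimately have "card V = card {0, Suc 0}" using bij_betw_same_card by metis
  then have "card V = 2" by simp
  moreover have "bij_betw (\<lambda>v. insert v \<sigma>) V {F \<in> faces_of_dim d K. \<sigma> \<subseteq> F}"
    unfolding bij_betw_def
  proof
    show "inj_on (\<lambda>v. insert v \<sigma>) V"
      unfolding V_def mem_link_complex[OF cx] by (intro inj_onI) auto
    show "(\<lambda>v. insert v \<sigma>) ` V = {F \<in> faces_of_dim d K. \<sigma> \<subseteq> F}"
    proof (intro equalityI subsetI)
      fix F assume "F \<in> {F \<in> faces_of_dim d K. \<sigma> \<subseteq> F}"
      then have F: "F \<in> K" "card F = Suc d" "\<sigma> \<subseteq> F"
        unfolding faces_of_dim_def by auto
      then have "card (F - \<sigma>) = 1" using \<sigma> fin by (simp add: card_Diff_subset)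
      then obtain v where "F - \<sigma> = {v}" by (auto simp: card_1_singleton_iff)
      then have "F = insert v \<sigma>" "v \<notin> \<sigma>" using F(3) by auto
      then show "F \<in> (\<lambda>v. insert v \<sigma>) ` V"
        using F(1) unfolding V_def mem_link_complex[OF cx] by auto
    next
      fix F assume "F \<in> (\<lambda>v. insert v \<sigma>) ` V"
      then show "F \<in> {F \<in> faces_of_dim d K. \<sigma> \<subseteq> F}"
        using \<sigma> fin unfolding V_def mem_link_complex[OF cx] faces_of_dim_def by auto
    qed
  qed
  ultimately show ?thesis using bij_betw_same_card by metis
qed

lemma sphere_complex_carrier:
  assumes K: "sphere_complex d K" and \<sigma>: "\<sigma> \<in> K" and d: "d = card \<sigma> + DIM('a::euclidean_space) - 1"
  shows "geometric_carrier (link_complex \<sigma> K) homeomorphic sphere (0 :: 'a) 1"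
proof -
  have "geometric_carrier (link_complex \<sigma> K) homeomorphic
         geometric_carrier (bdry {..<Suc (Suc d) - card \<sigma>})"
    using K \<sigma> unfolding sphere_complex_def by blast
  moreover have "geometric_carrier (bdry {..<Suc (Suc d) - card \<sigma>}) homeomorphic sphere (0 :: 'a) 1"
    using d DIM_positive[where 'a='a] by (intro bdry_carrier_sphere) auto
  ultimately show ?thesis by (rule homeomorphic_trans)
qed

theorem combinatorial_3_sphere_if_sphere_complex:
  assumes K: "sphere_complex 3 K"
  shows "combinatorial_3_sphere K"
proof -
  have cx: "abstract_complex K" and le: "\<And>\<sigma>. \<sigma> \<in> K \<Longrightarrow> card \<sigma> \<le> 4" and e: "{} \<in> K"
    using K unfolding sphere_complex_def abstract_complex_def by auto
  have pure: "pure_complex 3 K" unfolding pure_complex_def complex_dim_def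
    using sphere_complex_facet[OF K] cx le e by auto
  have car: "geometric_carrier K homeomorphic sphere (0 :: real^4) 1"
    using sphere_complex_carrier[OF K e, where 'a="real^4"] by simp
  have link1: "geometric_carrier (link_complex \<sigma> K) homeomorphic sphere (0 :: real^3) 1"
    if "\<sigma> \<in> K" "card \<sigma> = 1" for \<sigma>
    using sphere_complex_carrier[OF K that(1), where 'a="real^3"] that(2) by simp
  have link2: "geometric_carrier (link_complex \<sigma> K) homeomorphic sphere (0 :: real^2) 1"
    if "\<sigma> \<in> K" "card \<sigma> = 2" for \<sigma>
    using sphere_complex_carrier[OF K that(1), where 'a="real^2"] that(2) by simp
  have conn: "connected_complex (link_complex \<sigma> K)" if s: "\<sigma> \<in> K" "card \<sigma> < 3" for \<sigma>
  proof -
    have "finite \<sigma>" using cx s unfolding abstract_complex_def by blast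
    then consider "\<sigma> = {}" | "card \<sigma> = 1" | "card \<sigma> = 2"
      using s(2) by (metis One_nat_def card_0_eq less_2_cases less_Suc_eq numeral_3_eq_3 numeral_2_eq_2)
    then show ?thesis
    proof cases
      case 1
      then show ?thesis
        using homeomorphic_connectedness[OF car] connected_sphere[of "0 :: real^4" 1]
        unfolding connected_complex_def by simp
    next
      case 2
      then show ?thesis
        using homeomorphic_connectedness[OF link1[OF s(1) 2]] connected_sphere[of "0 :: real^3" 1]
        unfolding connected_complex_def by simp
    next
      case 3
      then show ?thesis
        using homeomorphic_connectedness[OF link2[OF s(1) 3]] connected_sphere[of "0 :: real^2" 1]
        unfolding connected_complex_def by simp
    qed
  qed
  have "{v} \<in> K" if "v \<in> \<Union>K" for v
    using cx that unfolding abstract_complex_def by blast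
  then have "combinatorial_3_manifold K"
    unfolding combinatorial_3_manifold_def normal_pseudomanifold_def weak_pseudomanifold_def
    using pure sphere_complex_ridge[OF K] conn conn[OF e] link1 by simp
  then show ?thesis using car unfolding combinatorial_3_sphere_def by blast
qed

subsection \<open>A non-separating triangle obstructs the 2-sphere\<close>

lemma indicator_in_carrier:
  assumes "abstract_complex L" "v \<in> \<Union>L"
  shows "(\<lambda>w. if w = v then 1 else 0) \<in> geometric_carrier L"
proof -
  have "{v} \<in> L" using assms unfolding abstract_complex_def by blast
  moreover have "{w. (if w = v then 1 else (0::real)) \<noteq> 0} = {v}" by auto
  ultimately show ?thesis using assms(2) abstract_complex_finite_vertices[OF assms(1)]
    unfolding geometric_carrier_def by (simp add: sum.delta)
qed

text \<open>The total weight that a point puts on the vertices of \<open>K1\<close> is continuous,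
  takes only the values 0 and 1 because each support lies on one side, and takes both; a connected
  carrier would also give 1/2.\<close>

lemma connected_carrier_vertex_partition:
  assumes cx: "abstract_complex L" and con: "connected_complex L"
    and L: "L = K1 \<union> K2" "\<Union>K1 \<inter> \<Union>K2 = {}" and v: "v \<in> \<Union>K1" and w: "w \<in> \<Union>K2"
  shows False
proof -
  define \<phi> where "\<phi> x = (\<Sum>u\<in>\<Union>K1. x u)" for x :: "'a \<Rightarrow> real"
  have fin: "finite (\<Union>L)" by (rule abstract_complex_finite_vertices[OF cx])
  have val: "\<phi> x = 0 \<or> \<phi> x = 1" if x: "x \<in> geometric_carrier L" for x
  proof -
    have s: "{u. x u \<noteq> 0} \<in> L" and sum: "(\<Sum>u\<in>\<Union>L. x u) = 1"
      using x unfolding geometric_carrier_def by auto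
    show ?thesis
    proof (cases "{u. x u \<noteq> 0} \<in> K1")
      case True
      then have "\<phi> x = (\<Sum>u\<in>\<Union>L. x u)"
        unfolding \<phi>_def using fin L(1) by (intro sum.mono_neutral_left) auto
      then show ?thesis using sum by simp
    next
      case False
      then have "{u. x u \<noteq> 0} \<in> K2" using s L(1) by blast
      then have "x u = 0" if "u \<in> \<Union>K1" for u using L(2) that by blast
      then show ?thesis unfolding \<phi>_def by simp
    qed
  qed
  have "\<phi> (\<lambda>u. if u = v then 1 else 0) = 1"
    unfolding \<phi>_def using v fin L(1) by (simp add: sum.delta finite_subset[of "\<Union>K1" "\<Union>L"])
  moreover have "\<phi> (\<lambda>u. if u = w then 1 else 0) = 0"
    unfolding \<phi>_def using w L(2) by (intro sum.neutral) auto
  moreover have "v \<in> \<Union>L" "w \<in> \<Union>L" using v w L(1) by blast+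
  ultimately have im: "0 \<in> \<phi> ` geometric_carrier L" "1 \<in> \<phi> ` geometric_carrier L"
    using indicator_in_carrier[OF cx] by (metis imageI)+
  have "connected (\<phi> ` geometric_carrier L)"
    using con unfolding connected_complex_def \<phi>_def
    by (intro connected_continuous_image continuous_on_sum continuous_on_coordinate)
  then have "{0..1} \<subseteq> \<phi> ` geometric_carrier L"
    using im by (rule connected_contains_Icc)
  then have "1 / 2 \<in> \<phi> ` geometric_carrier L" by auto
  then show False using val by fastforce
qed

lemma segment_connected_component:
  fixes x y :: "'v \<Rightarrow> real"
  assumes "\<And>t. 0 \<le> t \<Longrightarrow> t \<le> 1 \<Longrightarrow> (\<lambda>v. (1 - t) * x v + t * y v) \<in> X"
  shows "connected_component X x y"
proof -
  let ?l = "\<lambda>t v. (1 - t) * x v + t * y v"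
  have "connected (?l ` {0..1})"
    by (intro connected_continuous_image continuous_on_coordinatewise_then_product
        continuous_intros connected_Icc)
  moreover have "?l ` {0..1} \<subseteq> X" using assms by auto
  moreover have "x \<in> ?l ` {0..1}" "y \<in> ?l ` {0..1}"
    by (intro image_eqI[of _ _ 0] image_eqI[of _ _ 1]; simp)+
  ultimately show ?thesis unfolding connected_component_def by blast
qed

lemma midpoint_in_carrier:
  assumes "abstract_complex L" "{u, v} \<in> L" "u \<noteq> v"
  shows "(\<lambda>z. if z = u \<or> z = v then 1 / 2 else 0) \<in> geometric_carrier L"
proof -
  have fin: "finite (\<Union>L)" and sub: "{u, v} \<subseteq> \<Union>L"
    using abstract_complex_finite_vertices[OF assms(1)] assms(2) by auto
  have "(\<Sum>z\<in>\<Union>L. if z = u \<or> z = v then 1 / 2 else (0::real)) = (\<Sum>z\<in>{u, v}. 1 / 2)"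
    using fin sub by (intro sum.mono_neutral_cong_right) auto
  moreover have "{z. (if z = u \<or> z = v then 1 / 2 else (0::real)) \<noteq> 0} = {u, v}" by auto
  ultimately show ?thesis using assms unfolding geometric_carrier_def by simp
qed

text \<open>
  Besides the triangle, a further vertex \<open>w\<close> is removed: the sphere without \<open>w\<close> is a plane, so
  that the Jordan--Brouwer separation theorem applies.
\<close>

lemma carrier_minus_triangle_connected:
  assumes cx: "abstract_complex L"
    and F: "F \<subseteq> L" "\<And>\<sigma>. \<sigma> \<in> L \<Longrightarrow> \<exists>f\<in>F. \<sigma> \<subseteq> f"
    and con: "\<And>S. S \<subseteq> F \<Longrightarrow> S \<noteq> {} \<Longrightarrow>
      (\<And>g h u v. g \<in> S \<Longrightarrow> h \<in> F \<Longrightarrow> {u, v} \<subseteq> g \<inter> h \<Longrightarrow> u \<noteq> v \<Longrightarrow> \<not> {u, v} \<subseteq> T \<Longrightarrow> h \<in> S) \<Longrightarrow> S = F"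
  shows "connected {x \<in> geometric_carrier L. \<not> {v. x v \<noteq> 0} \<subseteq> T \<and> x w < 1}" (is "connected ?X")
proof -
  define X where "X = ?X"
  have fin: "finite (\<Union>L)" by (rule abstract_complex_finite_vertices[OF cx])
  \<comment> \<open>Within one facet the straight segment stays in \<open>X\<close>: for t > 0 a
    vertex of the support of \<open>y\<close> outside \<open>T\<close> remains in the support, and
    the weight at \<open>w\<close> is a convex combination of numbers below 1.\<close>
  have seg: "connected_component X x y"
    if x: "x \<in> X" "{v. x v \<noteq> 0} \<subseteq> f" and y: "y \<in> X" "{v. y v \<noteq> 0} \<subseteq> f" and f: "f \<in> F" for x y f
  proof (rule segment_connected_component)
    fix t :: real assume t: "0 \<le> t" "t \<le> 1"
    let ?z = "\<lambda>v. (1 - t) * x v + t * y v"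
    have nn: "\<And>v. 0 \<le> x v" "\<And>v. 0 \<le> y v" and sum: "(\<Sum>v\<in>\<Union>L. x v) = 1" "(\<Sum>v\<in>\<Union>L. y v) = 1"
      using x(1) y(1) unfolding X_def geometric_carrier_def by auto
    have "{v. ?z v \<noteq> 0} \<subseteq> {v. x v \<noteq> 0} \<union> {v. y v \<noteq> 0}" by auto
    then have "{v. ?z v \<noteq> 0} \<subseteq> f" using x(2) y(2) by blast
    then have 1: "{v. ?z v \<noteq> 0} \<in> L"
      using cx f F(1) unfolding abstract_complex_def by (metis subsetD)
    have "(\<Sum>v\<in>\<Union>L. ?z v) = (1 - t) * (\<Sum>v\<in>\<Union>L. x v) + t * (\<Sum>v\<in>\<Union>L. y v)"
      by (simp add: sum.distrib sum_distrib_left)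
    then have "(\<Sum>v\<in>\<Union>L. ?z v) = 1" using sum by simp
    moreover have "\<And>v. 0 \<le> ?z v" using nn t by simp
    ultimately have 2: "?z \<in> geometric_carrier L"
      using 1 unfolding geometric_carrier_def by blast
    obtain v where v: "x v \<noteq> 0" "v \<notin> T" using x(1) unfolding X_def by blast
    obtain u where u: "y u \<noteq> 0" "u \<notin> T" using y(1) unfolding X_def by blast
    have "x v > 0" "y u > 0" using nn(1)[of v] nn(2)[of u] v(1) u(1) by linarith+
    have 3: "\<not> {v. ?z v \<noteq> 0} \<subseteq> T"
    proof (cases "t = 0")
      case True
      then show ?thesis using v by auto
    next
      case False
      then have "?z u > 0" using t nn(1)[of u] \<open>y u > 0\<close> by (intro add_nonneg_pos) auto
      then show ?thesis using u(2) by force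
    qed
    have xw: "x w < 1" "y w < 1" using x(1) y(1) unfolding X_def by blast+
    have "?z w < 1"
    proof (cases "t = 0")
      case False
      then have "t * y w < t * 1" using t xw by (intro mult_strict_left_mono) auto
      moreover have "(1 - t) * x w \<le> (1 - t) * 1" using t xw by (intro mult_left_mono) auto
      ultimately show ?thesis by simp
    qed (use xw in simp)
    then show "?z \<in> X" using 2 3 unfolding X_def by blast
  qed
  have facet: "\<exists>f\<in>F. {v. x v \<noteq> 0} \<subseteq> f" if "x \<in> X" for x
  proof -
    have "{v. x v \<noteq> 0} \<in> L" using that unfolding X_def geometric_carrier_def by simp
    then show ?thesis by (rule F(2))
  qed
  have "connected X"
  proof (cases "X = {}")
    case True
    show ?thesis unfolding True by (rule connected_empty)
  next
    case False
    then obtain x0 where x0: "x0 \<in> X" by (rule ex_in_conv[THEN iffD2, THEN exE])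
    \<comment> \<open>The facets that meet the component of \<open>x0\<close>; the hypothesis
      \<open>con\<close> will show that these are all facets.\<close>
    define S where "S = {g \<in> F. \<exists>x\<in>X. {v. x v \<noteq> 0} \<subseteq> g \<and> connected_component X x0 x}"
    have "S = F"
    proof (rule con)
      show "S \<subseteq> F" unfolding S_def by (rule Collect_subset)
      obtain f0 where f0: "f0 \<in> F" "{v. x0 v \<noteq> 0} \<subseteq> f0"
        using facet[OF x0] by (rule bexE)
      have "connected_component X x0 x0" using x0 by simp
      then have "f0 \<in> S" unfolding S_def using f0 x0 by blast
      then show "S \<noteq> {}" by auto
      fix g h u v
      assume a: "g \<in> S" "h \<in> F" "{u, v} \<subseteq> g \<inter> h" "u \<noteq> v" "\<not> {u, v} \<subseteq> T"
      then obtain x where x: "x \<in> X" "{v. x v \<noteq> 0} \<subseteq> g" "connected_component X x0 x" "g \<in> F"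
        unfolding S_def by (elim CollectE conjE bexE)
      \<comment> \<open>The midpoint of a common edge leads from one facet to the next. It lies in
        \<open>X\<close>: its support \<open>{u, v}\<close> is not inside \<open>T\<close>, and its
        weight at \<open>w\<close> is at most 1/2.\<close>
      let ?m = "\<lambda>z. if z = u \<or> z = v then 1 / 2 else (0::real)"
      have supp: "{z. ?m z \<noteq> 0} = {u, v}" by auto
      have "h \<in> L" "{u, v} \<subseteq> h" using a F(1) by auto
      then have "{u, v} \<in> L" using cx unfolding abstract_complex_def by metis
      then have m: "?m \<in> X"
        using midpoint_in_carrier[OF cx _ a(4)] a(5) unfolding X_def mem_Collect_eq supp by simp
      moreover have "connected_component X x ?m"
        using a(3) by (intro seg[OF x(1,2) m _ x(4)]) (simp add: supp)
      then have "connected_component X x0 ?m" by (rule connected_component_trans[OF x(3)])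
      moreover have "{z. ?m z \<noteq> 0} \<subseteq> h" using a(3) by (simp add: supp)
      ultimately show "h \<in> S" unfolding S_def using a(2) by (intro CollectI conjI bexI[of _ ?m])
    qed
    have all: "connected_component X x0 y" if y: "y \<in> X" for y
    proof -
      obtain f where f: "f \<in> F" "{v. y v \<noteq> 0} \<subseteq> f"
        using facet[OF y] by (rule bexE)
      then have "f \<in> S" using \<open>S = F\<close> by simp
      then obtain x where x: "x \<in> X" "{v. x v \<noteq> 0} \<subseteq> f" "connected_component X x0 x"
        unfolding S_def by (elim CollectE conjE bexE)
      show ?thesis by (rule connected_component_trans[OF x(3) seg[OF x(1,2) y f(2,1)]])
    qed
    show ?thesis unfolding connected_iff_connected_component
    proof (intro ballI)
      fix x y assume "x \<in> X" "y \<in> X"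
      then show "connected_component X x y"
        using all connected_component_sym connected_component_trans by metis
    qed
  qed
  then show ?thesis unfolding X_def .
qed

text \<open>If the carrier were a sphere, removing \<open>w\<close> would leave a plane in which the
  boundary of the empty triangle \<open>T\<close> is a circle. Its complement is the connected set
  of the previous lemma, whereas a circle separates the plane.\<close>

lemma not_sphere_if_nonseparating_triangle:
  assumes cx: "abstract_complex L"
    and F: "F \<subseteq> L" "\<And>\<sigma>. \<sigma> \<in> L \<Longrightarrow> \<exists>f\<in>F. \<sigma> \<subseteq> f"
    and T: "card T = 3" "bdry T \<subseteq> L" "T \<notin> L" and w: "w \<in> \<Union>L" "w \<notin> T"
    and con: "\<And>S. S \<subseteq> F \<Longrightarrow> S \<noteq> {} \<Longrightarrow>
      (\<And>g h u v. g \<in> S \<Longrightarrow> h \<in> F \<Longrightarrow> {u, v} \<subseteq> g \<inter> h \<Longrightarrow> u \<noteq> v \<Longrightarrow> \<not> {u, v} \<subseteq> T \<Longrightarrow> h \<in> S) \<Longrightarrow> S = F"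
  shows "\<not> geometric_carrier L homeomorphic sphere (0 :: real^3) 1"
proof
  assume "geometric_carrier L homeomorphic sphere (0 :: real^3) 1"
  then obtain h h' where h: "homeomorphism (geometric_carrier L) (sphere (0 :: real^3) 1) h h'"
    unfolding homeomorphic_def by blast
  have finT: "finite T" using T(1) card.infinite by fastforce
  define p where "p = (\<lambda>v. if v = w then 1 else (0::real))"
  define C where "C = geometric_carrier (bdry T)"
  define X where "X = {x \<in> geometric_carrier L. \<not> {v. x v \<noteq> 0} \<subseteq> T \<and> x w < 1}"
  have fin: "finite (\<Union>L)" by (rule abstract_complex_finite_vertices[OF cx])
  have p: "p \<in> geometric_carrier L" unfolding p_def by (rule indicator_in_carrier[OF cx w(1)])
  have UT: "\<Union>(bdry T) \<subseteq> \<Union>L" using T(2) by (rule Union_mono)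
  \<comment> \<open>As \<open>T\<close> itself is not a face, the faces inside \<open>T\<close> are
    exactly its proper subsets; hence the points supported in \<open>T\<close> form the boundary
    circle.\<close>
  have bd: "\<sigma> \<in> bdry T \<longleftrightarrow> \<sigma> \<in> L \<and> \<sigma> \<subseteq> T" for \<sigma>
    using T(2,3) unfolding bdry_def by auto
  have C: "C = {x \<in> geometric_carrier L. {v. x v \<noteq> 0} \<subseteq> T}"
    unfolding C_def set_eq_iff mem_Collect_eq carrier_memI_superset[OF fin UT]
      carrier_memI_superset[OF fin order_refl] bd by metis
  have pC: "p \<notin> C" using w(2) unfolding C p_def by auto
  \<comment> \<open>The weight at \<open>w\<close> reaches 1 only at the vertex \<open>w\<close>
    itself, so \<open>x w < 1\<close> expresses the puncture.\<close>
  have one: "x w \<ge> 1 \<longleftrightarrow> x = p" if x: "x \<in> geometric_carrier L" for x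
  proof
    assume ge: "x w \<ge> 1"
    have nn: "\<And>v. 0 \<le> x v" and sum: "(\<Sum>v\<in>\<Union>L. x v) = 1" and s: "{v. x v \<noteq> 0} \<in> L"
      using x unfolding geometric_carrier_def by auto
    have sp: "(\<Sum>v\<in>\<Union>L. x v) = x w + (\<Sum>v\<in>\<Union>L - {w}. x v)"
      using fin w(1) by (rule sum.remove)
    moreover have "(\<Sum>v\<in>\<Union>L - {w}. x v) \<ge> 0" using nn by (intro sum_nonneg)
    ultimately have e: "x w = 1" "(\<Sum>v\<in>\<Union>L - {w}. x v) = 0" using sum ge by linarith+
    then have "\<forall>v\<in>\<Union>L - {w}. x v = 0"
      using nn fin by (subst (asm) sum_nonneg_eq_0_iff) auto
    moreover have "x v = 0" if "v \<notin> \<Union>L" for v using s that by blast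
    ultimately show "x = p" using e(1) unfolding p_def by fastforce
  qed (simp add: p_def)
  have X: "X = geometric_carrier L - {p} - C"
    unfolding X_def C using one by (auto simp: not_le[symmetric])
  obtain k k' where k: "homeomorphism (sphere (0 :: real^3) 1 - {h p}) (UNIV :: (real^2) set) k k'"
  proof -
    have "h p \<in> sphere (0 :: real^3) 1" using h p unfolding homeomorphism_def by blast
    then have "(sphere (0 :: real^3) 1 - {h p}) homeomorphic (UNIV :: (real^2) set)"
      by (intro homeomorphic_punctured_sphere_affine) simp_all
    then show ?thesis using that unfolding homeomorphic_def by blast
  qed
  have h1: "homeomorphism (geometric_carrier L - {p}) (sphere (0 :: real^3) 1 - {h p}) h h'"
  proof (rule homeomorphism_of_subsets[OF h])
    have inj: "inj_on h (geometric_carrier L)"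
      using h unfolding homeomorphism_def by (metis inj_on_inverseI)
    show "h ` (geometric_carrier L - {p}) = sphere 0 1 - {h p}"
      using inj_on_image_set_diff[OF inj, of "geometric_carrier L" "{p}"] p h
      unfolding homeomorphism_def by simp
  qed auto
  have hom: "homeomorphism (geometric_carrier L - {p}) (UNIV :: (real^2) set) (k \<circ> h) (h' \<circ> k')"
    by (rule homeomorphism_compose[OF h1 k])
  define \<phi> where "\<phi> = k \<circ> h"
  have CL: "C \<subseteq> geometric_carrier L - {p}" using pC C by auto
  have inj: "inj_on \<phi> (geometric_carrier L - {p})"
    using hom unfolding homeomorphism_def \<phi>_def by (metis inj_on_inverseI)
  have "\<phi> ` X = UNIV - \<phi> ` C" unfolding X using inj_on_image_set_diff[OF inj _ CL] hom
    unfolding homeomorphism_def \<phi>_def by simp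
  then have "- \<phi> ` C = \<phi> ` X" by blast
  moreover have "connected (\<phi> ` X)"
  proof (rule connected_continuous_image)
    show "continuous_on X \<phi>"
      using hom X unfolding homeomorphism_def \<phi>_def by (metis Diff_subset continuous_on_subset)
    show "connected X" unfolding X_def by (rule carrier_minus_triangle_connected[OF cx F con])
  qed
  ultimately have "connected (- \<phi> ` C)" by simp
  moreover have "\<phi> ` C homeomorphic sphere (0 :: real^2) 1"
  proof -
    have "homeomorphism C (\<phi> ` C) (k \<circ> h) (h' \<circ> k')"
      using homeomorphism_of_subsets[OF hom CL] unfolding \<phi>_def by blast
    then have "\<phi> ` C homeomorphic C"
      unfolding homeomorphic_def using homeomorphism_symD by blast
    moreover have "C homeomorphic sphere (0 :: real^2) 1"
      unfolding C_def using finT T(1) by (intro bdry_carrier_sphere) simp_all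
    ultimately show ?thesis by (rule homeomorphic_trans)
  qed
  ultimately show False using Jordan_Brouwer_separation by (metis zero_less_one)
qed

subsection \<open>Facet systems of pseudomanifolds\<close>

definition star :: "'v set set \<Rightarrow> 'v set \<Rightarrow> 'v set set" where
  "star F e = {f \<in> F. e \<subseteq> f}"

definition link_facets :: "'v \<Rightarrow> 'v set set \<Rightarrow> 'v set set" where
  "link_facets x F = {g. x \<notin> g \<and> insert x g \<in> F}"

definition down_closure :: "'v set set \<Rightarrow> 'v set set" where
  "down_closure F = {\<sigma>. \<exists>f\<in>F. \<sigma> \<subseteq> f}"

text \<open>
  The facet system of a normal \<open>d\<close>-pseudomanifold; connectivity of the links has become strong
  connectivity of the stars.
\<close>

definition strong_pm :: "nat \<Rightarrow> 'v set set \<Rightarrow> bool" where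
  "strong_pm d F \<longleftrightarrow> finite F \<and> (\<forall>f\<in>F. finite f \<and> card f = Suc d) \<and>
     (\<forall>f\<in>F. \<forall>v\<in>f. card (star F (f - {v})) = 2) \<and>
     (\<forall>e S. finite e \<longrightarrow> card e < d \<longrightarrow> S \<subseteq> star F e \<longrightarrow> S \<noteq> {} \<longrightarrow>
        (\<forall>g\<in>S. \<forall>h\<in>star F e. card (g \<inter> h) = d \<longrightarrow> h \<in> S) \<longrightarrow> S = star F e)"

lemma strong_pmD:
  assumes "strong_pm d F"
  shows "finite F" "\<And>f. f \<in> F \<Longrightarrow> finite f" "\<And>f. f \<in> F \<Longrightarrow> card f = Suc d"
    "\<And>f v. f \<in> F \<Longrightarrow> v \<in> f \<Longrightarrow> card (star F (f - {v})) = 2"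
  using assms unfolding strong_pm_def by auto

lemma strong_pm_connected:
  assumes "strong_pm d F" "finite e" "card e < d" "S \<subseteq> star F e" "S \<noteq> {}"
    "\<And>g h. g \<in> S \<Longrightarrow> h \<in> star F e \<Longrightarrow> card (g \<inter> h) = d \<Longrightarrow> h \<in> S"
  shows "S = star F e"
proof -
  have "\<forall>g\<in>S. \<forall>h\<in>star F e. card (g \<inter> h) = d \<longrightarrow> h \<in> S"
    using assms(6) by simp
  then show ?thesis using assms(1-5) unfolding strong_pm_def by metis
qed

lemma ridge_two:
  assumes "card (star F (f - {v})) = 2" "f \<in> F" "v \<in> f" "g \<in> star F (f - {v})" "g \<noteq> f"
    "h \<in> star F (f - {v})" "h \<noteq> f"
  shows "g = h"
proof (rule ccontr)
  assume "g \<noteq> h"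
  have "f \<in> star F (f - {v})" using assms(2) unfolding star_def by auto
  then have "card {f, g, h} \<le> card (star F (f - {v}))"
    using assms by (intro card_mono) (auto intro: card_ge_0_finite)
  then show False using assms \<open>g \<noteq> h\<close> by auto
qed

lemma card_Int_facets:
  assumes "finite f" "finite g" "card f = Suc d" "card g = Suc d" "f \<noteq> g" "r \<subseteq> f" "r \<subseteq> g" "card r = d"
  shows "card (f \<inter> g) = d"
proof -
  have "f \<inter> g \<noteq> f"
    using assms card_subset_eq[of g f] by (metis inf.absorb_iff1 inf_le2)
  then have "card (f \<inter> g) < card f" using assms(1) by (intro psubset_card_mono) auto
  moreover have "card r \<le> card (f \<inter> g)" using assms by (intro card_mono) auto
  ultimately show ?thesis using assms by simp
qed

text \<open>Induction from large faces to small ones. If a set \<open>S\<close> of facets around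
  \<open>e\<close> is closed under adjacency but not everything, the faces of the link lying in
  facets of \<open>S\<close> and those lying in the other facets cover the link; by connectedness
  they share a vertex, and the argument is repeated at the larger face obtained by adding this
  vertex.\<close>

lemma strong_pm_faces:
  assumes K: "normal_pseudomanifold d K"
  shows "strong_pm d (faces_of_dim d K)"
proof -
  define F where "F = faces_of_dim d K"
  have cx: "abstract_complex K" and d: "1 \<le> d"
    and pure: "\<And>\<sigma>. \<sigma> \<in> K \<Longrightarrow> \<exists>f\<in>F. \<sigma> \<subseteq> f"
    and ridge: "\<And>\<rho>. \<rho> \<in> K \<Longrightarrow> card \<rho> = d \<Longrightarrow> card {f \<in> F. \<rho> \<subseteq> f} = 2"
    and con: "\<And>\<sigma>. \<sigma> \<in> K \<Longrightarrow> card \<sigma> < d \<Longrightarrow> connected_complex (link_complex \<sigma> K)"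
    using K unfolding normal_pseudomanifold_def weak_pseudomanifold_def pure_complex_def F_def
    by simp_all
  have down: "\<And>\<sigma> \<tau>. \<sigma> \<in> K \<Longrightarrow> \<tau> \<subseteq> \<sigma> \<Longrightarrow> \<tau> \<in> K" and finK: "finite K"
    and finf: "\<And>\<sigma>. \<sigma> \<in> K \<Longrightarrow> finite \<sigma>"
    using cx unfolding abstract_complex_def by simp_all
  have FK: "\<And>f. f \<in> F \<Longrightarrow> f \<in> K" and cF: "\<And>f. f \<in> F \<Longrightarrow> card f = Suc d"
    unfolding F_def faces_of_dim_def by auto
  have finF: "finite F" using finK unfolding F_def faces_of_dim_def by simp
  have rid: "card (star F r) = 2" if "r \<subseteq> f" "f \<in> F" "card r = d" for r f
    using ridge[OF down[OF FK[OF that(2)] that(1)] that(3)] unfolding star_def .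
  have conn: "S = star F e"
    if "finite e" "card e < d" "S \<subseteq> star F e" "S \<noteq> {}"
      "\<And>g h. g \<in> S \<Longrightarrow> h \<in> star F e \<Longrightarrow> card (g \<inter> h) = d \<Longrightarrow> h \<in> S" for e S
    using that
  proof (induction "d - card e" arbitrary: e S)
    case 0
    then show ?case by simp
  next
    case (Suc n)
    show ?case
    proof (rule ccontr)
      assume "S \<noteq> star F e"
      then obtain f' where f': "f' \<in> star F e" "f' \<notin> S" using Suc.prems(3) by blast
      obtain f where f: "f \<in> S" using Suc.prems(4) by blast
      have fF: "f \<in> F" "e \<subseteq> f" "f' \<in> F" "e \<subseteq> f'"
        using f f' Suc.prems(3) unfolding star_def by auto
      have eK: "e \<in> K" using down[OF FK] fF by blast
      define L where "L = link_complex e K"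
      define K1 where "K1 = {\<tau> \<in> L. \<exists>g\<in>S. \<tau> \<subseteq> g}"
      define K2 where "K2 = {\<tau> \<in> L. \<exists>g\<in>star F e - S. \<tau> \<subseteq> g}"
      have L: "\<tau> \<in> L \<longleftrightarrow> \<tau> \<inter> e = {} \<and> \<tau> \<union> e \<in> K" for \<tau>
        unfolding L_def by (rule mem_link_complex[OF cx])
      have LU: "L = K1 \<union> K2"
      proof (intro equalityI subsetI)
        fix \<tau> assume t: "\<tau> \<in> L"
        then obtain g where g: "g \<in> F" "\<tau> \<union> e \<subseteq> g" using L pure by blast
        then have "g \<in> star F e" "\<tau> \<subseteq> g" unfolding star_def by auto
        then show "\<tau> \<in> K1 \<union> K2" using t unfolding K1_def K2_def by blast
      qed (auto simp: K1_def K2_def)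
      have vertex: "\<exists>v. v \<in> g \<and> {v} \<in> L" if "g \<in> star F e" for g
      proof -
        have g: "g \<in> F" "e \<subseteq> g" using that unfolding star_def by auto
        have "e \<noteq> g" using cF[OF g(1)] Suc.prems(2) by auto
        then obtain v where v: "v \<in> g" "v \<notin> e" using g(2) by blast
        then have "{v} \<union> e \<in> K" using down[OF FK[OF g(1)]] g(2) by simp
        then show ?thesis using v unfolding L by blast
      qed
      obtain v where "v \<in> f" "{v} \<in> L" using vertex f Suc.prems(3) by blast
      then have v: "v \<in> \<Union>K1" using f unfolding K1_def by blast
      obtain v' where "v' \<in> f'" "{v'} \<in> L" using vertex[OF f'(1)] by blast
      then have v': "v' \<in> \<Union>K2" using f' unfolding K2_def by blast
      \<comment> \<open>At a common vertex \<open>w\<close>, the face \<open>e' = insert w e\<close>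
        lies in a facet of \<open>S\<close> and in one outside. If \<open>e'\<close> is a ridge,
        these two are adjacent; otherwise the induction hypothesis puts the whole star of
        \<open>e'\<close> into \<open>S\<close>.\<close>
      have disj: "\<Union>K1 \<inter> \<Union>K2 = {}"
      proof (rule ccontr)
        assume "\<Union>K1 \<inter> \<Union>K2 \<noteq> {}"
        then obtain w where "w \<in> \<Union>K1" "w \<in> \<Union>K2" by blast
        then obtain \<tau> g h where w: "w \<in> \<tau>" "\<tau> \<in> L" "w \<in> g" "g \<in> S" "w \<in> h" "h \<in> star F e" "h \<notin> S"
          unfolding K1_def K2_def by blast
        then have we: "w \<notin> e" unfolding L by blast
        define e' where "e' = insert w e"
        have ce: "card e' = Suc (card e)" "finite e'" using we Suc.prems(1) unfolding e'_def by auto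
        have gh: "g \<in> star F e'" "h \<in> star F e'" "g \<in> F" "h \<in> F" "e' \<subseteq> g" "e' \<subseteq> h"
          using w Suc.prems(3) unfolding star_def e'_def by auto
        have sub: "star F e' \<subseteq> star F e" unfolding star_def e'_def by auto
        show False
        proof (cases "card e' = d")
          case True
          have "card (g \<inter> h) = d"
          proof (rule card_Int_facets[where r = e'])
            show "g \<noteq> h" using w by blast
          qed (use gh True cF finf FK in auto)
          then show False using Suc.prems(5)[OF w(4,6)] w(7) by blast
        next
          case False
          have "S \<inter> star F e' = star F e'"
          proof (rule Suc.hyps(1))
            show "n = d - card e'" using Suc.hyps(2) ce by simp
            show "card e' < d" using False ce Suc.prems(2) by simp
            show "S \<inter> star F e' \<noteq> {}" using gh w by blast
            fix g' h' assume "g' \<in> S \<inter> star F e'" "h' \<in> star F e'" "card (g' \<inter> h') = d"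
            then show "h' \<in> S \<inter> star F e'" using Suc.prems(5)[of g' h'] sub by blast
          qed (use ce in auto)
          then show False using gh w by blast
        qed
      qed
      show False by (rule connected_carrier_vertex_partition[OF _ _ LU disj v v'])
           (use abstract_complex_link[OF cx eK] con[OF eK Suc.prems(2)] in \<open>simp_all add: L_def\<close>)
    qed
  qed
  have "strong_pm d F" unfolding strong_pm_def
  proof (intro conjI ballI allI impI)
    show "card (star F (f - {v})) = 2" if "f \<in> F" "v \<in> f" for f v
      using that cF[OF that(1)] finf[OF FK[OF that(1)]] by (intro rid[of _ f]) auto
    show "S = star F e" if "finite e" "card e < d" "S \<subseteq> star F e" "S \<noteq> {}"
      "\<forall>g\<in>S. \<forall>h\<in>star F e. card (g \<inter> h) = d \<longrightarrow> h \<in> S" for e S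
      using that(5) by (intro conn[OF that(1-4)]) simp
  qed (use finF cF finf FK in simp_all)
  then show ?thesis unfolding F_def .
qed

lemma bij_betw_star_link_facets:
  assumes "x \<notin> e"
  shows "bij_betw (insert x) (star (link_facets x F) e) (star F (insert x e))"
  unfolding bij_betw_def
proof
  show "inj_on (insert x) (star (link_facets x F) e)"
    unfolding star_def link_facets_def by (intro inj_onI) (auto simp: insert_ident)
  show "insert x ` star (link_facets x F) e = star F (insert x e)"
  proof (intro equalityI subsetI)
    fix f assume f: "f \<in> star F (insert x e)"
    then have fF: "f \<in> F" "insert x e \<subseteq> f" unfolding star_def by simp_all
    then have eq: "f = insert x (f - {x})" by blast
    then have "insert x (f - {x}) \<in> F" using fF(1) by (simp only:)
    then have "f - {x} \<in> star (link_facets x F) e"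
      using fF(2) assms unfolding star_def link_facets_def by blast
    then show "f \<in> insert x ` star (link_facets x F) e" using eq by (rule image_eqI[rotated])
  qed (auto simp: star_def link_facets_def)
qed

text \<open>Adding \<open>x\<close> maps stars in the link bijectively to stars in \<open>F\<close>
  and raises the size of every intersection by one, so ridges and adjacency-closed sets
  correspond.\<close>

lemma strong_pm_link_facets:
  assumes F: "strong_pm (Suc d) F"
  shows "strong_pm d (link_facets x F)" unfolding strong_pm_def
proof (intro conjI ballI allI impI)
  let ?L = "link_facets x F"
  note D = strong_pmD[OF F]
  have L: "finite f" "card f = Suc d" if "f \<in> ?L" for f
    using that D(2,3)[of "insert x f"] unfolding link_facets_def by auto
  have "?L \<subseteq> (\<lambda>f. f - {x}) ` F"
  proof
    fix g assume "g \<in> ?L"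
    then show "g \<in> (\<lambda>f. f - {x}) ` F"
      unfolding link_facets_def by (intro image_eqI[of _ _ "insert x g"]) auto
  qed
  then show "finite ?L" by (rule finite_subset) (simp add: D(1))
  show "finite f" "card f = Suc d" if "f \<in> ?L" for f using L[OF that] .
  show "card (star ?L (f - {v})) = 2" if f: "f \<in> ?L" "v \<in> f" for f v
  proof -
    have x: "x \<notin> f" "insert x f \<in> F" using f unfolding link_facets_def by auto
    then have "insert x (f - {v}) = insert x f - {v}" using f(2) by auto
    moreover have "card (star ?L (f - {v})) = card (star F (insert x (f - {v})))"
      using x by (intro bij_betw_same_card[OF bij_betw_star_link_facets]) auto
    ultimately show ?thesis using D(4)[OF x(2), of v] f(2) by simp
  qed
  show "S = star ?L e" if e: "finite e" "card e < d" and S: "S \<subseteq> star ?L e" "S \<noteq> {}"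
    and cl: "\<forall>g\<in>S. \<forall>h\<in>star ?L e. card (g \<inter> h) = d \<longrightarrow> h \<in> S" for e S
  proof -
    have "x \<notin> e" using S unfolding star_def link_facets_def by blast
    note bij = bij_betw_star_link_facets[OF this, of F]
    have im: "insert x ` star ?L e = star F (insert x e)" and inj: "inj_on (insert x) (star ?L e)"
      using bij unfolding bij_betw_def by auto
    have "insert x ` S = star F (insert x e)"
    proof (rule strong_pm_connected[OF F])
      show "card (insert x e) < Suc d" using e \<open>x \<notin> e\<close> by simp
      show "insert x ` S \<subseteq> star F (insert x e)" using S(1) im by blast
      fix g h assume "g \<in> insert x ` S" "h \<in> star F (insert x e)" "card (g \<inter> h) = Suc d"
      then obtain g' h' where gh: "g = insert x g'" "g' \<in> S" "h = insert x h'" "h' \<in> star ?L e"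
        using im by blast
      have "x \<notin> g'" "x \<notin> h'" "finite g'"
        using gh S(1) L(1)[of g'] unfolding star_def link_facets_def by auto
      moreover have "g \<inter> h = insert x (g' \<inter> h')" using gh by blast
      ultimately have "card (g' \<inter> h') = d"
        using \<open>card (g \<inter> h) = Suc d\<close> by simp
      then show "h \<in> insert x ` S" using cl gh by blast
    qed (use e S in auto)
    then show ?thesis using im inj S(1) by (metis inj_on_image_eq_iff order_refl)
  qed
qed

section \<open>Passing between facet systems and complexes\<close>

lemma down_closure_faces:
  assumes "pure_complex d K"
  shows "down_closure (faces_of_dim d K) = K"
proof (intro equalityI subsetI)
  fix \<sigma> assume "\<sigma> \<in> down_closure (faces_of_dim d K)"
  then show "\<sigma> \<in> K"
    using assms unfolding down_closure_def faces_of_dim_def pure_complex_def abstract_complex_def by auto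
next
  fix \<sigma> assume "\<sigma> \<in> K"
  then show "\<sigma> \<in> down_closure (faces_of_dim d K)"
    using assms unfolding down_closure_def pure_complex_def by simp
qed

lemma abstract_complex_down_closure:
  assumes "finite F" "\<And>f. f \<in> F \<Longrightarrow> finite f" "F \<noteq> {}"
  shows "abstract_complex (down_closure F)"
proof -
  have "down_closure F = (\<Union>f\<in>F. Pow f)" unfolding down_closure_def by auto
  then have fin: "finite (down_closure F)" using assms by simp
  then show ?thesis unfolding abstract_complex_def
  proof (intro conjI ballI allI impI)
    show "finite (down_closure F)" by (rule fin)
    show "finite \<sigma>" if "\<sigma> \<in> down_closure F" for \<sigma>
      using that assms(2) unfolding down_closure_def by (auto intro: finite_subset)
    show "{} \<in> down_closure F" using assms(3) unfolding down_closure_def by blast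
    show "\<tau> \<in> down_closure F" if "\<sigma> \<in> down_closure F" "\<tau> \<subseteq> \<sigma>" for \<sigma> \<tau>
      using that unfolding down_closure_def by blast
  qed
qed

lemma Union_down_closure: "\<Union>(down_closure F) = \<Union>F" unfolding down_closure_def by auto

lemma complex_isomorphic_down_closure:
  assumes "complex_isomorphic F G"
  shows "complex_isomorphic (down_closure F) (down_closure G)"
proof -
  obtain f where f: "bij_betw f (\<Union>F) (\<Union>G)" "G = (\<lambda>\<sigma>. f ` \<sigma>) ` F"
    using assms unfolding complex_isomorphic_def by blast
  have "down_closure G = (\<lambda>\<sigma>. f ` \<sigma>) ` down_closure F"
  proof (intro equalityI subsetI)
    fix \<tau> assume "\<tau> \<in> down_closure G"
    then obtain g where g: "g \<in> F" "\<tau> \<subseteq> f ` g"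
      unfolding down_closure_def f(2) by blast
    then obtain \<sigma> where "\<sigma> \<subseteq> g" "\<tau> = f ` \<sigma>"
      by (metis subset_image_iff)
    then show "\<tau> \<in> (\<lambda>\<sigma>. f ` \<sigma>) ` down_closure F"
      using g(1) unfolding down_closure_def by blast
  next
    fix \<tau> assume "\<tau> \<in> (\<lambda>\<sigma>. f ` \<sigma>) ` down_closure F"
    then obtain \<sigma> g where "\<sigma> \<subseteq> g" "g \<in> F" "\<tau> = f ` \<sigma>"
      unfolding down_closure_def by blast
    then have "\<tau> \<subseteq> f ` g" "f ` g \<in> G" using f(2) by auto
    then show "\<tau> \<in> down_closure G" unfolding down_closure_def by blast
  qed
  then show ?thesis using f(1) unfolding complex_isomorphic_def Union_down_closure by blast
qed

lemma complex_isomorphic_sym: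
  assumes "complex_isomorphic K L"
  shows "complex_isomorphic L K"
proof -
  obtain f g where "bij_betw f (\<Union>K) (\<Union>L)" and fg: "bij_betw g (\<Union>L) (\<Union>K)"
    "\<And>v. v \<in> \<Union>K \<Longrightarrow> g (f v) = v" "\<And>w. w \<in> \<Union>L \<Longrightarrow> f (g w) = w"
    "\<And>\<sigma>. \<sigma> \<in> K \<Longrightarrow> f ` \<sigma> \<in> L" "\<And>\<tau>. \<tau> \<in> L \<Longrightarrow> g ` \<tau> \<in> K"
    using complex_isomorphic_obtain[OF assms] by blast
  have "K = (\<lambda>\<sigma>. g ` \<sigma>) ` L"
  proof (intro equalityI subsetI)
    fix \<sigma> assume s: "\<sigma> \<in> K"
    then have "\<And>v. v \<in> \<sigma> \<Longrightarrow> g (f v) = v" using fg(2) by blast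
    then have "g ` f ` \<sigma> = \<sigma>" by (simp add: image_image)
    then show "\<sigma> \<in> (\<lambda>\<sigma>. g ` \<sigma>) ` L"
      using fg(4)[OF s] by (metis imageI)
  qed (use fg(5) in auto)
  then show ?thesis using fg(1) unfolding complex_isomorphic_def by blast
qed

lemma complex_isomorphic_trans:
  assumes "complex_isomorphic K L" "complex_isomorphic L M"
  shows "complex_isomorphic K M"
proof -
  obtain f where f: "bij_betw f (\<Union>K) (\<Union>L)" "L = (\<lambda>\<sigma>. f ` \<sigma>) ` K"
    using assms(1) unfolding complex_isomorphic_def by blast
  obtain g where g: "bij_betw g (\<Union>L) (\<Union>M)" "M = (\<lambda>\<sigma>. g ` \<sigma>) ` L"
    using assms(2) unfolding complex_isomorphic_def by blast
  have "bij_betw (g \<circ> f) (\<Union>K) (\<Union>M)" by (rule bij_betw_trans[OF f(1) g(1)])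
  moreover have "M = (\<lambda>\<sigma>. (g \<circ> f) ` \<sigma>) ` K"
    unfolding g(2) f(2) by (simp add: image_comp image_image)
  ultimately show ?thesis unfolding complex_isomorphic_def by blast
qed

subsection \<open>A certified search for pseudomanifolds with few vertices\<close>

text \<open>
  The search works with lists of facets whose vertices are labels; a partial complex is a list
  together with an embedding \<open>\<gamma>\<close> of the labels used so far into the vertices of the unknown
  pseudomanifold. A ridge contained in only one facet of the list lies in a second facet of the
  pseudomanifold, whose remaining vertex either has a label already or receives a fresh one.
\<close>

definition incident :: "'a list \<Rightarrow> 'a list list \<Rightarrow> 'a list list" where
  "incident r F = filter (\<lambda>g. list_all (\<lambda>x. x \<in> set g) r) F"

text \<open>A facet around a codimension-2 face \<open>e\<close> is an edge of the graph that is the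
  link of \<open>e\<close>, with its two ends outside \<open>e\<close>. An edge with a free end lies
  on no cycle and is dropped.\<close>

definition cyclic_part :: "'a list \<Rightarrow> 'a list list \<Rightarrow> 'a list list" where
  "cyclic_part e F =
     filter (\<lambda>g. list_all (\<lambda>x. x \<in> set e \<or> list_ex (\<lambda>h. x \<in> set h \<and> h \<noteq> g) F) g) F"

text \<open>The union of the closed cycles in the link of \<open>e\<close>, where \<open>F\<close> is the list of facets around \<open>e\<close>.\<close>

function prune :: "'a list \<Rightarrow> 'a list list \<Rightarrow> 'a list list" where
  "prune e F = (let G = cyclic_part e F in if length G < length F then prune e G else F)"
  by pat_completeness auto
termination by (relation "Wellfounded.measure (\<lambda>(e, F). length F)") auto

declare prune.simps [simp del]

text \<open>In a normal pseudomanifold the link of a codimension-2 face is a single cycle. A closed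
  part that does not exhaust the known facets around \<open>e\<close> therefore refutes the partial
  complex.\<close>

definition premature :: "'a list list \<Rightarrow> 'a list \<Rightarrow> bool" where
  "premature F e = (let G = incident e F; D = prune e G in D \<noteq> [] \<and> length D < length G)"

fun facets_of :: "'a list \<Rightarrow> 'a list list" where
  "facets_of [] = []"
| "facets_of (x # xs) = xs # map ((#) x) (facets_of xs)"

fun codim2_of :: "'a list \<Rightarrow> 'a list list" where
  "codim2_of [] = []"
| "codim2_of (x # xs) = facets_of xs @ map ((#) x) (codim2_of xs)"

text \<open>Only faces of the head \<open>f\<close> are inspected: it is the facet just added, and a
  violation caused by adding it involves one of its vertices, ridges or codimension-2 faces. The
  bound \<open>c\<close> on facets per vertex is present only in the search for 3-dimensional
  complexes.\<close>

fun contradictory :: "nat option \<Rightarrow> 'a list list \<Rightarrow> bool" where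
  "contradictory c [] = False"
| "contradictory c (f # F) =
    ((case c of None \<Rightarrow> False | Some k \<Rightarrow> list_ex (\<lambda>v. k < length (incident [v] (f # F))) f) \<or>
     list_ex (\<lambda>r. 2 < length (incident r (f # F))) (facets_of f) \<or>
     list_ex (premature (f # F)) (codim2_of f))"

definition relabel :: "'a list \<Rightarrow> 'a list \<Rightarrow> 'a \<Rightarrow> 'a" where
  "relabel ls p x = the (map_of (zip ls p) x)"

text \<open>\<open>p\<close> lists the images of the first labels in \<open>ls\<close>. Containment
  of the relabelled facets in facets of \<open>F\<close> suffices, since the sizes agree; an
  embedding of a closed \<open>M\<close> is then an isomorphism onto the whole
  pseudomanifold.\<close>

definition matches :: "'a list \<Rightarrow> 'a list list \<Rightarrow> 'a list list \<Rightarrow> 'a list \<Rightarrow> bool" where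
  "matches ls M F p \<longleftrightarrow> distinct p \<and>
     list_all (\<lambda>m. list_all (\<lambda>x. x \<in> set (take (length p) ls)) m \<and>
       (let m' = map (relabel ls p) m in list_ex (\<lambda>f. list_all (\<lambda>x. x \<in> set f) m') F)) M"

fun open_ridge :: "'a list list \<Rightarrow> 'a list list \<Rightarrow> ('a list \<times> 'a list) option" where
  "open_ridge F [] = None"
| "open_ridge F (f # fs) = (case find (\<lambda>r. length (incident r F) = 1) (facets_of f) of
     Some r \<Rightarrow> Some (f, r) | None \<Rightarrow> open_ridge F fs)"

text \<open>Branches on which \<open>contradictory\<close> succeeds are omitted from the tree.\<close>

datatype 'a tree = Match nat "'a list" | Branch "'a tree list"

text \<open>Fresh labels are interchangeable, so besides the labels in use only the first element of
  \<open>W\<close> is tried; when \<open>W\<close> is empty, every vertex already has a label. A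
  partial complex without open ridge is rejected by \<open>Branch\<close>: a closed one has to be
  recognised by \<open>Match\<close>.\<close>

fun check :: "'a list \<Rightarrow> nat option \<Rightarrow> 'a list list list \<Rightarrow> 'a list \<Rightarrow> 'a list \<Rightarrow>
    'a list list \<Rightarrow> 'a tree \<Rightarrow> bool"
  and checks :: "'a list \<Rightarrow> nat option \<Rightarrow> 'a list list list \<Rightarrow> 'a list \<Rightarrow> 'a list \<Rightarrow>
    'a list list \<Rightarrow> 'a list \<Rightarrow> 'a list \<Rightarrow> 'a tree list \<Rightarrow> bool" where
  "check ls c cat U W F (Match i p) = (i < length cat \<and> matches ls (cat ! i) F p)"
| "check ls c cat U W F (Branch ts) = (case open_ridge F F of
     None \<Rightarrow> False
   | Some (f, r) \<Rightarrow> checks ls c cat U W F r (filter (\<lambda>v. v \<notin> set f) U) ts)"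
| "checks ls c cat U W F r (v # vs) ts =
     (if contradictory c ((v # r) # F) then checks ls c cat U W F r vs ts
      else case ts of [] \<Rightarrow> False
      | t # ts' \<Rightarrow> check ls c cat U W ((v # r) # F) t \<and> checks ls c cat U W F r vs ts')"
| "checks ls c cat U (w # W) F r [] ts =
     (if contradictory c ((w # r) # F) then True
      else case ts of [] \<Rightarrow> False
      | t # ts' \<Rightarrow> check ls c cat (U @ [w]) W ((w # r) # F) t)"
| "checks ls c cat U [] F r [] ts = True"

text \<open>A second facet at each ridge is what rigidity rests on: once \<open>M\<close> is
  embedded in a pseudomanifold, both facets at each of its ridges come from \<open>M\<close>, so no
  adjacent facet lies outside.\<close>

definition closed_facets :: "nat \<Rightarrow> 'a list list \<Rightarrow> bool" where
  "closed_facets d M \<longleftrightarrow> M \<noteq> [] \<and> list_all (\<lambda>m. distinct m \<and> length m = Suc d \<and>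
     list_all (\<lambda>r. list_ex (\<lambda>g. \<not> list_all (\<lambda>x. x \<in> set g) m) (incident r M)) (facets_of m)) M"

text \<open>Facets are distinct as sets, not merely as lists, so that lengths of lists of facets can
  be compared with cardinalities in \<open>FF\<close>.\<close>

definition embeds :: "nat \<Rightarrow> 'v set set \<Rightarrow> ('a \<Rightarrow> 'v) \<Rightarrow> 'a list \<Rightarrow> 'a list list \<Rightarrow> bool" where
  "embeds d FF \<gamma> U F \<longleftrightarrow> inj_on \<gamma> (set U) \<and> \<gamma> ` set U \<subseteq> \<Union>FF \<and>
     distinct (map set F) \<and> (\<forall>f\<in>set F. distinct f \<and> length f = Suc d \<and> set f \<subseteq> set U \<and> \<gamma> ` set f \<in> FF)"

lemma set_incident: "set (incident r F) = {g \<in> set F. set r \<subseteq> set g}"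
  unfolding incident_def by (auto simp: list_all_iff)

section \<open>Soundness of the search\<close>

lemma facets_of:
  assumes "r \<in> set (facets_of f)" "distinct f"
  shows "\<exists>v\<in>set f. set r = set f - {v}" "distinct r" using assms
proof (induction f arbitrary: r)
  case (Cons x xs)
  {
    case 1
    show ?case
    proof (cases "r = xs")
      case False
      then obtain r' where "r' \<in> set (facets_of xs)" "r = x # r'" using 1 by auto
      then show ?thesis using Cons.IH(1)[of r'] 1 by auto
    qed (use 1 in auto)
  next
    case 2
    show ?case
    proof (cases "r = xs")
      case False
      then obtain r' where "r' \<in> set (facets_of xs)" "r = x # r'" using 2 by auto
      then show ?thesis using Cons.IH[of r'] 2 by auto
    qed (use 2 in auto)
  }
qed auto

lemma facets_of_complete:
  assumes "distinct f" "v \<in> set f"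
  shows "\<exists>r\<in>set (facets_of f). set r = set f - {v}" using assms
proof (induction f)
  case (Cons x xs)
  show ?case
  proof (cases "v = x")
    case True
    then show ?thesis using Cons.prems by auto
  next
    case False
    then obtain r where "r \<in> set (facets_of xs)" "set r = set xs - {v}" using Cons by auto
    then show ?thesis using False by (intro bexI[of _ "x # r"]) auto
  qed
qed simp

lemma codim2_of:
  assumes "e \<in> set (codim2_of f)" "distinct f"
  shows "set e \<subseteq> set f \<and> distinct e \<and> Suc (Suc (length e)) = length f"
  using assms
proof (induction f arbitrary: e)
  case (Cons x xs)
  show ?case
  proof (cases "e \<in> set (facets_of xs)")
    case True
    have "distinct xs" using Cons.prems by simp
    then obtain v where v: "v \<in> set xs" "set e = set xs - {v}" "distinct e"
      using facets_of[OF True] by blast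
    have "length xs = card (set xs)" using \<open>distinct xs\<close> by (simp add: distinct_card)
    moreover have "length e = card (set e)" using v(3) by (simp add: distinct_card)
    moreover have "card (set xs) = Suc (card (set e))"
      unfolding v(2) using v(1) by (rule card.remove[OF finite_set])
    ultimately have "Suc (length e) = length xs" by linarith
    moreover have "set e \<subseteq> set (x # xs)" using v(2) by auto
    ultimately show ?thesis using v(3) by simp
  next
    case False
    then obtain e' where "e' \<in> set (codim2_of xs)" "e = x # e'" using Cons.prems by auto
    then show ?thesis using Cons by auto
  qed
qed auto

lemma embedsD:
  assumes "embeds d FF \<gamma> U F" "f \<in> set F"
  shows "distinct f" "length f = Suc d" "set f \<subseteq> set U" "\<gamma> ` set f \<in> FF"
  using assms unfolding embeds_def by auto

lemma embeds_image_eq: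
  assumes "embeds d FF \<gamma> U F" "f \<in> set F" "g \<in> set F" "\<gamma> ` set f = \<gamma> ` set g"
  shows "f = g"
proof -
  have "inj_on \<gamma> (set U)" "distinct (map set F)" using assms(1) unfolding embeds_def by auto
  then have "set f = set g" using assms(4) embedsD(3)[OF assms(1,2)] embedsD(3)[OF assms(1,3)]
    by (simp add: inj_on_image_eq_iff)
  moreover have "inj_on set (set F)"
    using \<open>distinct (map set F)\<close> by (simp add: distinct_map)
  ultimately show ?thesis using assms(2,3) by (simp add: inj_onD)
qed

lemma length_incident_le:
  assumes emb: "embeds d FF \<gamma> U F" and fin: "finite FF"
  shows "length (incident r F) \<le> card (star FF (\<gamma> ` set r))"
proof -
  have sub: "set (incident r F) \<subseteq> set F" by (auto simp: set_incident)
  have "distinct F" using emb unfolding embeds_def by (simp add: distinct_map)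
  then have "distinct (incident r F)" unfolding incident_def by simp
  then have "length (incident r F) = card (set (incident r F))" by (simp only: distinct_card)
  also have "\<dots> = card ((\<lambda>f. \<gamma> ` set f) ` set (incident r F))"
    using embeds_image_eq[OF emb] sub by (intro card_image[symmetric] inj_onI) blast
  also have "\<dots> \<le> card (star FF (\<gamma> ` set r))"
  proof (rule card_mono)
    show "finite (star FF (\<gamma> ` set r))" using fin unfolding star_def by simp
    show "(\<lambda>f. \<gamma> ` set f) ` set (incident r F) \<subseteq> star FF (\<gamma> ` set r)"
    proof (intro image_subsetI)
      fix f assume "f \<in> set (incident r F)"
      then have "f \<in> set F" "set r \<subseteq> set f" by (auto simp: set_incident)
      then show "\<gamma> ` set f \<in> star FF (\<gamma> ` set r)"
        using embedsD(4)[OF emb] unfolding star_def by auto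
    qed
  qed
  finally show ?thesis .
qed

text \<open>A neighbour \<open>h\<close> of \<open>g \<in> D\<close> in the star shares with
  \<open>g\<close> a ridge \<open>insert x e\<close>. By \<open>two\<close> some other
  \<open>k \<in> D\<close> contains \<open>x\<close>, hence that ridge too; a ridge has only two
  facets, so \<open>h = k\<close>. Strong connectivity of the star does the rest.\<close>

lemma cycle_is_whole_link:
  assumes FF: "strong_pm d FF" and e: "finite e" "Suc (card e) = d"
    and D: "D \<subseteq> star FF e" "D \<noteq> {}"
    and two: "\<And>g x. g \<in> D \<Longrightarrow> x \<in> g \<Longrightarrow> x \<notin> e \<Longrightarrow> \<exists>h\<in>D. x \<in> h \<and> h \<noteq> g"
  shows "D = star FF e"
proof (rule strong_pm_connected[OF FF e(1) _ D])
  show "card e < d" using e by simp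
  fix g h assume gh: "g \<in> D" "h \<in> star FF e" "card (g \<inter> h) = d"
  have g: "g \<in> FF" "e \<subseteq> g" and h: "h \<in> FF" "e \<subseteq> h"
    using gh D unfolding star_def by auto
  have "\<not> g \<inter> h \<subseteq> e"
    using card_mono[OF e(1), of "g \<inter> h"] gh(3) e(2) by auto
  then obtain x where x: "x \<in> g" "x \<in> h" "x \<notin> e" by blast
  obtain k where k: "k \<in> D" "x \<in> k" "k \<noteq> g" using two[OF gh(1) x(1,3)] by blast
  have kF: "k \<in> FF" "e \<subseteq> k" using k D unfolding star_def by auto
  have fg: "finite g" "card g = Suc d" using strong_pmD(2,3)[OF FF g(1)] by auto
  have "card (g - insert x e) = 1" using fg x e g(2) by (subst card_Diff_subset) auto
  then obtain y where "g - insert x e = {y}" by (auto simp: card_1_singleton_iff)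
  then have r: "g - {y} = insert x e" "y \<in> g" using x(1) g(2) by auto
  show "h \<in> D"
  proof (cases "h = g")
    case False
    have "h = k" using r x k kF h False
      by (intro ridge_two[OF strong_pmD(4)[OF FF g(1) r(2)] g(1) r(2)]) (auto simp: star_def)
    then show ?thesis using k by simp
  qed (use gh in simp)
qed

lemma prune:
  shows "set (prune e F) \<subseteq> set F"
    and "g \<in> set (prune e F) \<Longrightarrow> x \<in> set g \<Longrightarrow> x \<notin> set e \<Longrightarrow> \<exists>h\<in>set (prune e F). x \<in> set h \<and> h \<noteq> g"
proof (induction e F rule: prune.induct)
  case (1 e F)
  let ?G = "cyclic_part e F"
  have sub: "set ?G \<subseteq> set F" unfolding cyclic_part_def by auto
  {
    case 1
    show ?case
    proof (cases "length ?G < length F")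
      case True
      then show ?thesis
        using "1.IH"(1)[OF refl True] sub prune.simps[of e F] by (auto simp: Let_def)
    next
      case False
      then show ?thesis using prune.simps[of e F] by (simp add: Let_def)
    qed
  next
    case 2
    show ?case
    proof (cases "length ?G < length F")
      case True
      then have "prune e F = prune e ?G" using prune.simps[of e F] by (simp add: Let_def)
      then show ?thesis using "1.IH"(2)[OF refl True] 2 by simp
    next
      case False
      then have eq: "prune e F = F" using prune.simps[of e F] by (simp add: Let_def)
      have "\<forall>g\<in>set F. list_all (\<lambda>x. x \<in> set e \<or> list_ex (\<lambda>h. x \<in> set h \<and> h \<noteq> g) F) g"
        (is "\<forall>g\<in>set F. ?P g")
      proof (intro ballI, rule ccontr)
        fix g assume "g \<in> set F" "\<not> ?P g"
        then have "length ?G < length F" unfolding cyclic_part_def by (rule length_filter_less)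
        then show False using False by blast
      qed
      then have "list_all (\<lambda>x. x \<in> set e \<or> list_ex (\<lambda>h. x \<in> set h \<and> h \<noteq> g) F) g"
        using 2(1) unfolding eq by (rule bspec)
      then show ?thesis using 2(2,3) unfolding eq list_all_iff list_ex_iff by blast
    qed
  }
qed

lemma not_premature:
  assumes FF: "strong_pm d FF" and emb: "embeds d FF \<gamma> U F"
    and e: "distinct e" "Suc (length e) = d" "set e \<subseteq> set U"
  shows "\<not> premature F e"
proof
  assume "premature F e"
  define G where "G = incident e F"
  define D where "D = prune e G"
  have prem: "D \<noteq> []" "length D < length G"
    using \<open>premature F e\<close> unfolding premature_def G_def D_def by (auto simp: Let_def)
  let ?i = "\<lambda>f. \<gamma> ` set f"
  have inj: "inj_on \<gamma> (set U)" and distF: "distinct F"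
    using emb unfolding embeds_def by (auto simp: distinct_map)
  have GF: "set G \<subseteq> set F" and Ge: "\<And>g. g \<in> set G \<Longrightarrow> set e \<subseteq> set g"
    unfolding G_def by (auto simp: set_incident)
  have DG: "set D \<subseteq> set G" unfolding D_def by (rule prune)
  have iG: "?i ` set G \<subseteq> star FF (?i e)"
  proof (rule image_subsetI)
    fix g assume "g \<in> set G"
    then show "?i g \<in> star FF (?i e)"
      using embedsD(4)[OF emb, of g] GF Ge unfolding star_def by auto
  qed
  have "?i ` set D = star FF (?i e)"
  proof (rule cycle_is_whole_link[OF FF])
    show "finite (?i e)" by simp
    have "card (?i e) = length e" using inj e by (metis card_image distinct_card inj_on_subset)
    then show "Suc (card (?i e)) = d" using e by simp
    show "?i ` set D \<subseteq> star FF (?i e)" using iG DG by blast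
    show "?i ` set D \<noteq> {}" using prem by simp
    fix g' x' assume "g' \<in> ?i ` set D" "x' \<in> g'" "x' \<notin> ?i e"
    then obtain g x where gx: "g' = ?i g" "g \<in> set D" "x' = \<gamma> x" "x \<in> set g" "x \<notin> set e"
      by blast
    then obtain h where h: "h \<in> set D" "x \<in> set h" "h \<noteq> g"
      using prune(2)[of g e G x] unfolding D_def by blast
    have "?i h \<noteq> ?i g" using embeds_image_eq[OF emb, of h g] h gx(2) DG GF by blast
    then show "\<exists>h\<in>?i ` set D. x' \<in> h \<and> h \<noteq> g'" using h gx by blast
  qed
  then have "?i ` set G \<subseteq> ?i ` set D" using iG by simp
  have "set G \<subseteq> set D"
  proof
    fix g assume "g \<in> set G"
    then obtain h where "h \<in> set D" "?i g = ?i h"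
      using \<open>?i ` set G \<subseteq> ?i ` set D\<close> by blast
    then show "g \<in> set D"
      using embeds_image_eq[OF emb, of g h] \<open>g \<in> set G\<close> DG GF by blast
  qed
  then have "card (set G) \<le> card (set D)" by (intro card_mono) auto
  moreover have "distinct G" using distF unfolding G_def incident_def by simp
  then have "card (set G) = length G" by (rule distinct_card)
  ultimately show False using prem(2) card_length[of D] by linarith
qed

lemma not_contradictory:
  assumes FF: "strong_pm d FF" and emb: "embeds d FF \<gamma> U F" and d: "1 \<le> d"
    and bound: "\<And>k x. c = Some k \<Longrightarrow> card (star FF {x}) \<le> k"
  shows "\<not> contradictory c F"
proof (cases F)
  case (Cons f F')
  have f: "f \<in> set F" using Cons by simp
  note fD = embedsD[OF emb f]
  have inj: "inj_on \<gamma> (set U)" using emb unfolding embeds_def by blast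
  note le = length_incident_le[OF emb strong_pmD(1)[OF FF]]
  have "length (incident [v] F) \<le> k" if "c = Some k" for k v
    using le[of "[v]"] bound[OF that, of "\<gamma> v"] by simp
  then have 1: "\<not> (case c of None \<Rightarrow> False | Some k \<Rightarrow> list_ex (\<lambda>v. k < length (incident [v] F)) f)"
    by (auto simp: list_ex_iff not_less split: option.splits)
  have "length (incident r F) \<le> 2" if r: "r \<in> set (facets_of f)" for r
  proof -
    obtain v where v: "v \<in> set f" "set r = set f - {v}" using facets_of(1)[OF r fD(1)] by blast
    have "\<gamma> ` set r = \<gamma> ` set f - {\<gamma> v}"
      using inj_on_image_set_diff[OF inj, of "set f" "{v}"] fD(3) v by auto
    then show ?thesis using le[of r] strong_pmD(4)[OF FF fD(4), of "\<gamma> v"] v(1) by simp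
  qed
  then have 2: "\<not> list_ex (\<lambda>r. 2 < length (incident r F)) (facets_of f)"
    by (auto simp: list_ex_iff not_less)
  have "\<not> premature F e" if "e \<in> set (codim2_of f)" for e
    using codim2_of[OF that fD(1)] fD by (intro not_premature[OF FF emb]) auto
  then have 3: "\<not> list_ex (premature F) (codim2_of f)" by (auto simp: list_ex_iff)
  show ?thesis using 1 2 3 unfolding Cons by simp
qed simp

text \<open>The relabelling followed by \<open>\<gamma>\<close> embeds \<open>M\<close> into
  \<open>FF\<close>. Its image contains both facets at each of its ridges, so it is closed under
  adjacency, and strong connectivity makes it all of \<open>FF\<close>.\<close>

lemma matches_isomorphic:
  assumes FF: "strong_pm d FF" and d: "1 \<le> d" and emb: "embeds d FF \<gamma> U F"
    and M: "closed_facets d M" and ls: "distinct ls" and mt: "matches ls M F p"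
  shows "complex_isomorphic (set ` set M) FF"
proof -
  let ?V = "set (take (length p) ls)"
  define \<sigma> where "\<sigma> = relabel ls p"
  define \<delta> where "\<delta> = \<gamma> \<circ> \<sigma>"
  have distp: "distinct p" using mt unfolding matches_def by blast
  have inj\<gamma>: "inj_on \<gamma> (set U)" using emb unfolding embeds_def by blast
  have nth: "relabel ls p (ls ! i) = p ! i" if "i < length p" "i < length ls" for i
  proof -
    have "distinct (map fst (zip ls p))" using ls by (simp add: map_fst_zip_take)
    moreover have "(ls ! i, p ! i) \<in> set (zip ls p)" using that by (auto simp: in_set_zip)
    ultimately have "map_of (zip ls p) (ls ! i) = Some (p ! i)" by (rule map_of_is_SomeI)
    then show ?thesis unfolding relabel_def by simp
  qed
  have inj\<sigma>: "inj_on \<sigma> ?V"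
  proof (rule inj_onI)
    fix x y assume "x \<in> ?V" "y \<in> ?V" "\<sigma> x = \<sigma> y"
    then obtain i j where "i < length p" "i < length ls" "x = ls ! i"
      "j < length p" "j < length ls" "y = ls ! j" by (auto simp: in_set_conv_nth)
    then show "x = y"
      using \<open>\<sigma> x = \<sigma> y\<close> nth distp nth_eq_iff_index_eq[OF distp] unfolding \<sigma>_def by metis
  qed
  have MV: "set m \<subseteq> ?V" if "m \<in> set M" for m
    using mt that unfolding matches_def list_all_iff by blast
  have MF: "\<exists>f\<in>set F. \<sigma> ` set m = set f" if m: "m \<in> set M" for m
  proof -
    have "\<exists>f\<in>set F. \<forall>x\<in>set m. \<sigma> x \<in> set f"
      using mt m unfolding matches_def list_all_iff list_ex_iff \<sigma>_def by simp
    then obtain f where f: "f \<in> set F" "\<sigma> ` set m \<subseteq> set f" by auto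
    have "card (\<sigma> ` set m) = card (set m)"
      using inj_on_subset[OF inj\<sigma> MV[OF m]] by (rule card_image)
    also have "\<dots> = Suc d"
      using M m unfolding closed_facets_def list_all_iff by (simp add: distinct_card)
    also have "\<dots> = card (set f)" using embedsD(1,2)[OF emb f(1)] by (simp add: distinct_card)
    finally have "\<sigma> ` set m = set f" using f(2) by (intro card_subset_eq) auto
    then show ?thesis using f(1) by blast
  qed
  have \<sigma>U: "\<sigma> ` \<Union>(set ` set M) \<subseteq> set U"
    using MF embedsD(3)[OF emb] by fastforce
  have inj\<delta>: "inj_on \<delta> (\<Union>(set ` set M))" unfolding \<delta>_def
    by (rule comp_inj_on[OF inj_on_subset[OF inj\<sigma>] inj_on_subset[OF inj\<gamma> \<sigma>U]]) (use MV in auto)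
  define G where "G = (\<lambda>s. \<delta> ` s) ` set ` set M"
  have GF: "G \<subseteq> FF"
  proof
    fix g assume "g \<in> G"
    then obtain m where m: "m \<in> set M" "g = \<gamma> ` \<sigma> ` set m"
      unfolding G_def \<delta>_def by (auto simp: image_comp)
    then show "g \<in> FF" using MF[OF m(1)] embedsD(4)[OF emb] by auto
  qed
  \<comment> \<open>Strong connectivity at the empty face is that of the whole system, since
    \<open>star FF {} = FF\<close>.\<close>
  have "G = star FF {}"
  proof (rule strong_pm_connected[OF FF])
    show "G \<subseteq> star FF {}" using GF unfolding star_def by auto
    show "G \<noteq> {}" using M unfolding G_def closed_facets_def by simp
    fix g h assume gh: "g \<in> G" "h \<in> star FF {}" "card (g \<inter> h) = d"
    have hF: "h \<in> FF" using gh unfolding star_def by simp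
    show "h \<in> G"
    proof (cases "h = g")
      case False
      obtain m where m: "m \<in> set M" "g = \<delta> ` set m" using gh(1) unfolding G_def by blast
      have gF: "g \<in> FF" using gh(1) GF by blast
      have "card (g - g \<inter> h) = 1"
        using strong_pmD(2,3)[OF FF gF] gh(3) by (subst card_Diff_subset) auto
      then obtain y where "g - g \<inter> h = {y}" by (auto simp: card_1_singleton_iff)
      then have y: "y \<in> g" "g - {y} \<subseteq> h" by auto
      then obtain v where v: "v \<in> set m" "y = \<delta> v" using m by blast
      have dm: "distinct m" using M m(1) unfolding closed_facets_def list_all_iff by blast
      obtain r where r: "r \<in> set (facets_of m)" "set r = set m - {v}"
        using facets_of_complete[OF dm v(1)] by blast
      obtain m' where m': "m' \<in> set M" "set r \<subseteq> set m'" "\<not> set m \<subseteq> set m'"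
        using M m(1) r(1) unfolding closed_facets_def list_all_iff list_ex_iff set_incident by blast
      have sub: "set m \<subseteq> \<Union>(set ` set M)" "set m' \<subseteq> \<Union>(set ` set M)"
        using m m' by auto
      have "g - {y} = \<delta> ` set r"
        using inj_on_image_set_diff[OF inj\<delta>, of "set m" "{v}"] sub v m r(2) by auto
      then have "g - {y} \<subseteq> \<delta> ` set m'" using m'(2) by blast
      moreover have "\<delta> ` set m' \<noteq> g"
        using inj_on_image_eq_iff[OF inj\<delta> sub] m'(3) m(2) by auto
      moreover have "\<delta> ` set m' \<in> G" using m' unfolding G_def by blast
      moreover have "h = \<delta> ` set m'"
      proof (rule ridge_two[OF strong_pmD(4)[OF FF gF y(1)] gF y(1) _ False])
        show "h \<in> star FF (g - {y})" using hF y unfolding star_def by simp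
        show "\<delta> ` set m' \<in> star FF (g - {y})"
          using calculation GF unfolding star_def by auto
      qed (rule calculation)
      ultimately show ?thesis by simp
    qed (use gh in simp)
  qed (use d in auto)
  then have "G = FF" unfolding star_def by simp
  moreover have "\<delta> ` \<Union>(set ` set M) = \<Union>G" unfolding G_def by blast
  ultimately show ?thesis
    using inj\<delta> unfolding complex_isomorphic_def bij_betw_def G_def by auto
qed

lemma embeds_extend:
  assumes "embeds d FF \<gamma> U F" "set r \<subseteq> set U" "v \<in> set U" "v \<notin> set r" "distinct r" "length r = d"
    "insert (\<gamma> v) (\<gamma> ` set r) \<in> FF" "\<And>g. g \<in> set F \<Longrightarrow> \<not> insert v (set r) \<subseteq> set g"
  shows "embeds d FF \<gamma> U ((v # r) # F)"
proof -
  have "insert v (set r) \<notin> set ` set F" using assms(8) by auto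
  then show ?thesis using assms(1-7) unfolding embeds_def by simp
qed

lemma embeds_fresh:
  assumes emb: "embeds d FF \<gamma> U F" and w: "w \<notin> set U" and y: "y \<notin> \<gamma> ` set U" "y \<in> \<Union>FF"
  shows "embeds d FF (\<gamma>(w := y)) (U @ [w]) F"
proof -
  have "(\<gamma>(w := y)) ` set f = \<gamma> ` set f" if "f \<in> set F" for f
    using embedsD(3)[OF emb that] w by auto
  then show ?thesis using emb w y unfolding embeds_def by (auto simp: inj_on_def)
qed

definition admissible :: "nat \<Rightarrow> 'v set set \<Rightarrow> 'a list \<Rightarrow> nat option \<Rightarrow> 'a list list list \<Rightarrow> bool" where
  "admissible d FF ls c cat \<longleftrightarrow> strong_pm d FF \<and> 1 \<le> d \<and>
     (\<forall>k x. c = Some k \<longrightarrow> card (star FF {x}) \<le> k) \<and> distinct ls \<and>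
     (\<forall>M\<in>set cat. closed_facets d M)"

lemma open_ridge:
  assumes "open_ridge F fs = Some (f, r)" "set fs \<subseteq> set F" "\<And>f. f \<in> set F \<Longrightarrow> distinct f"
  shows "f \<in> set F" "r \<in> set (facets_of f)" "incident r F = [f]"
proof -
  have *: "f \<in> set F \<and> r \<in> set (facets_of f) \<and> length (incident r F) = 1"
    using assms(1,2)
  proof (induction fs)
    case (Cons g fs)
    show ?case
    proof (cases "find (\<lambda>r. length (incident r F) = 1) (facets_of g)")
      case None
      then show ?thesis using Cons by (simp del: One_nat_def)
    next
      case (Some q)
      then have "q \<in> set (facets_of g)" "length (incident q F) = 1"
        by (auto simp: find_Some_iff)
      moreover have "f = g" "r = q" using Cons.prems(1) Some by (simp_all del: One_nat_def)
      ultimately show ?thesis using Cons.prems(2) by simp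
    qed
  qed simp
  then show "f \<in> set F" "r \<in> set (facets_of f)" by blast+
  then have "set r \<subseteq> set f" using facets_of(1)[of r f] assms(3) by blast
  then have "f \<in> set (incident r F)"
    using \<open>f \<in> set F\<close> by (simp add: set_incident)
  moreover obtain g where "incident r F = [g]" using * by (auto simp: length_Suc_conv)
  ultimately show "incident r F = [f]" by simp
qed

lemma admissible_not_contradictory:
  "admissible d FF ls c cat \<Longrightarrow> embeds d FF \<gamma> U F \<Longrightarrow> \<not> contradictory c F"
  using not_contradictory[of d FF \<gamma> U F c] unfolding admissible_def by auto

text \<open>The second part follows one open ridge \<open>r\<close>: \<open>f\<close> is its known
  facet and \<open>y\<close> the vertex completing it to the other facet of \<open>FF\<close>. The
  invariant is that \<open>y\<close> is the image of a label still to be tried or has no label yet.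
  \<open>\<gamma>\<close> is arbitrary because a fresh label extends it.\<close>

lemma check_sound_aux:
  shows "check ls c cat U W F t \<Longrightarrow> admissible d FF ls c cat \<Longrightarrow> embeds d FF \<gamma> U F \<Longrightarrow>
      distinct (U @ W) \<Longrightarrow> card (\<Union>FF) \<le> length (U @ W) \<Longrightarrow>
      \<exists>M\<in>set cat. complex_isomorphic (set ` set M) FF"
    and "checks ls c cat U W F r vs ts \<Longrightarrow> admissible d FF ls c cat \<Longrightarrow> embeds d FF \<gamma> U F \<Longrightarrow>
      distinct (U @ W) \<Longrightarrow> card (\<Union>FF) \<le> length (U @ W) \<Longrightarrow>
      distinct r \<Longrightarrow> length r = d \<Longrightarrow> incident r F = [f] \<Longrightarrow>
      insert y (\<gamma> ` set r) \<in> FF \<Longrightarrow> set vs \<subseteq> set U - set f \<Longrightarrow>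
      y \<in> \<gamma> ` set vs \<or> y \<notin> \<gamma> ` set U \<Longrightarrow> \<exists>M\<in>set cat. complex_isomorphic (set ` set M) FF"
proof (induction ls c cat U W F t and ls c cat U W F r vs ts
    arbitrary: \<gamma> and \<gamma> f y rule: check_checks.induct)
  case (1 ls c cat U W F i p)
  then show ?case using matches_isomorphic[of d FF \<gamma> U F "cat ! i" ls p] nth_mem[of i cat]
    unfolding admissible_def by auto
next
  case (2 ls c cat U W F ts)
  then obtain f r where op: "open_ridge F F = Some (f, r)"
    and chk: "checks ls c cat U W F r (filter (\<lambda>v. v \<notin> set f) U) ts"
    by (auto split: option.splits)
  have FF: "strong_pm d FF" using 2 unfolding admissible_def by simp
  note emb = "2.prems"(3)
  note R = open_ridge[OF op order_refl embedsD(1)[OF emb]]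
  note fD = embedsD[OF emb R(1)]
  have inj: "inj_on \<gamma> (set U)" using emb unfolding embeds_def by simp
  obtain u where u: "u \<in> set f" "set r = set f - {u}" and r: "distinct r"
    using facets_of[OF R(2) fD(1)] by blast
  define g where "g = \<gamma> ` set f"
  have g: "g \<in> FF" "\<gamma> u \<in> g" "g - {\<gamma> u} = \<gamma> ` set r"
  proof -
    show "g \<in> FF" unfolding g_def by (rule fD(4))
    show "\<gamma> u \<in> g" unfolding g_def using u(1) by (rule imageI)
    have "\<gamma> ` (set f - {u}) = \<gamma> ` set f - \<gamma> ` {u}"
      using fD(3) u(1) by (intro inj_on_image_set_diff[OF inj]) auto
    then show "g - {\<gamma> u} = \<gamma> ` set r" unfolding g_def u(2) by simp
  qed
  \<comment> \<open>\<open>h\<close> is the second facet at the image of the open ridge, and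
    \<open>y\<close> its vertex off that ridge. As \<open>h \<noteq> g\<close>, \<open>y\<close> is
    not the image of a label of \<open>f\<close>, which is why these labels are filtered
    out.\<close>
  have "card (star FF (g - {\<gamma> u}) - {g}) = 1"
    using strong_pmD(4)[OF FF g(1,2)] g(1) by (subst card_Diff_singleton) (auto simp: star_def)
  then obtain h where "star FF (g - {\<gamma> u}) - {g} = {h}" by (auto simp: card_1_singleton_iff)
  then have "h \<in> star FF (g - {\<gamma> u})" and h3: "h \<noteq> g" by blast+
  then have h: "h \<in> FF" "\<gamma> ` set r \<subseteq> h" unfolding star_def g(3) by simp_all
  have cr: "card (\<gamma> ` set r) = d"
    using strong_pmD(2,3)[OF FF g(1)] g(2) unfolding g(3)[symmetric] by simp
  then have "card (h - \<gamma> ` set r) = 1"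
    using strong_pmD(2,3)[OF FF h(1)] h(2) by (subst card_Diff_subset) auto
  then obtain y where "h - \<gamma> ` set r = {y}" by (auto simp: card_1_singleton_iff)
  then have y: "h = insert y (\<gamma> ` set r)" "y \<notin> \<gamma> ` set r" using h(2) by blast+
  have "g = insert (\<gamma> u) (\<gamma> ` set r)" using g(2,3) by blast
  then have "y \<noteq> \<gamma> u" using h3 y(1) by blast
  then have yf: "y \<notin> \<gamma> ` set f" using y(2) u(2) by blast
  have "card (set f) = Suc (card (set r))"
    unfolding u(2) using u(1) by (rule card.remove[OF finite_set])
  then have lr: "length r = d" using fD(1,2) r by (simp add: distinct_card)
  have iy: "insert y (\<gamma> ` set r) \<in> FF" using h(1) y(1) by simp
  have sub: "set (filter (\<lambda>v. v \<notin> set f) U) \<subseteq> set U - set f" by auto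
  have yy: "y \<in> \<gamma> ` set (filter (\<lambda>v. v \<notin> set f) U) \<or> y \<notin> \<gamma> ` set U"
    using yf by auto
  show ?case by (rule "2.IH"[OF op refl chk "2.prems"(2-5) r lr R(3) iy sub yy])
next
  case (3 ls c cat U W F r v vs ts)
  note prems = "3.prems"
  have chk: "if contradictory c ((v # r) # F) then checks ls c cat U W F r vs ts
      else case ts of [] \<Rightarrow> False
      | t # ts' \<Rightarrow> check ls c cat U W ((v # r) # F) t \<and> checks ls c cat U W F r vs ts'"
    using prems(1) by simp
  show ?case
  proof (cases "y = \<gamma> v")
    case True
    have "f \<in> set (incident r F)" using prems(8) by simp
    then have rf: "set r \<subseteq> set f" "f \<in> set F" by (auto simp: set_incident)
    have v: "v \<in> set U" "v \<notin> set f" using prems(10) by auto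
    have "\<not> insert v (set r) \<subseteq> set g" if g: "g \<in> set F" for g
    proof
      assume "insert v (set r) \<subseteq> set g"
      then have "g \<in> set (incident r F)" using g by (simp add: set_incident)
      then show False using prems(8) v \<open>insert v (set r) \<subseteq> set g\<close> by simp
    qed
    then have emb: "embeds d FF \<gamma> U ((v # r) # F)"
      using prems v rf True embedsD(3)[OF prems(3) rf(2)] by (intro embeds_extend) auto
    have nr: "\<not> contradictory c ((v # r) # F)"
      by (rule admissible_not_contradictory[OF prems(2) emb])
    then obtain t ts' where ts: "ts = t # ts'" "check ls c cat U W ((v # r) # F) t"
      using chk by (auto split: list.splits)
    show ?thesis by (rule "3.IH"(2)[OF nr ts(1,2) prems(2) emb prems(4,5)])
  next
    case False
    then have y: "y \<in> \<gamma> ` set vs \<or> y \<notin> \<gamma> ` set U" and vs: "set vs \<subseteq> set U - set f"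
      using prems(10,11) by auto
    show ?thesis
    proof (cases "contradictory c ((v # r) # F)")
      case True
      show ?thesis by (rule "3.IH"(1)[OF True _ prems(2-9) vs y]) (use chk True in simp)
    next
      case nr: False
      then obtain t ts' where ts: "ts = t # ts'" "checks ls c cat U W F r vs ts'"
        using chk by (auto split: list.splits)
      show ?thesis by (rule "3.IH"(3)[OF nr ts(1,2) prems(2-9) vs y])
    qed
  qed
next
  case (4 ls c cat U w W F r ts)
  note prems = "4.prems"
  have w: "w \<notin> set U" and yU: "y \<notin> \<gamma> ` set U" using prems by auto
  have "f \<in> set (incident r F)" using prems(8) by simp
  then have rf: "set r \<subseteq> set f" "f \<in> set F" by (auto simp: set_incident)
  have rU: "set r \<subseteq> set U" using rf embedsD(3)[OF prems(3) rf(2)] by simp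
  \<comment> \<open>All labels in use have been refuted, so \<open>y\<close> is an unlabelled vertex
    and receives the fresh label \<open>w\<close>.\<close>
  let ?\<gamma> = "\<gamma>(w := y)"
  have emb: "embeds d FF ?\<gamma> (U @ [w]) F"
    by (rule embeds_fresh[OF prems(3) w yU]) (use prems(9) in blast)
  have "?\<gamma> ` set r = \<gamma> ` set r" using rU w by auto
  then have "insert (?\<gamma> w) (?\<gamma> ` set r) \<in> FF" using prems(9) by simp
  moreover have "w \<notin> set g" if "g \<in> set F" for g
    using w embedsD(3)[OF prems(3) that] by auto
  ultimately have emb2: "embeds d FF ?\<gamma> (U @ [w]) ((w # r) # F)"
    using rU w prems(6,7) by (intro embeds_extend[OF emb]) auto
  have nr: "\<not> contradictory c ((w # r) # F)"
    by (rule admissible_not_contradictory[OF prems(2) emb2])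
  then obtain t ts' where ts: "ts = t # ts'" "check ls c cat (U @ [w]) W ((w # r) # F) t"
    using prems(1) by (auto split: list.splits)
  show ?case by (rule "4.IH"[OF nr ts(1,2) prems(2) emb2]) (use prems(4,5) in simp_all)
next
  case (5 ls c cat U F r ts)
  have yU: "y \<notin> \<gamma> ` set U" using 5 by auto
  have inj: "inj_on \<gamma> (set U)" using "5.prems"(3) unfolding embeds_def by simp
  have FF: "strong_pm d FF" using "5.prems" unfolding admissible_def by simp
  \<comment> \<open>No label is left although \<open>y\<close> is unlabelled; together with the
    images of \<open>U\<close> this is one vertex more than the bound on
    \<open>card (\<Union>FF)\<close> allows.\<close>
  have "finite (\<Union>FF)" using strong_pmD(1,2)[OF FF] by blast
  moreover have "insert y (\<gamma> ` set U) \<subseteq> \<Union>FF"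
    using "5.prems"(3,9) unfolding embeds_def by blast
  ultimately have "card (insert y (\<gamma> ` set U)) \<le> card (\<Union>FF)" by (rule card_mono)
  moreover have "card (insert y (\<gamma> ` set U)) = Suc (length U)"
    using yU inj "5.prems"(4) by (simp add: card_image distinct_card)
  ultimately show ?case using "5.prems"(5) by simp
qed

theorem check_sound:
  assumes "check ls c cat U W F t" "strong_pm d FF" "1 \<le> d"
    "\<And>k x. c = Some k \<Longrightarrow> card (star FF {x}) \<le> k"
    "distinct ls" "\<And>M. M \<in> set cat \<Longrightarrow> closed_facets d M"
    "embeds d FF \<gamma> U F" "distinct (U @ W)" "card (\<Union>FF) \<le> length (U @ W)"
  shows "\<exists>M\<in>set cat. complex_isomorphic (set ` set M) FF"
  by (rule check_sound_aux(1)[OF assms(1) _ assms(7-9)])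
     (use assms(2-6) in \<open>simp add: admissible_def\<close>)

lemma link_down_closure:
  "link_complex {v} (down_closure FF) = down_closure (link_facets v FF)"
proof (intro equalityI subsetI)
  fix \<tau> assume "\<tau> \<in> link_complex {v} (down_closure FF)"
  then obtain f where f: "v \<notin> \<tau>" "f \<in> FF" "\<tau> \<union> {v} \<subseteq> f"
    unfolding link_complex_def down_closure_def by auto
  then have "f - {v} \<in> link_facets v FF" unfolding link_facets_def by (simp add: insert_absorb)
  moreover have "\<tau> \<subseteq> f - {v}" using f(1,3) by blast
  ultimately show "\<tau> \<in> down_closure (link_facets v FF)" unfolding down_closure_def by blast
next
  fix \<tau> assume "\<tau> \<in> down_closure (link_facets v FF)"
  then obtain g where "\<tau> \<subseteq> g" "v \<notin> g" "insert v g \<in> FF"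
    unfolding down_closure_def link_facets_def by auto
  then show "\<tau> \<in> link_complex {v} (down_closure FF)"
    unfolding link_complex_def down_closure_def by blast
qed

subsection \<open>Flips and separation on lists of facets\<close>

abbreviation complex_of :: "'a list list \<Rightarrow> 'a set set" where
  "complex_of F \<equiv> down_closure (set ` set F)"

lemma complex_of_facets_of:
  assumes "distinct xs"
  shows "complex_of (facets_of xs) = bdry (set xs)"
proof (intro equalityI subsetI)
  fix \<sigma> assume "\<sigma> \<in> complex_of (facets_of xs)"
  then obtain r where r: "r \<in> set (facets_of xs)" "\<sigma> \<subseteq> set r"
    unfolding down_closure_def by blast
  obtain v where "v \<in> set xs" "set r = set xs - {v}" using facets_of(1)[OF r(1) assms] by blast
  then show "\<sigma> \<in> bdry (set xs)" using r(2) unfolding bdry_def by blast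
next
  fix \<sigma> assume "\<sigma> \<in> bdry (set xs)"
  then obtain v where v: "v \<in> set xs" "\<sigma> \<subseteq> set xs - {v}"
    unfolding bdry_def by blast
  obtain r where "r \<in> set (facets_of xs)" "set r = set xs - {v}"
    using facets_of_complete[OF assms v(1)] by blast
  then show "\<sigma> \<in> complex_of (facets_of xs)"
    using v(2) unfolding down_closure_def by blast
qed

definition flip_list :: "'a list \<Rightarrow> 'a list \<Rightarrow> 'a list list \<Rightarrow> 'a list list" where
  "flip_list A B F =
     filter (\<lambda>f. \<not> list_all (\<lambda>x. x \<in> set f) A) F @ map (\<lambda>a. B @ remove1 a A) A"

text \<open>The conditions on facets say that \<open>B\<close> is not a face and that the link of
  \<open>A\<close> contains only proper subsets of \<open>B\<close>; the last condition supplies the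
  maximal ones, so the link is all of \<open>bdry B\<close>.\<close>

definition flip_valid :: "nat \<Rightarrow> 'a list \<Rightarrow> 'a list \<Rightarrow> 'a list list \<Rightarrow> bool" where
  "flip_valid d A B F \<longleftrightarrow> A \<noteq> [] \<and> B \<noteq> [] \<and> distinct (A @ B) \<and>
     length (A @ B) = Suc (Suc d) \<and>
     list_all (\<lambda>f. \<not> list_all (\<lambda>x. x \<in> set f) B \<and>
       (list_all (\<lambda>x. x \<in> set f) A \<longrightarrow> list_all (\<lambda>x. x \<in> set (A @ B)) f)) F \<and>
     list_all (\<lambda>b. list_ex (\<lambda>f. list_all (\<lambda>x. x \<in> set f) (A @ remove1 b B)) F) B"

lemma sphere_complex_flip_list:
  assumes K: "sphere_complex d (complex_of F)" and val: "flip_valid d A B F"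
  shows "sphere_complex d (complex_of (flip_list A B F))"
proof -
  define K where "K = complex_of F"
  have ne: "A \<noteq> []" "B \<noteq> []" and dist: "distinct A" "distinct B" "set A \<inter> set B = {}"
    and len: "length A + length B = Suc (Suc d)" using val unfolding flip_valid_def by auto
  have nB: "\<not> set B \<subseteq> set f" and AF: "set A \<subseteq> set f \<Longrightarrow> set f \<subseteq> set A \<union> set B"
    if "f \<in> set F" for f using val that unfolding flip_valid_def list_all_iff by auto
  have star: "\<exists>f\<in>set F. set A \<union> (set B - {b}) \<subseteq> set f" if "b \<in> set B" for b
  proof -
    have "\<exists>f\<in>set F. \<forall>x\<in>set (A @ remove1 b B). x \<in> set f"
      using val that unfolding flip_valid_def list_all_iff list_ex_iff by blast
    then show ?thesis using dist(2) by (auto simp: set_remove1_eq)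
  qed
  have Km: "\<sigma> \<in> K \<longleftrightarrow> (\<exists>f\<in>set F. \<sigma> \<subseteq> set f)" for \<sigma>
    unfolding K_def down_closure_def by auto
  have cx: "abstract_complex K" using K unfolding sphere_complex_def K_def by blast
  have BK: "set B \<notin> K" using nB unfolding Km by blast
  obtain b0 where "b0 \<in> set B" using ne(2) by (cases B) auto
  then have AK: "set A \<in> K" using star[of b0] unfolding Km by blast
  have lk: "link_complex (set A) K = bdry (set B)"
  proof (intro equalityI subsetI)
    fix \<tau> assume "\<tau> \<in> link_complex (set A) K"
    then obtain f where f: "\<tau> \<inter> set A = {}" "f \<in> set F" "\<tau> \<union> set A \<subseteq> set f"
      unfolding mem_link_complex[OF cx] unfolding Km by blast
    then have "\<tau> \<subseteq> set B" "\<not> set B \<subseteq> \<tau>"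
      using AF[OF f(2)] nB[OF f(2)] by blast+
    then show "\<tau> \<in> bdry (set B)" unfolding bdry_def by blast
  next
    fix \<tau> assume "\<tau> \<in> bdry (set B)"
    then obtain b where b: "b \<in> set B" "\<tau> \<subseteq> set B - {b}"
      unfolding bdry_def by blast
    obtain f where "f \<in> set F" "set A \<union> (set B - {b}) \<subseteq> set f"
      using star[OF b(1)] by blast
    then have "\<tau> \<union> set A \<in> K" using b(2) unfolding Km by blast
    moreover have "\<tau> \<inter> set A = {}" using b(2) dist(3) by blast
    ultimately show "\<tau> \<in> link_complex (set A) K" unfolding mem_link_complex[OF cx] by blast
  qed
  have fl: "flippable (set A) (set B) K"
    unfolding flippable_def using cx ne dist(3) AK BK lk by simp
  have "complex_of (flip_list A B F) = flip (set A) (set B) K"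
  proof (intro equalityI subsetI)
    fix \<sigma> assume "\<sigma> \<in> complex_of (flip_list A B F)"
    then obtain f where f: "f \<in> set (flip_list A B F)" "\<sigma> \<subseteq> set f"
      unfolding down_closure_def by auto
    then consider "f \<in> set F" "\<not> set A \<subseteq> set f" | a where "a \<in> set A" "f = B @ remove1 a A"
      unfolding flip_list_def by (auto simp: list_all_iff)
    then show "\<sigma> \<in> flip (set A) (set B) K"
    proof cases
      case 1
      then show ?thesis using f(2) unfolding flip_def Km by blast
    next
      case 2
      then have s: "\<sigma> \<subseteq> set B \<union> (set A - {a})"
        using f(2) dist(1) by (simp add: set_remove1_eq)
      then have nA: "\<not> set A \<subseteq> \<sigma>" "\<sigma> \<subseteq> set A \<union> set B"
        using 2(1) dist(3) by blast+
      show ?thesis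
      proof (cases "set B \<subseteq> \<sigma>")
        case False
        then obtain b where b: "b \<in> set B" "b \<notin> \<sigma>" by blast
        \<comment> \<open>A face of a new facet that misses some \<open>b\<close> of
          \<open>B\<close> lies in \<open>A \<union> (B - {b})\<close>, which is inside an old
          facet.\<close>
        obtain f where "f \<in> set F" "set A \<union> (set B - {b}) \<subseteq> set f"
          using star[OF b(1)] by blast
        then have "\<sigma> \<in> K" using b(2) nA(2) unfolding Km by blast
        then show ?thesis using nA unfolding flip_def by blast
      qed (use nA in \<open>simp add: flip_def\<close>)
    qed
  next
    fix \<sigma> assume \<sigma>: "\<sigma> \<in> flip (set A) (set B) K"
    then obtain a where a: "a \<in> set A" "a \<notin> \<sigma>" unfolding flip_def by blast
    have new: "\<sigma> \<in> complex_of (flip_list A B F)" if "\<sigma> \<subseteq> set A \<union> set B"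
    proof -
      have "\<sigma> \<subseteq> set (B @ remove1 a A)"
        using that a(2) dist(1) by (auto simp: set_remove1_eq)
      moreover have "B @ remove1 a A \<in> set (flip_list A B F)"
        using a(1) unfolding flip_list_def by simp
      ultimately show ?thesis unfolding down_closure_def by blast
    qed
    show "\<sigma> \<in> complex_of (flip_list A B F)"
    proof (cases "\<sigma> \<subseteq> set A \<union> set B")
      case False
      then obtain f where f: "f \<in> set F" "\<sigma> \<subseteq> set f"
        using \<sigma> unfolding flip_def Km by blast
      then have "\<not> set A \<subseteq> set f" using AF[OF f(1)] False by blast
      then have "f \<in> set (flip_list A B F)"
        using f(1) unfolding flip_list_def by (auto simp: list_all_iff)
      then show ?thesis using f(2) unfolding down_closure_def by blast
    qed (rule new)
  qed
  moreover have "card (set A) + card (set B) = Suc (Suc d)"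
    using dist len by (simp add: distinct_card)
  ultimately show ?thesis using sphere_complex_flip[OF _ fl] K unfolding K_def by simp
qed

text \<open>Each move flips an earlier entry and appends the result, so all intermediate complexes
  stay available as starting points and appear in the final list.\<close>

fun flips :: "(nat \<times> 'a list \<times> 'a list) list \<Rightarrow> 'a list list list \<Rightarrow> 'a list list list" where
  "flips [] cat = cat"
| "flips ((i, A, B) # ms) cat = flips ms (cat @ [flip_list A B (cat ! i)])"

fun flips_valid :: "nat \<Rightarrow> (nat \<times> 'a list \<times> 'a list) list \<Rightarrow> 'a list list list \<Rightarrow> bool" where
  "flips_valid d [] cat = True"
| "flips_valid d ((i, A, B) # ms) cat \<longleftrightarrow> i < length cat \<and> flip_valid d A B (cat ! i) \<and>
     flips_valid d ms (cat @ [flip_list A B (cat ! i)])"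

lemma sphere_complex_flips:
  assumes "flips_valid d ms cat" "\<And>F. F \<in> set cat \<Longrightarrow> sphere_complex d (complex_of F)"
    "F \<in> set (flips ms cat)"
  shows "sphere_complex d (complex_of F)" using assms
proof (induction ms cat arbitrary: F rule: flips.induct)
  case (2 i A B ms cat)
  have val: "i < length cat" "flip_valid d A B (cat ! i)"
    "flips_valid d ms (cat @ [flip_list A B (cat ! i)])" using "2.prems"(1) by simp_all
  have new: "sphere_complex d (complex_of (flip_list A B (cat ! i)))"
    by (rule sphere_complex_flip_list[OF "2.prems"(2)[OF nth_mem[OF val(1)]] val(2)])
  show ?case
  proof (rule "2.IH"[OF val(3)])
    show "sphere_complex d (complex_of G)" if "G \<in> set (cat @ [flip_list A B (cat ! i)])" for G
    proof (cases "G \<in> set cat")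
      case False
      then have "G = flip_list A B (cat ! i)" using that by simp
      then show ?thesis using new by (simp only:)
    qed (rule "2.prems"(2))
    show "F \<in> set (flips ms (cat @ [flip_list A B (cat ! i)]))" using "2.prems"(3) by simp
  qed
qed (auto simp only: flips.simps)

section \<open>Non-separating triangles on lists of facets\<close>

definition adjacent_off :: "'a list \<Rightarrow> 'a list \<Rightarrow> 'a list \<Rightarrow> bool" where
  "adjacent_off T m g = (let cs = filter (\<lambda>x. x \<in> set g) m in
     2 \<le> length cs \<and> list_ex (\<lambda>x. x \<notin> set T) cs)"

text \<open>The order of the list is itself the certificate of connectivity: every facet shares an
  edge not in \<open>T\<close> with an earlier one. The lists in \<open>nonspheres2\<close> and the
  facets around \<open>V3\<close> in \<open>nonmanifold3\<close> are written in such an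
  order.\<close>

fun connected_order :: "'a list \<Rightarrow> 'a list list \<Rightarrow> 'a list list \<Rightarrow> bool" where
  "connected_order T seen [] = True"
| "connected_order T seen (m # ms) =
     ((seen = [] \<or> list_ex (adjacent_off T m) seen) \<and> connected_order T (m # seen) ms)"

definition nonseparating :: "'a list list \<Rightarrow> 'a list \<Rightarrow> 'a \<Rightarrow> bool" where
  "nonseparating F T w \<longleftrightarrow> distinct T \<and> length T = 3 \<and> list_all distinct F \<and>
     list_all (\<lambda>r. list_ex (\<lambda>f. list_all (\<lambda>x. x \<in> set f) r) F) (facets_of T) \<and>
     \<not> list_ex (\<lambda>f. list_all (\<lambda>x. x \<in> set f) T) F \<and>
     w \<notin> set T \<and> list_ex (\<lambda>f. w \<in> set f) F \<and> connected_order T [] F"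

lemma adjacent_off:
  assumes "adjacent_off T m g" "distinct m"
  shows "\<exists>u v. {u, v} \<subseteq> set m \<inter> set g \<and> u \<noteq> v \<and> \<not> {u, v} \<subseteq> set T"
proof -
  define cs where "cs = filter (\<lambda>x. x \<in> set g) m"
  have cs: "2 \<le> length cs" "\<exists>u\<in>set cs. u \<notin> set T" "distinct cs" "set cs = set m \<inter> set g"
    using assms unfolding adjacent_off_def cs_def by (auto simp: list_ex_iff Let_def)
  then obtain u where u: "u \<in> set cs" "u \<notin> set T" by blast
  have "card (set cs) = length cs" using cs(3) by (rule distinct_card)
  moreover have "card (set cs) = Suc (card (set cs - {u}))"
    using u(1) by (rule card.remove[OF finite_set])
  ultimately have "card (set cs - {u}) \<noteq> 0" using cs(1) by linarith
  then have "set cs - {u} \<noteq> {}" by (metis card.empty)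
  then obtain v where "v \<in> set cs" "v \<noteq> u" by blast
  then show ?thesis using u cs(4) by blast
qed

text \<open>Each facet inherits the truth value of \<open>P\<close> from an earlier neighbour. With
  \<open>P\<close> as membership in an adjacency-closed set, that set contains all facets or
  none.\<close>

lemma connected_order_uniform:
  assumes "connected_order T seen ms" "list_all distinct ms"
    and step: "\<And>g h u v. g \<in> set seen \<union> set ms \<Longrightarrow> h \<in> set seen \<union> set ms \<Longrightarrow>
      {u, v} \<subseteq> set g \<inter> set h \<Longrightarrow> u \<noteq> v \<Longrightarrow> \<not> {u, v} \<subseteq> set T \<Longrightarrow> P g \<Longrightarrow> P h"
    and "(\<forall>g\<in>set seen. P g) \<or> (\<forall>g\<in>set seen. \<not> P g)"
  shows "(\<forall>g\<in>set seen \<union> set ms. P g) \<or> (\<forall>g\<in>set seen \<union> set ms. \<not> P g)"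
  using assms
proof (induction T seen ms rule: connected_order.induct)
  case (2 T seen m ms)
  have eq: "set (m # seen) \<union> set ms = set seen \<union> set (m # ms)" by auto
  have "(\<forall>g\<in>set (m # seen). P g) \<or> (\<forall>g\<in>set (m # seen). \<not> P g)"
  proof (cases "seen = []")
    case False
    then obtain g where g: "g \<in> set seen" "adjacent_off T m g"
      using "2.prems"(1) by (auto simp: list_ex_iff)
    then obtain u v where uv: "{u, v} \<subseteq> set m \<inter> set g" "u \<noteq> v" "\<not> {u, v} \<subseteq> set T"
      using adjacent_off[OF g(2)] "2.prems"(2) by auto
    have "P m \<longleftrightarrow> P g"
      using "2.prems"(3)[of m g u v] "2.prems"(3)[of g m u v] g(1) uv by auto
    then show ?thesis using "2.prems"(4) g(1) by auto
  qed simp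
  then have "(\<forall>g\<in>set (m # seen) \<union> set ms. P g) \<or> (\<forall>g\<in>set (m # seen) \<union> set ms. \<not> P g)"
    using "2.prems" unfolding eq[symmetric] by (intro "2.IH") (simp_all add: eq)
  then show ?case unfolding eq .
qed simp

lemma not_sphere_if_nonseparating:
  assumes "nonseparating F T w"
  shows "\<not> geometric_carrier (complex_of F) homeomorphic sphere (0 :: real^3) 1"
proof -
  have T: "distinct T" "length T = 3" and dist: "list_all distinct F"
    and edges: "\<And>r. r \<in> set (facets_of T) \<Longrightarrow> \<exists>f\<in>set F. set r \<subseteq> set f"
    and nT: "\<And>f. f \<in> set F \<Longrightarrow> \<not> set T \<subseteq> set f"
    and w: "w \<notin> set T" "\<exists>f\<in>set F. w \<in> set f" and ord: "connected_order T [] F"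
    using assms unfolding nonseparating_def list_all_iff list_ex_iff subset_eq by blast+
  show ?thesis
  proof (rule not_sphere_if_nonseparating_triangle[where F = "set ` set F" and T = "set T" and w = w])
    show "abstract_complex (complex_of F)" using w(2) by (intro abstract_complex_down_closure) auto
    show "set ` set F \<subseteq> complex_of F" unfolding down_closure_def by blast
    show "\<exists>f\<in>set ` set F. \<sigma> \<subseteq> f" if "\<sigma> \<in> complex_of F" for \<sigma>
      using that unfolding down_closure_def by simp
    show "card (set T) = 3" using T by (simp add: distinct_card)
    show "bdry (set T) \<subseteq> complex_of F" unfolding complex_of_facets_of[OF T(1), symmetric]
      using edges unfolding down_closure_def by fastforce
    show "set T \<notin> complex_of F" using nT unfolding down_closure_def by auto
    show "w \<in> \<Union>(complex_of F)" "w \<notin> set T"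
      using w unfolding Union_down_closure by auto
    fix S assume S: "S \<subseteq> set ` set F" "S \<noteq> {}"
      and cl: "\<And>g h u v. g \<in> S \<Longrightarrow> h \<in> set ` set F \<Longrightarrow> {u, v} \<subseteq> g \<inter> h \<Longrightarrow> u \<noteq> v \<Longrightarrow>
        \<not> {u, v} \<subseteq> set T \<Longrightarrow> h \<in> S"
    have "(\<forall>g\<in>set [] \<union> set F. set g \<in> S) \<or> (\<forall>g\<in>set [] \<union> set F. set g \<notin> S)"
    proof (rule connected_order_uniform[OF ord dist])
      fix g h u v assume "h \<in> set [] \<union> set F" "set g \<in> S" "{u, v} \<subseteq> set g \<inter> set h" "u \<noteq> v"
        "\<not> {u, v} \<subseteq> set T"
      then show "set h \<in> S" by (intro cl[of "set g" "set h" u v]) auto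
    qed simp
    then show "S = set ` set F" using S by auto
  qed
qed

subsection \<open>A numerical invariant\<close>

definition meeting_number :: "'v set set \<Rightarrow> 'v set \<Rightarrow> int" where
  "meeting_number FF f = (\<Sum>h\<in>FF. if card (f \<inter> h) = 1 then 1 else 0)"

text \<open>Ordered pairs of facets sharing exactly an edge, weighted by how many facets meet each
  of the two in a single vertex. Only sizes of intersections enter, so isomorphisms preserve it;
  that it separates the 39 spheres is a computed fact, \<open>invariants3\<close>.\<close>

definition meeting_invariant :: "'v set set \<Rightarrow> int" where
  "meeting_invariant FF = (\<Sum>f\<in>FF. \<Sum>g\<in>FF.
     if card (f \<inter> g) = 2 then meeting_number FF f * meeting_number FF g else 0)"

lemma meeting_invariant_isomorphic:
  assumes "complex_isomorphic FF GG"
  shows "meeting_invariant FF = meeting_invariant GG"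
proof -
  obtain f where f: "bij_betw f (\<Union>FF) (\<Union>GG)" "GG = (\<lambda>\<sigma>. f ` \<sigma>) ` FF"
    using assms unfolding complex_isomorphic_def by blast
  have inj: "inj_on f (\<Union>FF)" using f(1) unfolding bij_betw_def by blast
  have injF: "inj_on ((`) f) FF" by (rule inj_on_image[OF inj])
  have card: "card (f ` a \<inter> f ` b) = card (a \<inter> b)" if "a \<in> FF" "b \<in> FF" for a b
  proof -
    have "f ` a \<inter> f ` b = f ` (a \<inter> b)"
      using that by (intro inj_on_image_Int[OF inj, symmetric]) auto
    moreover have "inj_on f (a \<inter> b)" by (rule inj_on_subset[OF inj]) (use that in blast)
    ultimately show ?thesis by (simp add: card_image)
  qed
  have num: "meeting_number GG (f ` a) = meeting_number FF a" if "a \<in> FF" for a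
    unfolding meeting_number_def f(2) sum.reindex[OF injF]
    using card[OF that] by (intro sum.cong) simp_all
  show ?thesis unfolding meeting_invariant_def f(2) sum.reindex[OF injF]
    by (simp add: card num[unfolded f(2)] cong: sum.cong if_cong)
qed

definition meet :: "'a list \<Rightarrow> 'a list \<Rightarrow> nat" where
  "meet f g = length (filter (\<lambda>x. x \<in> set g) f)"

text \<open>\<open>ps\<close> pairs each facet with its meeting number, so that these are computed
  once per facet and not once per pair.\<close>

definition meeting_list :: "'a list list \<Rightarrow> int" where
  "meeting_list F = (let ps = map (\<lambda>f. (f, sum_list (map (\<lambda>h. if meet f h = 1 then 1 else 0) F))) F
     in sum_list (map (\<lambda>(f, a). sum_list (map (\<lambda>(g, b). if meet f g = 2 then a * b else 0) ps)) ps))"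

fun distinct_sets :: "'a list list \<Rightarrow> bool" where
  "distinct_sets [] = True"
| "distinct_sets (f # F) = (list_all (\<lambda>g. \<not> list_all (\<lambda>x. x \<in> set g) f) F \<and> distinct_sets F)"

lemma distinct_sets: "distinct_sets F \<Longrightarrow> distinct (map set F)"
  by (induction F) (auto simp: list_all_iff)

lemma meeting_list:
  assumes "list_all distinct F" "distinct_sets F"
  shows "meeting_list F = meeting_invariant (set ` set F)"
proof -
  have sum: "(\<Sum>h\<in>set ` set F. c h) = sum_list (map (\<lambda>h. c (set h)) F)" for c :: "'a set \<Rightarrow> int"
    using sum_list_distinct_conv_sum_set[OF distinct_sets[OF assms(2)], of c] by (simp add: o_def)
  have meet: "meet f g = card (set f \<inter> set g)" if "f \<in> set F" for f g
  proof -
    have "distinct (filter (\<lambda>x. x \<in> set g) f)"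
      using that assms(1) by (simp add: list_all_iff)
    then have "meet f g = card (set (filter (\<lambda>x. x \<in> set g) f))"
      unfolding meet_def by (simp only: distinct_card)
    also have "set (filter (\<lambda>x. x \<in> set g) f) = set f \<inter> set g" by auto
    finally show ?thesis .
  qed
  have num: "sum_list (map (\<lambda>h. if meet f h = 1 then 1 else 0) F) =
      meeting_number (set ` set F) (set f)" if "f \<in> set F" for f
    unfolding meeting_number_def sum using meet[OF that] by simp
  show ?thesis unfolding meeting_invariant_def sum meeting_list_def Let_def map_map o_def prod.case
    using num meet by (intro arg_cong[where f = sum_list] map_cong) (simp_all cong: if_cong)
qed

subsection \<open>Catalogues and search trees\<close>

datatype label = V0 | V1 | V2 | V3 | V4 | V5 | V6 | V7

definition labels :: "label list" where
  "labels = [V0, V1, V2, V3, V4, V5, V6, V7]"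

definition vertices :: "label list list \<Rightarrow> label list" where
  "vertices F = filter (\<lambda>v. list_ex (\<lambda>f. v \<in> set f) F) labels"

text \<open>One sphere with four vertices, one with five, two with six (the octahedron first) and
  five with seven (the suspension of a pentagon first). \<open>V7\<close> is left free, to serve as
  apex of the cone.\<close>

definition spheres2 :: "label list list list" where
  "spheres2 =
   [[[V0,V1,V2], [V0,V1,V3], [V0,V2,V3], [V1,V2,V3]],
    [[V0,V2,V3], [V0,V2,V4], [V0,V3,V4], [V1,V2,V3], [V1,V2,V4], [V1,V3,V4]],
    [[V0,V1,V2], [V0,V1,V3], [V0,V2,V4], [V0,V3,V4], [V1,V2,V5], [V1,V3,V5], [V2,V4,V5],
     [V3,V4,V5]],
    [[V0,V2,V4], [V0,V2,V5], [V0,V4,V5], [V1,V3,V4], [V1,V3,V5], [V1,V4,V5], [V2,V3,V4],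
     [V2,V3,V5]],
    [[V0,V1,V5], [V0,V1,V6], [V0,V2,V5], [V0,V2,V6], [V1,V3,V5], [V1,V3,V6], [V2,V4,V5],
     [V2,V4,V6], [V3,V4,V5], [V3,V4,V6]],
    [[V0,V2,V4], [V0,V2,V6], [V0,V4,V6], [V1,V3,V5], [V1,V3,V6], [V1,V5,V6], [V2,V4,V5],
     [V2,V5,V6], [V3,V4,V5], [V3,V4,V6]],
    [[V0,V2,V5], [V0,V2,V6], [V0,V5,V6], [V1,V3,V5], [V1,V3,V6], [V1,V5,V6], [V2,V4,V5],
     [V2,V4,V6], [V3,V4,V5], [V3,V4,V6]],
    [[V0,V3,V4], [V0,V3,V6], [V0,V4,V6], [V1,V3,V5], [V1,V3,V6], [V1,V5,V6], [V2,V4,V5],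
     [V2,V4,V6], [V2,V5,V6], [V3,V4,V5]],
    [[V0,V4,V5], [V0,V4,V6], [V0,V5,V6], [V1,V2,V3], [V1,V2,V4], [V1,V3,V5], [V1,V4,V5],
     [V2,V3,V6], [V2,V4,V6], [V3,V5,V6]]]"

text \<open>The projective plane on six vertices, then the torus and three projective planes on seven.\<close>

definition nonspheres2 :: "label list list list" where
  "nonspheres2 =
   [[[V0,V1,V2], [V0,V2,V4], [V1,V2,V5], [V1,V4,V5], [V0,V4,V5], [V0,V3,V5], [V0,V1,V3],
     [V1,V3,V4], [V2,V3,V4], [V2,V3,V5]],
    [[V0,V1,V2], [V0,V2,V4], [V1,V2,V5], [V1,V4,V5], [V2,V3,V4], [V2,V3,V6], [V1,V3,V6],
     [V0,V1,V3], [V0,V3,V5], [V0,V5,V6], [V0,V4,V6], [V1,V4,V6], [V2,V5,V6], [V3,V4,V5]],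
    [[V0,V1,V5], [V0,V1,V6], [V1,V3,V5], [V1,V3,V4], [V1,V4,V6], [V2,V3,V4], [V2,V3,V6],
     [V0,V2,V6], [V0,V2,V5], [V2,V4,V5], [V3,V5,V6], [V4,V5,V6]],
    [[V0,V3,V4], [V0,V4,V6], [V1,V3,V4], [V1,V3,V6], [V1,V4,V5], [V1,V5,V6], [V0,V5,V6],
     [V0,V3,V5], [V2,V3,V5], [V2,V3,V6], [V2,V4,V5], [V2,V4,V6]],
    [[V0,V4,V5], [V0,V4,V6], [V0,V5,V6], [V1,V5,V6], [V1,V2,V5], [V1,V3,V6], [V2,V3,V5],
     [V2,V3,V6], [V2,V4,V6], [V1,V2,V4], [V1,V3,V4], [V3,V4,V5]]]"

text \<open>With \<open>A\<close> of size 4 a facet is subdivided by a new vertex, with size 3 a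
  triangle gives way to an edge. A single move, with \<open>A\<close> of size 2, goes the other way
  and replaces an edge by a triangle.\<close>

definition flips3 :: "(nat \<times> label list \<times> label list) list" where
  "flips3 =
   [(0, [V0,V1,V2,V3], [V5]), (1, [V0,V1,V2], [V4,V5]), (1, [V0,V1,V2,V4], [V6]),
    (2, [V0,V1,V3,V4], [V6]), (3, [V0,V1,V2], [V5,V6]), (4, [V0,V1,V3], [V5,V6]),
    (6, [V0,V3,V4], [V2,V6]), (3, [V0,V1,V2,V5], [V7]), (3, [V0,V1,V3,V4], [V7]),
    (3, [V0,V1,V3,V5], [V7]), (4, [V0,V1,V3,V5], [V7]), (4, [V0,V1,V3,V6], [V7]),
    (4, [V0,V2,V3,V5], [V7]), (5, [V0,V1,V3,V4], [V7]), (6, [V0,V1,V4,V5], [V7]),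
    (6, [V0,V1,V4,V6], [V7]), (6, [V0,V2,V3,V4], [V7]), (7, [V0,V1,V4,V5], [V7]),
    (7, [V0,V1,V4,V6], [V7]), (8, [V0,V1,V2], [V6,V7]), (11, [V0,V1,V3], [V6,V7]),
    (12, [V0,V1,V6], [V4,V7]), (12, [V0,V3,V6], [V4,V7]), (14, [V0,V1,V3], [V5,V7]),
    (15, [V0,V1,V4], [V6,V7]), (16, [V0,V1,V6], [V5,V7]), (16, [V0,V4,V6], [V3,V7]),
    (17, [V0,V2,V3], [V5,V7]), (17, [V0,V3,V4], [V6,V7]), (18, [V0,V1,V4], [V6,V7]),
    (18, [V0,V1,V5], [V6,V7]), (19, [V0,V4,V6], [V2,V7]), (24, [V0,V1,V4], [V6,V7]),
    (25, [V0,V4,V5], [V2,V7]), (27, [V0,V3,V4], [V2,V7]), (28, [V0,V3,V4], [V6,V7]),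
    (30, [V0,V4,V5], [V2,V7]), (30, [V0,V4,V6], [V2,V7]), (30, [V1,V4,V6], [V3,V7]),
    (31, [V0,V5,V6], [V3,V7]), (33, [V0,V1], [V5,V6,V7]), (34, [V0,V4,V7], [V2,V6]),
    (37, [V0,V2,V5], [V3,V7]), (38, [V0,V2,V6], [V3,V7]), (39, [V1,V3,V4], [V2,V7]),
    (40, [V0,V3,V6], [V2,V7])]"

text \<open>The spheres with five (1), six (2), seven (5) and eight (39) vertices, in this order.\<close>

definition spheres3 :: "label list list list" where
  "spheres3 = flips flips3 [facets_of [V0, V1, V2, V3, V4]]"

text \<open>A normal pseudomanifold; the link of \<open>V3\<close> is the projective plane on six vertices.\<close>

definition nonmanifold3 :: "label list list" where
  "nonmanifold3 =
    [[V0,V1,V2,V3], [V0,V2,V3,V6], [V1,V2,V3,V7], [V1,V3,V6,V7], [V0,V3,V6,V7], [V0,V3,V5,V7],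
     [V0,V1,V3,V5], [V1,V3,V5,V6], [V2,V3,V5,V6], [V2,V3,V5,V7], [V0,V1,V2,V4], [V0,V1,V4,V5],
     [V0,V2,V4,V6], [V0,V4,V5,V7], [V0,V4,V6,V7], [V1,V2,V4,V7], [V1,V4,V5,V6], [V1,V4,V6,V7],
     [V2,V4,V5,V6], [V2,V4,V5,V7]]"

text \<open>The initial facets form the cone over the link \<open>F\<close> with apex
  \<open>V7\<close>. They are all the facets at the apex, and no vertex lies in more facets than the
  apex, whence the bound \<open>length F\<close>.\<close>

definition star_check :: "label list list \<Rightarrow> label tree \<Rightarrow> bool" where
  "star_check F t = check labels (Some (length F)) (spheres3 @ [nonmanifold3]) (V7 # vertices F)
     (filter (\<lambda>v. v \<notin> set (V7 # vertices F)) labels) (map ((#) V7) F) t"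

lemma closed2: "list_all (closed_facets 2) (spheres2 @ nonspheres2)" by code_simp

lemma spheres2_apex: "list_all (\<lambda>F. V7 \<notin> set (vertices F) \<and> distinct_sets F) spheres2 \<and>
    length spheres2 = 9" by code_simp

text \<open>For each surface an empty triangle whose edges do not disconnect it, and a vertex off
  the triangle that serves as puncture.\<close>

lemma nonseparating2: "list_all2 (\<lambda>F (T, w). nonseparating F T w) nonspheres2
    [([V0,V1,V4], V2), ([V0,V1,V4], V2), ([V0,V5,V6], V1), ([V0,V3,V6], V1), ([V1,V2,V3], V0)]"
  by code_simp

lemma closed3: "list_all (closed_facets 3) (spheres3 @ [nonmanifold3])" by code_simp

lemma nonseparating3:
  "nonseparating (map (remove1 V3) (incident [V3] nonmanifold3)) [V0,V1,V6] V2 \<and> V3 \<in> set (vertices nonmanifold3)"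
  by code_simp

text \<open>The catalogue starts with 1 + 2 + 5 = 8 spheres on at most seven vertices, hence the
  number 8 to be dropped.\<close>

lemma sizes3: "list_all (\<lambda>F. length (vertices F) < 8) (take 8 spheres3) \<and>
    list_all (\<lambda>F. length (vertices F) = 8 \<and> distinct_sets F) (drop 8 spheres3) \<and>
    length (drop 8 spheres3) = 39" by code_simp

lemma invariants3: "distinct (map meeting_list (drop 8 spheres3))" by code_simp

lemma flips3_valid: "flips_valid 3 flips3 [facets_of [V0, V1, V2, V3, V4]]" by code_simp

section \<open>Search trees, verified by evaluation\<close>

abbreviation (input) "M \<equiv> Match"
abbreviation (input) "B \<equiv> Branch"

text \<open>The search grows from one triangle, with four further labels and no bound on vertices.
  Leaves 0 to 8 are the spheres and 9 to 13 the other surfaces; \<open>B[]\<close> marks an open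
  ridge at which every candidate vertex is contradictory.\<close>

lemma surface_check: "check labels None (spheres2 @ nonspheres2) [V0, V1, V2] [V3, V4, V5, V6]
  [[V0, V1, V2]]
   (B[B[B[M 0 [V0,V1,V2,V3],B[B[M 1 [V2,V4,V0,V1,V3],B[B[M 3 [V2,V5,V3,V4,V0,V1],B[B[
   M 6 [V2,V6,V3,V5,V4,V0,V1]]]],B[B[B[M 5 [V2,V5,V3,V6,V0,V4,V1]],B[M 5 [V2,V6,V3,V5,V1,V4,V0]]]]]
   ],B[B[B[M 3 [V2,V4,V1,V5,V0,V3],B[B[M 5 [V2,V6,V1,V4,V3,V5,V0]]]],B[M 3 [V2,V5,V0,V4,V1,V3],B[B[
   M 7 [V2,V5,V6,V3,V0,V4,V1]]]],B[B[B[M 7 [V2,V4,V6,V3,V1,V5,V0]]],B[B[M 8 [V2,V4,V5,V6,V3,V0,V1]],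
   B[M 5 [V2,V6,V0,V5,V3,V4,V1]]]]],B[B[B[B[M 5 [V2,V5,V1,V4,V0,V6,V3]],B[M 6 [V2,V4,V1,V5,V6,V0,V3]
   ]],B[B[B[B[M 13 [V2,V4,V5,V6,V1,V3,V0]]]],B[M 5 [V2,V5,V0,V6,V1,V4,V3]]],B[B[
   M 7 [V2,V4,V6,V0,V1,V5,V3]],B[M 6 [V2,V6,V0,V5,V4,V1,V3]]]]]]]],B[B[B[M 1 [V0,V3,V1,V2,V4],B[B[
   M 3 [V0,V5,V2,V3,V1,V4],B[B[M 5 [V0,V6,V2,V5,V4,V3,V1]]]],B[B[B[M 6 [V0,V5,V2,V6,V3,V1,V4]],B[
   M 5 [V0,V6,V2,V5,V1,V3,V4]]]]]],B[M 1 [V1,V4,V0,V2,V3],B[B[M 3 [V4,V5,V2,V1,V0,V3],B[B[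
   M 5 [V4,V6,V2,V5,V0,V1,V3]]]],B[B[B[M 6 [V4,V5,V2,V6,V1,V0,V3]],B[M 5 [V4,V6,V2,V5,V3,V1,V0]]]]]
   ],B[B[B[M 3 [V3,V5,V2,V0,V1,V4],B[B[M 5 [V3,V6,V2,V5,V4,V0,V1]]]],B[B[B[B[B[
   M 12 [V2,V5,V6,V0,V4,V1,V3]]],B[]],B[M 6 [V5,V6,V0,V3,V2,V1,V4]],B[B[B[
   M 11 [V2,V0,V3,V5,V6,V4,V1]]]]]]],B[B[M 3 [V1,V5,V2,V4,V0,V3],B[B[M 6 [V5,V6,V4,V1,V2,V0,V3]]]],
   B[M 2 [V0,V1,V2,V5,V4,V3],B[B[M 8 [V6,V2,V3,V4,V1,V0,V5]]]],B[B[B[M 4 [V1,V2,V6,V4,V5,V0,V3]],B[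
   M 6 [V1,V6,V2,V5,V4,V0,V3]]],B[B[M 8 [V6,V0,V2,V4,V1,V5,V3]]]]],B[B[B[B[
   M 5 [V3,V5,V2,V6,V1,V0,V4]],B[M 6 [V3,V6,V2,V5,V0,V1,V4]]]],B[B[B[B[B[M 11 [V2,V1,V4,V5,V6,V3,V0]
   ]]],B[M 5 [V1,V5,V2,V6,V3,V4,V0]]],B[B[M 8 [V5,V1,V2,V3,V0,V6,V4]],B[M 4 [V0,V2,V5,V3,V6,V1,V4]]
   ],B[B[M 5 [V1,V6,V2,V5,V0,V4,V3]],B[M 8 [V6,V0,V1,V2,V5,V4,V3]]]]]]],B[B[B[B[
   M 3 [V0,V4,V1,V3,V2,V5],B[B[M 5 [V0,V6,V1,V4,V2,V3,V5]]]],B[M 3 [V0,V3,V5,V4,V1,V2],B[B[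
   M 5 [V0,V6,V5,V3,V2,V4,V1]]]],B[B[B[M 7 [V0,V4,V6,V2,V1,V3,V5]]],B[B[M 7 [V0,V3,V6,V2,V5,V4,V1]],
   B[M 8 [V0,V3,V4,V6,V2,V1,V5]]]]],B[B[B[B[M 9 [V0,V1,V2,V4,V5,V3],B[B[M 13 [V6,V1,V2,V5,V3,V0,V4]]
   ]],B[B[B[M 11 [V6,V0,V4,V2,V5,V1,V3]],B[M 13 [V6,V2,V3,V5,V4,V1,V0]]]]],B[B[B[B[
   M 11 [V6,V1,V4,V2,V3,V0,V5]],B[]],B[B[M 13 [V6,V0,V2,V3,V5,V1,V4]]],B[B[
   M 11 [V4,V2,V6,V0,V1,V5,V3]]]]]],B[M 3 [V1,V4,V0,V5,V2,V3],B[B[M 5 [V4,V6,V5,V1,V2,V0,V3]]]],B[B[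
   B[B[B[M 13 [V6,V0,V2,V4,V1,V5,V3]],B[B[]]]]],B[B[B[B[M 11 [V1,V2,V6,V4,V5,V3,V0]]]],B[B[],B[B[
   M 11 [V6,V1,V5,V0,V2,V4,V3]]]],B[M 5 [V1,V6,V0,V4,V2,V5,V3]]]]],B[B[M 3 [V3,V5,V1,V0,V2,V4],B[B[
   M 5 [V5,V6,V0,V3,V2,V1,V4]]]],B[M 3 [V1,V5,V3,V4,V0,V2],B[B[M 5 [V5,V6,V4,V1,V2,V3,V0]]]],B[B[B[
   M 8 [V5,V1,V3,V6,V2,V0,V4]],B[M 7 [V3,V5,V6,V2,V1,V0,V4]]],B[B[M 7 [V1,V5,V6,V2,V3,V4,V0]]]]],B[
   B[B[B[M 5 [V4,V6,V3,V0,V2,V1,V5]]],B[B[B[B[M 11 [V6,V3,V5,V2,V4,V1,V0]]],B[B[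
   M 11 [V3,V2,V6,V0,V5,V1,V4]]]],B[M 5 [V3,V6,V4,V0,V2,V5,V1]]]],B[B[B[B[B[
   M 13 [V6,V1,V2,V4,V0,V3,V5]],B[M 11 [V6,V0,V3,V1,V2,V4,V5]]],B[B[M 11 [V0,V2,V6,V3,V4,V1,V5]]]]],
   B[B[M 7 [V1,V4,V6,V2,V0,V5,V3]],B[M 8 [V4,V0,V1,V6,V2,V5,V3]]]],B[B[B[M 5 [V3,V6,V1,V5,V2,V0,V4]
   ],B[M 5 [V1,V6,V3,V5,V2,V4,V0]]],B[B[M 8 [V3,V0,V5,V6,V2,V1,V4]],B[B[B[
   M 11 [V5,V2,V6,V1,V3,V0,V4]]]]],B[B[M 8 [V1,V4,V5,V6,V2,V3,V0]],B[M 4 [V0,V1,V5,V3,V4,V2,V6]]]]]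
   ],B[B[B[B[B[M 6 [V0,V5,V1,V4,V3,V2,V6]],B[M 5 [V0,V4,V1,V5,V6,V3,V2]]],B[B[B[B[
   M 13 [V0,V3,V4,V5,V6,V2,V1]]]],B[M 7 [V0,V3,V5,V1,V6,V4,V2]]],B[B[M 5 [V0,V4,V6,V3,V1,V5,V2]],B[
   M 6 [V0,V3,V6,V4,V5,V1,V2]]]],B[B[B[B[B[M 13 [V5,V0,V1,V3,V4,V2,V6]]]],B[B[B[
   M 13 [V4,V0,V1,V6,V2,V5,V3]],B[M 11 [V4,V3,V5,V1,V6,V2,V0]]],B[B[M 11 [V5,V4,V6,V0,V3,V1,V2]]]]],
   B[B[B[B[B[],B[]],B[B[B[M 10 [V0,V1,V4,V2,V5,V6,V3]]]]]],B[M 5 [V1,V5,V0,V4,V3,V6,V2]]],B[B[B[B[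
   M 12 [V1,V4,V6,V0,V5,V2,V3]]],B[B[M 11 [V6,V0,V5,V1,V4,V2,V3]]]],B[M 6 [V1,V4,V0,V5,V6,V2,V3]]]],
   B[B[B[B[B[B[B[M 10 [V0,V1,V2,V5,V6,V3,V4]]]]]],B[B[B[],B[M 13 [V3,V0,V5,V6,V4,V1,V2]]],B[B[B[]]]]
   ],B[B[B[B[M 11 [V3,V1,V4,V0,V5,V2,V6]],B[M 12 [V0,V3,V5,V1,V2,V4,V6]]]],B[B[B[
   M 13 [V1,V4,V5,V6,V0,V2,V3]]],B[B[M 11 [V1,V0,V3,V4,V6,V5,V2]],B[M 11 [V0,V1,V6,V3,V5,V2,V4]]]]],
   B[B[M 6 [V3,V5,V1,V6,V0,V2,V4]],B[M 5 [V1,V5,V3,V6,V0,V4,V2]]]],B[B[B[M 6 [V4,V6,V3,V0,V1,V2,V5]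
   ],B[M 5 [V3,V6,V4,V0,V1,V5,V2]]],B[B[M 7 [V1,V4,V6,V3,V0,V5,V2]],B[B[B[
   M 13 [V6,V1,V3,V4,V5,V2,V0]]]]],B[B[M 5 [V3,V6,V1,V5,V4,V0,V2]],B[M 6 [V1,V6,V3,V5,V4,V0,V2]]]]]]
   ]]]])" by code_simp

lemma star_check_0: "star_check (spheres2 ! 0)
   (B[M 0 [V0,V1,V2,V3,V7],B[]])" by code_simp

lemma star_check_1: "star_check (spheres2 ! 1)
   (B[B[B[M 2 [V0,V1,V7,V2,V3,V4],B[]],B[]],B[M 1 [V2,V3,V4,V7,V0,V1],B[]],B[B[],B[],B[]]])"
  by code_simp

lemma star_check_2: "star_check (spheres2 ! 2)
   (B[B[B[B[B[M 6 [V1,V4,V0,V7,V2,V3,V5],B[]],B[]],B[B[]]],B[B[B[M 6 [V0,V5,V1,V7,V2,V3,V4],B[]],B[]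
   ],B[M 5 [V2,V3,V7,V0,V1,V4,V5],B[]],B[B[],B[]]],B[B[B[]],B[B[],B[],B[]]]],B[B[B[B[
   M 6 [V2,V3,V0,V7,V1,V4,V5],B[]],B[]],B[B[]]],B[B[B[M 6 [V0,V5,V2,V7,V1,V4,V3],B[]],B[]],B[
   M 5 [V1,V4,V7,V0,V2,V3,V5],B[]],B[B[],B[]]],B[B[B[]],B[B[],B[B[B[],B[]],B[],B[B[],B[]]]]]],B[B[B[
   B[M 6 [V2,V3,V1,V7,V0,V5,V4],B[]],B[]],B[B[]]],B[B[B[M 6 [V1,V4,V2,V7,V0,V5,V3],B[]],B[]],B[
   M 5 [V0,V5,V7,V1,V2,V3,V4],B[]],B[B[],B[]]],B[B[B[]],B[B[],B[B[],B[B[],B[]],B[B[],B[]]]]]],B[B[B[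
   B[]],B[B[],B[],B[]]],B[B[B[]],B[B[],B[],B[]]],B[B[B[],B[B[],B[],B[]]],B[B[],B[]],B[B[B[B[],B[]],
   B[B[],B[B[],B[M 41 [V0,V5,V1,V2,V6,V7,V3,V4]]]],B[B[],B[]]],B[]]]]])"
  by code_simp

lemma star_check_3: "star_check (spheres2 ! 3)
   (B[B[B[B[B[B[M 7 [V0,V3,V4,V7,V1,V2,V5],B[]],B[]],B[]],B[B[M 6 [V1,V7,V0,V2,V4,V5,V3],B[]],B[]],B[
   B[],B[]]],B[B[],B[]],B[B[],B[]]],B[B[B[B[B[M 7 [V0,V3,V5,V7,V1,V2,V4],B[]],B[]],B[
   M 6 [V0,V7,V1,V3,V4,V5,V2],B[]],B[B[],B[]]],B[]],B[B[M 4 [V3,V7,V0,V4,V5,V2,V1],B[]],B[]],B[B[],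
   B[]]],B[B[B[M 4 [V2,V7,V1,V4,V5,V3,V0],B[]],B[]],B[M 3 [V4,V5,V7,V2,V3,V0,V1],B[]],B[B[],B[]]],B[
   B[B[B[],B[],B[]],B[]],B[B[],B[],B[]],B[B[],B[]]]])"
  by code_simp

lemma star_check_4: "star_check (spheres2 ! 4)
   (B[B[B[B[B[B[B[B[B[M 39 [V1,V4,V5,V2,V7,V3,V0,V6]]]],B[B[M 35 [V7,V2,V1,V3,V0,V5,V4,V6]]]],B[B[]]
   ],B[B[B[B[M 35 [V7,V4,V0,V1,V2,V6,V3,V5]],B[B[M 39 [V3,V0,V5,V2,V7,V1,V4,V6]]]]],B[B[
   M 29 [V1,V4,V5,V7,V2,V3,V6,V0]]]],B[B[B[M 29 [V3,V0,V5,V7,V2,V1,V6,V4]]],B[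
   M 24 [V2,V7,V1,V3,V5,V6,V0,V4]]]],B[B[B[B[B[M 31 [V6,V5,V0,V1,V2,V7,V3,V4]]],B[
   M 25 [V5,V6,V0,V1,V7,V2,V3,V4]]]]]],B[B[B[B[B[B[B[M 39 [V2,V3,V5,V1,V7,V4,V0,V6]]]],B[B[
   M 35 [V7,V1,V2,V4,V0,V5,V3,V6]]]],B[B[]]],B[B[B[B[M 35 [V7,V3,V0,V2,V1,V6,V4,V5]],B[B[
   M 39 [V4,V0,V5,V1,V7,V2,V3,V6]]]]],B[B[M 29 [V2,V3,V5,V7,V1,V4,V6,V0]]]],B[B[B[
   M 29 [V4,V0,V5,V7,V1,V2,V6,V3]]],B[M 24 [V1,V7,V2,V4,V5,V6,V0,V3]]]],B[B[B[B[B[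
   M 31 [V6,V5,V0,V2,V1,V7,V4,V3]]],B[M 25 [V5,V6,V0,V2,V7,V1,V4,V3]]]]]],B[B[B[B[B[B[B[]]],B[
   M 28 [V2,V1,V3,V7,V5,V6,V0,V4]]]],B[B[M 21 [V5,V6,V0,V7,V1,V2,V3,V4]]]],B[B[B[B[],B[B[B[]]]],B[
   B[]],B[B[M 28 [V1,V2,V4,V7,V5,V6,V0,V3]]]]]]],B[B[B[B[B[B[B[M 35 [V7,V4,V1,V0,V3,V6,V2,V5]],B[B[
   M 39 [V2,V1,V5,V3,V7,V0,V4,V6]]]]],B[B[M 29 [V0,V4,V5,V7,V3,V2,V6,V1]]]],B[B[B[B[B[
   M 39 [V0,V4,V5,V3,V7,V2,V1,V6]]]],B[B[M 35 [V7,V3,V0,V2,V1,V5,V4,V6]]]],B[B[]]],B[B[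
   M 24 [V3,V7,V0,V2,V5,V6,V1,V4]],B[B[M 29 [V2,V1,V5,V7,V3,V0,V6,V4]]]]],B[B[B[B[
   M 25 [V5,V6,V1,V0,V7,V3,V2,V4]],B[B[M 31 [V5,V6,V0,V1,V2,V7,V3,V4]]]]]]],B[B[B[B[B[B[B[
   M 39 [V3,V2,V5,V0,V7,V4,V1,V6]]]],B[B[M 35 [V7,V1,V2,V4,V0,V6,V3,V5]]]],B[B[]]],B[B[B[B[
   M 35 [V7,V2,V1,V3,V0,V6,V4,V5]],B[B[M 39 [V4,V1,V5,V0,V7,V3,V2,V6]]]]],B[B[
   M 29 [V3,V2,V5,V7,V0,V4,V6,V1]]]],B[B[B[M 29 [V4,V1,V5,V7,V0,V3,V6,V2]]],B[
   M 24 [V0,V7,V3,V4,V5,V6,V1,V2]]]],B[B[B[B[B[M 31 [V6,V5,V1,V3,V0,V7,V4,V2]]],B[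
   M 25 [V5,V6,V1,V3,V7,V0,V4,V2]]]]]],B[B[B[B[B[B[B[]]],B[M 28 [V3,V0,V2,V7,V5,V6,V1,V4]]]],B[B[
   M 21 [V5,V6,V1,V7,V0,V3,V2,V4]]]],B[B[B[B[],B[B[B[]]]],B[B[]],B[B[M 28 [V0,V3,V4,V7,V5,V6,V1,V2]]
   ]]]]],B[B[B[B[B[B[B[B[]],B[B[]]],B[B[B[]],B[B[]]],B[B[B[]],B[B[B[M 47 [V0,V1,V4,V5,V6,V7,V3,V2]]]
   ]]],B[]],B[B[]]],B[B[B[],B[],B[]]]],B[B[B[B[B[B[B[M 39 [V1,V2,V5,V4,V7,V0,V3,V6]]]]]],B[B[B[B[
   M 35 [V7,V4,V1,V0,V3,V5,V2,V6]]]],B[B[M 29 [V0,V3,V5,V7,V4,V1,V6,V2]],B[B[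
   M 31 [V5,V6,V1,V3,V0,V7,V4,V2]]]]]],B[B[B[B[B[B[M 39 [V0,V3,V5,V4,V7,V1,V2,V6]]],B[]]],B[B[B[
   M 35 [V7,V4,V0,V1,V2,V5,V3,V6]]]]],B[B[B[],B[]]]],B[B[B[M 24 [V4,V7,V0,V1,V5,V6,V2,V3]],B[B[
   M 25 [V5,V6,V3,V1,V7,V4,V0,V2]]]],B[B[B[M 29 [V1,V2,V5,V7,V4,V0,V6,V3]]]]]],B[B[B[B[]]],B[B[B[]],
   B[B[],B[]],B[B[B[M 25 [V5,V6,V2,V0,V7,V4,V1,V3]]],B[B[B[M 31 [V5,V6,V0,V2,V1,V7,V4,V3]]]]]]]],B[
   B[B[B[B[],B[]],B[B[B[B[B[]]]],B[B[B[M 31 [V5,V6,V3,V4,V1,V7,V2,V0]]]],B[B[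
   M 25 [V5,V6,V4,V3,V7,V2,V1,V0]]]]],B[B[B[B[B[B[B[]]],B[M 31 [V6,V5,V3,V4,V1,V7,V2,V0]]]],B[B[
   M 25 [V5,V6,V3,V4,V7,V1,V2,V0]]]]]],B[B[B[B[B[B[M 31 [V5,V6,V2,V4,V0,V7,V3,V1]]],B[
   M 25 [V5,V6,V4,V2,V7,V3,V0,V1]]]],B[B[B[B[M 31 [V6,V5,V2,V4,V0,V7,V3,V1]]],B[
   M 25 [V5,V6,V2,V4,V7,V0,V3,V1]]]]],B[B[B[M 21 [V5,V6,V4,V7,V2,V3,V0,V1]]],B[B[]]],B[B[B[
   M 21 [V5,V6,V2,V7,V0,V4,V1,V3]]],B[M 20 [V5,V6,V7,V0,V1,V2,V3,V4]]]],B[B[B[B[],B[]]],B[B[B[B[B[B[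
   B[]]]]]],B[B[B[M 28 [V4,V0,V1,V7,V5,V6,V2,V3]]],B[M 21 [V5,V6,V3,V7,V1,V4,V0,V2]]]]]]])"
  by code_simp

lemma star_check_5: "star_check (spheres2 ! 5)
   (B[B[B[B[B[B[B[B[B[B[M 46 [V1,V2,V6,V7,V0,V5,V4,V3]]]]],B[B[],B[]]],B[B[]]],B[B[B[B[B[B[
   M 43 [V3,V2,V6,V7,V0,V5,V4,V1]]],B[M 40 [V1,V7,V0,V2,V6,V4,V5,V3]]]]],B[B[B[B[
   M 38 [V4,V1,V7,V5,V6,V3,V2,V0]]],B[M 32 [V2,V7,V1,V3,V6,V5,V4,V0]]]]],B[B[B[B[],B[B[],B[]]]],B[B[
   B[],B[]]]]],B[B[B[],B[]]]],B[B[B[B[B[B[B[]],B[B[M 42 [V0,V5,V6,V2,V7,V1,V4,V3]]]],B[B[B[B[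
   M 46 [V5,V0,V7,V6,V4,V2,V3,V1]]]],B[]],B[B[B[]],B[]]]],B[B[B[]]]],B[B[B[B[B[
   M 34 [V1,V7,V0,V2,V4,V6,V5,V3]],B[B[M 38 [V0,V7,V1,V3,V5,V6,V4,V2]]]],B[B[B[
   M 40 [V2,V3,V5,V7,V1,V4,V6,V0]]]]]],B[B[B[M 25 [V1,V7,V0,V2,V4,V6,V5,V3]],B[B[
   M 31 [V1,V7,V0,V2,V6,V4,V5,V3]]]]]],B[B[B[B[B[]]],B[B[B[B[B[]],B[]]],B[B[B[B[]],B[]]]]],B[B[]]]],
   B[B[B[B[B[],B[B[B[]],B[]]],B[B[]],B[B[B[]]]]],B[B[B[],B[]],B[B[]]]]],B[B[B[B[B[]],B[B[B[B[B[B[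
   M 44 [V6,V2,V3,V1,V4,V0,V5,V7]]]]],B[B[]]],B[B[B[B[M 38 [V1,V4,V6,V0,V7,V3,V2,V5]]]],B[B[
   M 31 [V6,V4,V1,V5,V3,V2,V7,V0]]]]],B[B[],B[]]],B[B[B[]]]],B[B[B[B[B[B[B[],B[
   M 38 [V5,V0,V7,V4,V6,V2,V3,V1]]],B[B[B[M 43 [V2,V3,V6,V7,V1,V4,V5,V0]]]]]]],B[B[B[B[B[
   M 40 [V0,V7,V1,V3,V6,V5,V4,V2]]],B[M 32 [V3,V7,V0,V2,V6,V4,V5,V1]]]],B[B[
   M 19 [V3,V7,V0,V2,V6,V4,V5,V1]]]]],B[B[B[B[B[B[M 39 [V0,V7,V1,V5,V3,V6,V2,V4]],B[B[
   M 43 [V2,V6,V3,V4,V1,V7,V0,V5]]]]]],B[B[B[M 35 [V3,V7,V0,V2,V6,V4,V5,V1]],B[B[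
   M 39 [V1,V7,V0,V4,V2,V6,V3,V5]]]]]],B[B[B[M 27 [V3,V7,V0,V2,V6,V4,V5,V1]]]]],B[B[B[B[],B[]],B[
   M 16 [V3,V7,V0,V2,V6,V4,V5,V1]]],B[B[B[B[B[]],B[B[]]]]]]],B[B[B[B[],B[],B[]]],B[B[B[],B[B[B[]],
   B[]]],B[B[]]]]],B[B[B[B[B[B[B[B[],B[M 37 [V1,V7,V0,V2,V4,V6,V5,V3]]]],B[B[
   M 30 [V0,V7,V1,V3,V5,V6,V4,V2]]]],B[B[B[B[B[]],B[B[M 43 [V0,V7,V1,V3,V5,V6,V4,V2]]]]],B[B[B[]]]],
   B[B[B[]],B[B[]]]]],B[B[B[B[B[M 30 [V1,V7,V0,V2,V4,V6,V5,V3]]],B[M 27 [V4,V6,V2,V5,V7,V0,V1,V3]]]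
   ],B[B[B[],B[]]]]],B[B[B[B[B[B[B[B[M 44 [V6,V3,V2,V0,V5,V1,V4,V7]]]],B[B[
   M 38 [V1,V7,V0,V2,V4,V6,V5,V3]]]],B[B[B[]],B[M 31 [V0,V7,V1,V3,V6,V5,V4,V2]]]]]],B[B[B[B[B[B[
   M 38 [V0,V5,V6,V1,V7,V2,V3,V4]]]]],B[B[B[M 34 [V0,V7,V1,V3,V5,V6,V4,V2]]],B[
   M 25 [V0,V7,V1,V3,V5,V6,V4,V2]]]],B[B[B[B[B[M 40 [V3,V2,V4,V7,V0,V5,V6,V1]]]]],B[B[B[
   M 31 [V6,V5,V0,V4,V2,V3,V7,V1]]],B[M 18 [V7,V3,V2,V0,V5,V6,V4,V1]]]],B[B[B[B[]]],B[
   M 17 [V7,V0,V3,V5,V6,V4,V2,V1]]]]],B[B[B[B[M 23 [V7,V5,V0,V4,V6,V2,V1,V3]]]],B[B[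
   M 12 [V5,V7,V0,V6,V4,V2,V3,V1]],B[B[],B[]]]]],B[B[B[B[B[B[M 19 [V2,V7,V1,V3,V6,V5,V4,V0]]],B[B[]]
   ]],B[B[B[M 17 [V7,V1,V2,V4,V6,V5,V3,V0]]],B[B[]]]],B[B[B[B[B[M 18 [V7,V2,V3,V1,V4,V6,V5,V0]]]]],
   B[B[B[M 16 [V2,V7,V1,V3,V6,V5,V4,V0]]],B[M 13 [V7,V2,V3,V6,V4,V5,V0,V1]]]],B[B[B[
   M 12 [V4,V7,V1,V6,V5,V3,V2,V0]]],B[M 10 [V6,V7,V4,V5,V2,V3,V0,V1]]]]])"
  by code_simp

lemma star_check_6: "star_check (spheres2 ! 6)
   (B[B[B[B[B[B[B[B[B[B[M 43 [V3,V0,V7,V5,V6,V2,V1,V4]]]]],B[B[B[M 39 [V6,V2,V1,V5,V3,V0,V7,V4]]]]],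
   B[B[]]],B[B[B[B[B[M 38 [V6,V5,V4,V3,V2,V7,V1,V0]]],B[B[B[M 44 [V7,V0,V3,V4,V1,V6,V2,V5]]]]]],B[B[
   B[B[]],B[M 30 [V6,V5,V4,V3,V2,V7,V1,V0]]]]],B[B[B[B[M 32 [V3,V5,V6,V0,V7,V1,V2,V4]]]],B[B[
   M 25 [V5,V6,V4,V3,V2,V7,V1,V0]]]]],B[B[]]],B[B[B[B[B[B[B[B[M 44 [V4,V0,V7,V5,V6,V2,V1,V3]]]]],B[
   B[B[M 39 [V7,V1,V2,V0,V4,V5,V6,V3]]]]],B[B[B[]]]],B[B[B[B[B[M 39 [V5,V3,V0,V6,V2,V1,V7,V4]],B[B[
   M 45 [V0,V4,V5,V7,V1,V2,V6,V3]]]]]],B[B[B[M 30 [V5,V6,V4,V3,V2,V7,V1,V0]]]]],B[B[B[B[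
   M 30 [V7,V1,V2,V0,V4,V5,V6,V3]]]],B[B[M 26 [V1,V7,V0,V2,V5,V6,V4,V3]]]]],B[B[],B[]]],B[B[B[B[B[],
   B[B[B[]],B[]]],B[B[]],B[]]],B[B[],B[]]]],B[B[B[B[],B[]],B[B[]]],B[B[B[B[B[B[B[],B[]],B[B[B[
   M 44 [V4,V0,V7,V6,V5,V2,V1,V3]]]]]]],B[B[B[B[B[M 38 [V6,V5,V4,V2,V3,V7,V0,V1]]]]],B[B[B[
   M 30 [V6,V5,V4,V2,V3,V7,V0,V1]]],B[M 18 [V3,V7,V0,V2,V6,V5,V4,V1]]]]],B[B[B[B[B[B[B[]],B[B[
   M 43 [V2,V1,V7,V5,V6,V3,V0,V4]]]],B[]]],B[B[B[B[M 39 [V6,V3,V0,V5,V2,V1,V7,V4]]]]]],B[B[B[],B[]]]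
   ],B[B[B[B[M 25 [V5,V6,V4,V2,V3,V7,V0,V1]]],B[M 15 [V3,V7,V0,V2,V5,V6,V4,V1]]],B[B[B[B[
   M 32 [V3,V6,V5,V0,V7,V1,V2,V4]]]]]]],B[B[B[]],B[B[],B[]]]],B[B[B[B[]],B[B[B[B[B[B[B[
   M 43 [V3,V0,V7,V6,V5,V2,V1,V4]]]]]],B[B[B[B[M 38 [V5,V6,V4,V3,V2,V7,V1,V0]]]],B[B[
   M 30 [V7,V1,V2,V0,V4,V6,V5,V3]]]]],B[B[B[B[B[B[M 43 [V2,V1,V7,V6,V5,V3,V0,V4]]]]]],B[B[B[B[
   M 38 [V5,V6,V4,V2,V3,V7,V0,V1]]]],B[B[M 30 [V7,V0,V3,V1,V4,V6,V5,V2]]]]],B[B[B[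
   M 28 [V7,V0,V1,V4,V5,V6,V2,V3]]],B[B[B[B[]]]]]]],B[B[B[B[B[B[B[B[M 45 [V0,V4,V6,V7,V1,V2,V5,V3]]
   ],B[M 39 [V5,V2,V1,V6,V3,V0,V7,V4]]]],B[B[B[B[M 44 [V7,V0,V3,V4,V1,V5,V2,V6]]],B[
   M 39 [V7,V1,V2,V0,V4,V6,V5,V3]]]]],B[B[B[M 30 [V5,V6,V4,V2,V3,V7,V0,V1]]],B[
   M 26 [V0,V7,V1,V3,V5,V6,V4,V2]]],B[B[B[]],B[B[B[B[]]],B[M 30 [V7,V0,V3,V1,V4,V5,V6,V2]]]]]],B[B[
   B[B[M 18 [V3,V7,V0,V2,V5,V6,V4,V1]]],B[M 16 [V5,V6,V2,V4,V7,V0,V3,V1]]]]],B[B[B[B[B[]],B[B[],B[B[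
   B[]],B[]]],B[M 22 [V4,V7,V0,V5,V6,V2,V1,V3]]]],B[B[M 12 [V5,V6,V2,V7,V4,V0,V3,V1]]]]],B[B[B[B[B[
   B[M 18 [V2,V7,V1,V3,V6,V5,V4,V0]]],B[M 15 [V2,V7,V1,V3,V5,V6,V4,V0]]]],B[B[B[],B[B[
   M 18 [V2,V7,V1,V3,V5,V6,V4,V0]]],B[M 16 [V5,V6,V3,V4,V7,V1,V2,V0]]]]],B[B[B[]],B[B[B[B[]]],B[
   M 11 [V5,V6,V4,V7,V2,V3,V0,V1]]]],B[B[B[B[],M 12 [V5,V6,V3,V7,V4,V1,V2,V0]]],B[
   M 8 [V5,V6,V7,V4,V2,V3,V0,V1]]]]])"
  by code_simp

lemma star_check_7: "star_check (spheres2 ! 7)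
   (B[B[B[B[B[B[]],B[B[B[B[B[]],B[B[B[M 43 [V2,V3,V6,V0,V7,V1,V4,V5]]]]]],B[B[B[B[
   M 37 [V2,V3,V6,V0,V7,V1,V4,V5]]]],B[B[M 30 [V6,V3,V2,V5,V4,V1,V7,V0]]]]],B[B[],B[B[B[B[]]],B[B[]]
   ]]],B[B[B[],B[]]]],B[B[B[B[B[B[],B[B[M 37 [V1,V4,V6,V2,V7,V0,V5,V3]]]],B[B[B[B[
   M 43 [V1,V4,V6,V2,V7,V0,V5,V3]]]]],B[B[M 30 [V6,V4,V1,V3,V5,V0,V7,V2]]]]],B[B[B[
   M 19 [V6,V4,V1,V3,V5,V0,V7,V2]]]]],B[B[B[B[B[],B[M 36 [V7,V0,V2,V1,V4,V6,V3,V5]]],B[B[B[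
   M 38 [V7,V2,V3,V0,V1,V6,V4,V5]]]],B[B[B[M 38 [V7,V0,V5,V2,V1,V6,V4,V3]]]]]],B[B[B[
   M 28 [V6,V3,V5,V4,V1,V7,V0,V2]],B[B[]]]]],B[B[B[B[B[]]],B[M 17 [V6,V3,V5,V4,V7,V1,V0,V2]]],B[B[]]
   ]],B[B[B[B[],B[],B[]]],B[B[B[],B[]],B[B[B[]]]]]],B[B[B[B[B[]],B[B[B[B[B[]],B[B[B[
   M 43 [V1,V4,V6,V0,V7,V2,V3,V5]]]]]],B[B[B[B[M 37 [V1,V4,V6,V0,V7,V2,V3,V5]]]],B[B[
   M 30 [V6,V4,V1,V5,V3,V2,V7,V0]]]]],B[B[],B[B[B[B[]]],B[B[]]]]],B[B[B[]]]],B[B[B[B[B[B[],B[B[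
   M 37 [V2,V3,V6,V1,V7,V0,V5,V4]]]],B[B[B[B[M 43 [V2,V3,V6,V1,V7,V0,V5,V4]]]]],B[B[
   M 30 [V6,V3,V2,V4,V5,V0,V7,V1]]]]],B[B[B[M 19 [V6,V3,V2,V4,V5,V0,V7,V1]]]]],B[B[B[B[B[],B[
   M 36 [V7,V0,V1,V2,V3,V6,V4,V5]]],B[B[B[M 38 [V7,V1,V4,V0,V2,V6,V3,V5]]]],B[B[B[
   M 38 [V7,V0,V5,V1,V2,V6,V3,V4]]]]]],B[B[B[M 28 [V6,V4,V5,V3,V2,V7,V0,V1]],B[B[]]]]],B[B[B[B[B[]]
   ],B[M 17 [V6,V4,V5,V3,V7,V2,V0,V1]]],B[B[]]]],B[B[B[B[],B[],B[]]],B[B[B[],B[B[B[],B[]],B[B[]],B[]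
   ]],B[B[]]]]],B[B[B[B[B[B[B[B[M 37 [V0,V5,V6,V2,V7,V1,V4,V3]]]],B[B[]]],B[B[B[B[B[
   M 43 [V0,V5,V6,V2,V7,V1,V4,V3]]]]],B[B[B[B[]]]]],B[B[B[]],B[B[]]]]],B[B[B[B[B[],B[B[B[]],B[]]],B[
   B[M 30 [V6,V5,V0,V3,V4,V1,V7,V2]]]]],B[B[B[B[],M 19 [V6,V5,V0,V3,V4,V1,V7,V2]]]]]],B[B[B[B[B[B[B[
   B[]]],B[B[B[]]]],B[B[B[M 38 [V7,V1,V4,V2,V0,V6,V5,V3]]],B[B[B[M 43 [V0,V5,V6,V1,V7,V2,V3,V4]]]]]]
   ]],B[B[B[B[B[B[M 37 [V0,V5,V6,V1,V7,V2,V3,V4]]],B[B[]]]],B[B[B[M 36 [V7,V1,V2,V0,V5,V6,V3,V4]]],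
   B[B[]]]],B[B[B[B[B[M 38 [V7,V2,V3,V1,V0,V6,V5,V4]]]]],B[B[B[M 30 [V6,V5,V0,V4,V3,V2,V7,V1]]],B[
   M 19 [V6,V5,V0,V4,V3,V2,V7,V1]]]],B[B[B[M 28 [V6,V3,V4,V5,V0,V7,V1,V2]]],B[
   M 17 [V6,V4,V3,V5,V7,V0,V2,V1]]]]],B[B[B[B[B[B[B[]],B[]],B[B[B[]],B[]]]]],B[B[B[B[],
   M 17 [V6,V3,V4,V5,V7,V0,V1,V2]]],B[M 11 [V5,V7,V0,V6,V3,V4,V1,V2]]]]],B[B[B[B[B[B[],B[
   M 19 [V6,V3,V2,V5,V4,V1,V7,V0]]]]],B[B[B[M 17 [V6,V5,V3,V4,V7,V1,V2,V0]]],B[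
   M 11 [V4,V7,V1,V6,V3,V5,V0,V2]]]],B[B[B[B[B[],B[M 19 [V6,V4,V1,V5,V3,V2,V7,V0]]]]],B[B[B[
   M 17 [V6,V5,V4,V3,V7,V2,V1,V0]]],B[M 11 [V3,V7,V2,V6,V4,V5,V0,V1]]]],B[B[B[B[B[],B[]]]],B[
   M 9 [V6,V7,V3,V4,V5,V0,V1,V2]]]]])"
  by code_simp

lemma star_check_8: "star_check (spheres2 ! 8)
   (B[B[B[B[B[B[B[B[B[],B[B[]]]],B[B[]]],B[B[B[B[M 38 [V5,V6,V1,V4,V2,V0,V7,V3]]]],B[B[
   M 36 [V0,V1,V3,V7,V2,V5,V4,V6]]]],B[B[B[B[]]],B[B[B[M 38 [V5,V4,V3,V6,V2,V0,V7,V1]]]]]]],B[B[B[B[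
   B[]],B[B[M 30 [V1,V6,V4,V0,V7,V2,V5,V3]]],B[B[],B[]]]],B[B[B[B[M 32 [V7,V1,V6,V0,V2,V4,V5,V3]]],
   B[M 29 [V7,V0,V1,V2,V5,V4,V6,V3]]]]]],B[B[B[B[B[B[B[M 40 [V1,V6,V3,V5,V2,V7,V0,V4]]],B[B[]]],B[B[
   M 34 [V7,V0,V3,V1,V2,V5,V4,V6]],B[B[M 38 [V4,V5,V2,V6,V3,V0,V7,V1]]]]]]],B[B[B[B[B[
   M 36 [V0,V2,V3,V7,V1,V6,V4,V5]]]],B[B[M 29 [V7,V0,V3,V1,V6,V5,V4,V2]],B[B[
   M 30 [V3,V4,V5,V0,V7,V1,V6,V2]]]]],B[B[B[M 33 [V0,V7,V1,V2,V3,V4,V5,V6]],B[B[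
   M 34 [V7,V0,V2,V3,V1,V6,V5,V4]]]],B[B[B[M 36 [V0,V1,V2,V7,V3,V4,V5,V6]]]]],B[B[B[
   M 29 [V7,V0,V1,V3,V4,V5,V6,V2]],B[B[M 30 [V1,V6,V5,V0,V7,V3,V4,V2]]]],B[B[B[
   M 34 [V7,V0,V2,V1,V3,V4,V5,V6]]]]]]],B[B[B[B[B[B[M 30 [V2,V5,V4,V0,V7,V1,V6,V3]]],B[
   M 27 [V7,V1,V0,V6,V5,V4,V2,V3]]]]],B[B[B[B[B[B[M 40 [V1,V6,V2,V4,V3,V7,V0,V5]]],B[
   M 34 [V7,V0,V3,V2,V1,V6,V4,V5]]]],B[B[B[B[M 38 [V4,V6,V1,V5,V3,V0,V7,V2]]],B[
   M 32 [V7,V1,V6,V0,V3,V5,V4,V2]]]]],B[B[B[M 29 [V7,V0,V2,V1,V6,V4,V5,V3]]],B[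
   M 21 [V1,V7,V0,V6,V4,V5,V2,V3]]],B[B[B[M 27 [V7,V1,V0,V6,V4,V5,V3,V2]]],B[B[]]]]]],B[B[B[B[B[B[B[
   B[M 38 [V6,V5,V2,V4,V1,V0,V7,V3]]]],B[B[M 34 [V7,V0,V1,V3,V2,V5,V6,V4]],B[]],B[B[B[
   M 40 [V3,V4,V1,V5,V2,V7,V0,V6]]]]]],B[B[B[B[B[B[M 46 [V1,V4,V3,V6,V2,V0,V7,V5]]],B[
   M 40 [V2,V5,V3,V6,V1,V7,V0,V4]]]],B[B[M 32 [V7,V2,V5,V0,V1,V4,V6,V3]]]]]],B[B[B[B[
   M 29 [V7,V0,V3,V2,V5,V6,V4,V1]],B[B[M 32 [V7,V3,V4,V0,V2,V6,V5,V1]]]]],B[B[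
   M 21 [V2,V7,V0,V5,V4,V6,V1,V3]]]],B[B[B[B[],B[]],B[B[M 27 [V7,V2,V0,V5,V6,V4,V1,V3]]]],B[B[]]]],
   B[B[B[B[]],B[B[B[B[M 30 [V3,V4,V6,V0,V7,V2,V5,V1]]]],B[B[M 27 [V7,V2,V0,V5,V4,V6,V3,V1]]]],B[B[],
   B[]]],B[B[B[],B[]]]],B[B[B[B[],B[]],B[B[B[],B[B[B[]],B[]]],B[B[]],B[B[]]]],B[B[B[],B[],B[]]]]],B[
   B[B[B[B[B[B[B[M 38 [V6,V4,V3,V5,V1,V0,V7,V2]]]],B[B[M 34 [V7,V0,V1,V2,V3,V4,V6,V5]],B[]],B[B[B[
   M 40 [V2,V5,V1,V4,V3,V7,V0,V6]]]]]],B[B[B[B[B[B[M 46 [V2,V4,V3,V5,V1,V0,V7,V6]]],B[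
   M 40 [V3,V4,V2,V6,V1,V7,V0,V5]]]],B[B[M 32 [V7,V3,V4,V0,V1,V5,V6,V2]]]]]],B[B[B[B[
   M 29 [V7,V0,V2,V3,V4,V6,V5,V1]],B[B[M 32 [V7,V2,V5,V0,V3,V6,V4,V1]]]]],B[B[
   M 21 [V3,V7,V0,V4,V5,V6,V1,V2]]]],B[B[B[B[],B[]],B[B[M 27 [V7,V3,V0,V4,V6,V5,V1,V2]]]],B[B[]]]],
   B[B[B[B[]],B[B[B[B[M 30 [V2,V5,V6,V0,V7,V3,V4,V1]]]],B[B[M 27 [V7,V3,V0,V4,V5,V6,V2,V1]]]],B[B[],
   B[]]],B[B[B[]]]],B[B[B[B[],B[B[B[B[]],B[B[]]],B[B[B[]],B[]],B[B[]]]],B[B[]]],B[B[B[],B[],B[]]]]],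
   B[B[B[B[B[M 17 [V5,V2,V4,V7,V6,V1,V3,V0]]]],B[B[M 14 [V6,V7,V1,V4,V5,V2,V3,V0]],B[B[
   M 17 [V4,V3,V5,V7,V6,V1,V2,V0]]]]],B[B[B[M 14 [V5,V7,V2,V4,V6,V1,V3,V0]],B[B[
   M 17 [V6,V1,V4,V7,V5,V2,V3,V0]]]],B[B[B[M 17 [V4,V3,V6,V7,V5,V2,V1,V0]]]]],B[B[B[
   M 14 [V4,V7,V3,V5,V6,V1,V2,V0]],B[B[M 17 [V6,V1,V5,V7,V4,V3,V2,V0]]]],B[B[B[
   M 17 [V5,V2,V6,V7,V4,V3,V1,V0]]]]]]])"
  by code_simp

subsection \<open>The classification\<close>

lemma set_labels [simp]: "set labels = UNIV"
proof -
  have "v \<in> set labels" for v unfolding labels_def by (cases v) simp_all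
  then show ?thesis by blast
qed

lemma distinct_labels [simp]: "distinct labels" unfolding labels_def by simp

lemma set_vertices: "set (vertices F) = \<Union>(set ` set F)"
  unfolding vertices_def by (auto simp: list_ex_iff)

lemma distinct_vertices: "distinct (vertices F)" unfolding vertices_def by simp

lemma complex_isomorphic_card:
  "complex_isomorphic K L \<Longrightarrow> card (\<Union>K) = card (\<Union>L)"
  unfolding complex_isomorphic_def by (auto dest: bij_betw_same_card)

lemma surfaces_up_to_7_vertices:
  assumes FF: "strong_pm 2 FF" "FF \<noteq> {}" "card (\<Union>FF) \<le> 7"
  shows "\<exists>G\<in>set (spheres2 @ nonspheres2). complex_isomorphic (set ` set G) FF"
proof -
  obtain f where f: "f \<in> FF" using FF(2) by blast
  then have "card f = 3" using strong_pmD(3)[OF FF(1)] by simp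
  then obtain a b c where abc: "f = {a, b, c}" "a \<noteq> b" "b \<noteq> c" "a \<noteq> c"
    by (auto simp: card_3_iff)
  let ?\<gamma> = "\<lambda>l. if l = V0 then a else if l = V1 then b else c"
  have emb: "embeds 2 FF ?\<gamma> [V0, V1, V2] [[V0, V1, V2]]"
    using f abc unfolding embeds_def by (auto simp: inj_on_def insert_commute)
  have "closed_facets 2 G" if "G \<in> set (spheres2 @ nonspheres2)" for G
    using closed2 that unfolding list_all_iff by blast
  then show ?thesis
    by (intro check_sound[OF surface_check FF(1) _ _ _ _ emb]) (use FF(3) in simp_all)
qed

lemma combinatorial_3_manifoldD:
  assumes "combinatorial_3_manifold K"
  shows "strong_pm 3 (faces_of_dim 3 K)" "down_closure (faces_of_dim 3 K) = K"
    "\<And>v. v \<in> \<Union>K \<Longrightarrow>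
       geometric_carrier (link_complex {v} K) homeomorphic sphere (0 :: real^3) 1"
proof -
  have K: "normal_pseudomanifold 3 K" using assms unfolding combinatorial_3_manifold_def by blast
  then have "pure_complex 3 K" unfolding normal_pseudomanifold_def weak_pseudomanifold_def by blast
  then show "down_closure (faces_of_dim 3 K) = K" by (rule down_closure_faces)
  show "strong_pm 3 (faces_of_dim 3 K)" by (rule strong_pm_faces[OF K])
  show "\<And>v. v \<in> \<Union>K \<Longrightarrow>
       geometric_carrier (link_complex {v} K) homeomorphic sphere (0 :: real^3) 1"
    using assms unfolding combinatorial_3_manifold_def by blast
qed

lemma vertex_link_facets:
  assumes K: "combinatorial_3_manifold K" and n: "card (\<Union>K) \<le> 8" and v: "v \<in> \<Union>K"
  shows "\<exists>G\<in>set spheres2. complex_isomorphic (set ` set G) (link_facets v (faces_of_dim 3 K))"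
proof -
  define FF where "FF = faces_of_dim 3 K"
  note D = combinatorial_3_manifoldD[OF K, folded FF_def]
  have UK: "\<Union>FF = \<Union>K" using Union_down_closure[of FF] unfolding D(2) by simp
  have "strong_pm (Suc 2) FF" using D(1) by simp
  then have L: "strong_pm 2 (link_facets v FF)" by (rule strong_pm_link_facets)
  obtain f where f: "f \<in> FF" "v \<in> f" using v unfolding UK[symmetric] by blast
  then have "f - {v} \<in> link_facets v FF" unfolding link_facets_def by (simp add: insert_absorb)
  then have ne: "link_facets v FF \<noteq> {}" by blast
  have fin: "finite (\<Union>K)" unfolding UK[symmetric] using strong_pmD(1,2)[OF D(1)] by blast
  have "\<Union>(link_facets v FF) \<subseteq> \<Union>K - {v}"
    unfolding UK[symmetric] link_facets_def by blast
  then have "card (\<Union>(link_facets v FF)) \<le> card (\<Union>K - {v})"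
    using fin by (intro card_mono) auto
  also have "\<dots> \<le> 7" using n v fin by simp
  finally obtain G where G: "G \<in> set (spheres2 @ nonspheres2)"
    "complex_isomorphic (set ` set G) (link_facets v FF)"
    using surfaces_up_to_7_vertices[OF L ne] by blast
  have "G \<notin> set nonspheres2"
  proof
    assume "G \<in> set nonspheres2"
    then obtain T w where "nonseparating G T w"
      using nonseparating2 unfolding list_all2_conv_all_nth in_set_conv_nth
      by (metis (mono_tags, lifting) case_prod_unfold)
    then have "\<not> geometric_carrier (complex_of G) homeomorphic sphere (0 :: real^3) 1"
      by (rule not_sphere_if_nonseparating)
    moreover have "geometric_carrier (complex_of G) homeomorphic
        geometric_carrier (link_complex {v} (down_closure FF))" unfolding link_down_closure
      by (intro complex_isomorphic_carrier complex_isomorphic_down_closure G)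
    ultimately show False using D(3)[OF v] homeomorphic_trans unfolding D(2) by blast
  qed
  then show ?thesis using G unfolding FF_def by auto
qed

lemma star_checks: "\<forall>G\<in>set spheres2. \<exists>t. star_check G t"
proof -
  have "\<exists>t. star_check (spheres2 ! i) t" if "i < 9" for i
  proof -
    have "i \<in> {0, 1, 2, 3, 4, 5, 6, 7, 8}" using that by auto
    then show ?thesis
      using star_check_0 star_check_1 star_check_2 star_check_3 star_check_4 star_check_5
        star_check_6 star_check_7 star_check_8 by blast
  qed
  then show ?thesis using spheres2_apex by (metis in_set_conv_nth)
qed

text \<open>Extending the isomorphism of the link by \<open>V7\<close> to \<open>x\<close> embeds
  the cone over \<open>G\<close> onto the star of \<open>x\<close>, from which the search in
  \<open>star_check\<close> starts.\<close>

lemma pseudomanifold_with_sphere_link: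
  assumes FF: "strong_pm 3 FF" "card (\<Union>FF) \<le> 8"
    and x: "x \<in> \<Union>FF" "\<And>y. card (star FF {y}) \<le> card (star FF {x})"
    and G: "G \<in> set spheres2" "complex_isomorphic (set ` set G) (link_facets x FF)"
  shows "\<exists>F\<in>set (spheres3 @ [nonmanifold3]). complex_isomorphic (set ` set F) FF"
proof -
  obtain t where t: "star_check G t" using star_checks G(1) by blast
  obtain \<delta> where \<delta>: "bij_betw \<delta> (\<Union>(set ` set G)) (\<Union>(link_facets x FF))"
    "link_facets x FF = (\<lambda>\<sigma>. \<delta> ` \<sigma>) ` set ` set G"
    using G(2) unfolding complex_isomorphic_def by blast
  have V7: "V7 \<notin> set (vertices G)" and "distinct_sets G"
    using spheres2_apex G(1) unfolding list_all_iff by blast+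
  then have dist: "distinct (map set G)" by (intro distinct_sets)
  have cl: "distinct g" "length g = 3" if "g \<in> set G" for g
    using closed2 G(1) that unfolding closed_facets_def list_all_iff by auto
  define \<gamma> where "\<gamma> = \<delta>(V7 := x)"
  let ?U = "V7 # vertices G"
  have \<gamma>7: "\<gamma> V7 = x" unfolding \<gamma>_def by simp
  have \<gamma>: "\<gamma> v = \<delta> v" if "v \<in> set (vertices G)" for v
    using V7 that unfolding \<gamma>_def by auto
  have xL: "x \<notin> \<Union>(link_facets x FF)" and LF: "\<Union>(link_facets x FF) \<subseteq> \<Union>FF"
    unfolding link_facets_def by blast+
  have im: "\<gamma> ` set (vertices G) = \<Union>(link_facets x FF)"
    using \<gamma> \<delta>(1) unfolding set_vertices bij_betw_def by simp
  have "inj_on \<delta> (set (vertices G))"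
    using \<delta>(1) unfolding set_vertices bij_betw_def by blast
  then have "inj_on \<gamma> (set (vertices G))"
    using inj_on_cong[of "set (vertices G)" \<gamma> \<delta>] \<gamma> by simp
  then have inj: "inj_on \<gamma> (set ?U)" using xL im V7 by (simp add: \<gamma>_def)
  have facet: "\<gamma> ` set (V7 # g) \<in> FF" if "g \<in> set G" for g
  proof -
    have "\<delta> ` set g \<in> link_facets x FF" unfolding \<delta>(2) using that by blast
    moreover have "\<gamma> ` set g = \<delta> ` set g"
      using \<gamma> that set_vertices[of G] by (intro image_cong) auto
    moreover have "\<gamma> ` set (V7 # g) = insert x (\<gamma> ` set g)" using \<gamma>7 by simp
    ultimately show ?thesis unfolding link_facets_def by simp
  qed
  have "distinct (map set (map ((#) V7) G))"
  proof -
    have "set g = set h" if "g \<in> set G" "h \<in> set G" "insert V7 (set g) = insert V7 (set h)" for g h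
    proof -
      have "V7 \<notin> set g" "V7 \<notin> set h" using V7 that(1,2) unfolding set_vertices by auto
      then show ?thesis using that(3) by (simp add: insert_ident)
    qed
    then have "inj_on (insert V7) (set (map set G))" by (intro inj_onI) auto
    then have "distinct (map (insert V7) (map set G))"
      unfolding distinct_map[of "insert V7"] using dist by simp
    then show ?thesis by (simp add: o_def)
  qed
  moreover have "\<gamma> ` set ?U \<subseteq> \<Union>FF" using im LF x(1) \<gamma>7 by simp
  moreover have "distinct f \<and> length f = Suc 3 \<and> set f \<subseteq> set ?U \<and> \<gamma> ` set f \<in> FF"
    if f: "f \<in> set (map ((#) V7) G)" for f
  proof -
    obtain g where g: "g \<in> set G" "f = V7 # g" using f by auto
    have gv: "set g \<subseteq> set (vertices G)" using g(1) unfolding set_vertices by blast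
    then have "V7 \<notin> set g" using V7 by blast
    then show ?thesis using g(2) gv cl[OF g(1)] facet[OF g(1)] by auto
  qed
  ultimately have emb: "embeds 3 FF \<gamma> ?U (map ((#) V7) G)"
    unfolding embeds_def using inj by blast
  \<comment> \<open>Facets at \<open>x\<close> correspond to facets of its link, at most
    \<open>length G\<close> many, and \<open>x\<close> is in the largest number of facets.\<close>
  have bound: "card (star FF {y}) \<le> length G" for y
  proof -
    have "card (star FF {x}) = card (star (link_facets x FF) {})"
      using bij_betw_same_card[OF bij_betw_star_link_facets[of x "{}" FF]] by simp
    also have "\<dots> = card (link_facets x FF)" unfolding star_def by simp
    also have "\<dots> \<le> card (set G)"
      unfolding \<delta>(2) image_image by (rule card_image_le) simp
    also have "\<dots> \<le> length G" by (rule card_length)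
    finally show ?thesis using x(2)[of y] by simp
  qed
  show ?thesis
  proof (rule check_sound[OF t[unfolded star_check_def] FF(1)])
    let ?W = "filter (\<lambda>v. v \<notin> set ?U) labels"
    show "embeds 3 FF \<gamma> ?U (map ((#) V7) G)" by (rule emb)
    show dU: "distinct (?U @ ?W)" using V7 distinct_vertices by auto
    have "set (?U @ ?W) = UNIV" by auto
    then have "length (?U @ ?W) = card (UNIV :: label set)" using distinct_card[OF dU] by simp
    also have "\<dots> = length labels" using distinct_card[OF distinct_labels] by simp
    finally show "card (\<Union>FF) \<le> length (?U @ ?W)" using FF(2) unfolding labels_def by simp
    show "closed_facets 3 F" if "F \<in> set (spheres3 @ [nonmanifold3])" for F
      using closed3 that unfolding list_all_iff by blast
  qed (use bound in simp_all)
qed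

lemma link_facets_list:
  assumes "list_all distinct F"
  shows "link_facets v (set ` set F) = set ` set (map (remove1 v) (incident [v] F))"
proof (intro equalityI subsetI)
  fix g assume "g \<in> link_facets v (set ` set F)"
  then obtain f where f: "v \<notin> g" "f \<in> set F" "insert v g = set f"
    unfolding link_facets_def by auto
  then have "set (remove1 v f) = g" using assms by (auto simp: list_all_iff set_remove1_eq)
  moreover have "f \<in> set (incident [v] F)" using f by (auto simp: set_incident)
  ultimately show "g \<in> set ` set (map (remove1 v) (incident [v] F))" by auto
next
  fix g assume "g \<in> set ` set (map (remove1 v) (incident [v] F))"
  then obtain f where "f \<in> set F" "v \<in> set f" "g = set (remove1 v f)"
    by (auto simp: set_incident)
  then show "g \<in> link_facets v (set ` set F)"
    using assms unfolding link_facets_def by (auto simp: list_all_iff insert_absorb)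
qed

text \<open>An isomorphism carries the link of \<open>V3\<close>, in which the triangle on
  \<open>V0\<close>, \<open>V1\<close>, \<open>V6\<close> does not separate, to a vertex link of
  \<open>K\<close>, which would have to be a sphere.\<close>

lemma nonmanifold3:
  assumes K: "combinatorial_3_manifold K"
  shows "\<not> complex_isomorphic (complex_of nonmanifold3) K"
proof
  assume "complex_isomorphic (complex_of nonmanifold3) K"
  then obtain f where f: "bij_betw f (\<Union>(complex_of nonmanifold3)) (\<Union>K)"
    "K = (\<lambda>\<sigma>. f ` \<sigma>) ` complex_of nonmanifold3"
    unfolding complex_isomorphic_def by blast
  have "V3 \<in> \<Union>(set ` set nonmanifold3)"
    using nonseparating3 unfolding set_vertices by blast
  then have v: "{V3} \<in> complex_of nonmanifold3" and "V3 \<in> \<Union>(complex_of nonmanifold3)"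
    unfolding Union_down_closure by (auto simp: down_closure_def)
  then have fv: "f V3 \<in> \<Union>K" using bij_betwE[OF f(1)] by blast
  have "list_all distinct nonmanifold3"
    using closed3 unfolding closed_facets_def list_all_iff by simp
  then have "link_complex {V3} (complex_of nonmanifold3) =
      complex_of (map (remove1 V3) (incident [V3] nonmanifold3))"
    unfolding link_down_closure by (simp only: link_facets_list)
  then have "\<not> geometric_carrier (link_complex {V3} (complex_of nonmanifold3))
      homeomorphic sphere (0 :: real^3) 1" using not_sphere_if_nonseparating nonseparating3 by metis
  moreover have "geometric_carrier (link_complex {V3} (complex_of nonmanifold3)) homeomorphic
      geometric_carrier (link_complex {f V3} K)"
    using complex_isomorphic_carrier[OF complex_isomorphic_link[OF f v]] by simp
  ultimately show False using combinatorial_3_manifoldD(3)[OF K fv] homeomorphic_trans by blast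
qed

lemma sphere_complex_spheres3:
  assumes "F \<in> set spheres3"
  shows "sphere_complex 3 (complex_of F)"
proof (rule sphere_complex_flips[OF flips3_valid _ assms[unfolded spheres3_def]])
  fix G assume "G \<in> set [facets_of [V0, V1, V2, V3, V4]]"
  then have "complex_of G = bdry {V0, V1, V2, V3, V4}"
    using complex_of_facets_of[of "[V0, V1, V2, V3, V4]"] by simp
  then show "sphere_complex 3 (complex_of G)"
    using sphere_complex_bdry[of "{V0, V1, V2, V3, V4}" 3] by simp
qed

lemma combinatorial_3_manifold_8_vertices:
  assumes K: "combinatorial_3_manifold K" and n: "card (\<Union>K) = 8"
  shows "\<exists>F\<in>set (drop 8 spheres3). complex_isomorphic (complex_of F) K"
proof -
  define FF where "FF = faces_of_dim 3 K"
  note D = combinatorial_3_manifoldD[OF K, folded FF_def]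
  have UK: "\<Union>FF = \<Union>K" using Union_down_closure[of FF] unfolding D(2) by simp
  have fin: "finite (\<Union>K)" "\<Union>K \<noteq> {}" using n card.infinite by force+
  define c where "c y = card (star FF {y})" for y
  have "Max (c ` \<Union>K) \<in> c ` \<Union>K" using fin by (intro Max_in) auto
  then obtain x where x: "Max (c ` \<Union>K) = c x" "x \<in> \<Union>K" by (rule imageE)
  \<comment> \<open>\<open>y\<close> ranges over the whole type; outside the vertex set the star is
    empty and the count is 0.\<close>
  have max: "c y \<le> c x" for y
  proof (cases "y \<in> \<Union>K")
    case True
    then show ?thesis unfolding x(1)[symmetric] using fin by simp
  next
    case False
    then have "star FF {y} = {}" unfolding UK[symmetric] star_def by blast
    then show ?thesis unfolding c_def by simp
  qed
  obtain G where G: "G \<in> set spheres2" "complex_isomorphic (set ` set G) (link_facets x FF)"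
    using vertex_link_facets[OF K _ x(2)] n unfolding FF_def by auto
  obtain F where F: "F \<in> set (spheres3 @ [nonmanifold3])" "complex_isomorphic (set ` set F) FF"
    using pseudomanifold_with_sphere_link[OF D(1) _ _ _ G] n x(2) max unfolding UK c_def by auto
  have iso: "complex_isomorphic (complex_of F) K"
    using complex_isomorphic_down_closure[OF F(2)] unfolding D(2) .
  have "F \<in> set spheres3" using F(1) iso nonmanifold3[OF K] by auto
  \<comment> \<open>The early catalogue entries can match, but they have fewer than 8
    vertices.\<close>
  moreover have "F \<notin> set (take 8 spheres3)"
  proof
    assume "F \<in> set (take 8 spheres3)"
    then have "length (vertices F) < 8" using sizes3 unfolding list_all_iff by blast
    moreover have "card (\<Union>(complex_of F)) = length (vertices F)"
      unfolding Union_down_closure set_vertices[symmetric]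
      by (rule distinct_card[OF distinct_vertices])
    ultimately show False using complex_isomorphic_card[OF iso] n by simp
  qed
  ultimately have "F \<in> set (drop 8 spheres3)"
    using set_append[of "take 8 spheres3" "drop 8 spheres3"] by simp
  then show ?thesis using iso by blast
qed

section \<open>Counting the isomorphism classes\<close>

lemma faces_down_closure:
  assumes "\<And>f. f \<in> FF \<Longrightarrow> finite f \<and> card f = Suc d"
  shows "faces_of_dim d (down_closure FF) = FF"
proof (intro equalityI subsetI)
  fix \<sigma> assume "\<sigma> \<in> faces_of_dim d (down_closure FF)"
  then obtain f where f: "f \<in> FF" "\<sigma> \<subseteq> f" "card \<sigma> = Suc d"
    unfolding faces_of_dim_def down_closure_def by blast
  then have "\<sigma> = f" using assms[OF f(1)] by (intro card_subset_eq) auto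
  then show "\<sigma> \<in> FF" using f(1) by simp
next
  fix \<sigma> assume "\<sigma> \<in> FF"
  then show "\<sigma> \<in> faces_of_dim d (down_closure FF)"
    using assms unfolding faces_of_dim_def down_closure_def by blast
qed

lemma complex_isomorphic_faces:
  assumes "complex_isomorphic K L"
  shows "complex_isomorphic (faces_of_dim d K) (faces_of_dim d L)"
proof -
  obtain f where f: "bij_betw f (\<Union>K) (\<Union>L)" "L = (\<lambda>\<sigma>. f ` \<sigma>) ` K"
    using assms unfolding complex_isomorphic_def by blast
  have inj: "inj_on f (\<Union>K)" using f(1) unfolding bij_betw_def by blast
  have "card (f ` \<sigma>) = card \<sigma>" if "\<sigma> \<in> K" for \<sigma>
    using inj_on_subset[OF inj] that by (intro card_image) blast
  then have eq: "faces_of_dim d L = (\<lambda>\<sigma>. f ` \<sigma>) ` faces_of_dim d K"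
    unfolding faces_of_dim_def f(2) by auto
  have "\<Union>(faces_of_dim d K) \<subseteq> \<Union>K" unfolding faces_of_dim_def by blast
  moreover have "\<Union>(faces_of_dim d L) = f ` \<Union>(faces_of_dim d K)" unfolding eq by blast
  ultimately have "bij_betw f (\<Union>(faces_of_dim d K)) (\<Union>(faces_of_dim d L))"
    using inj_on_subset[OF inj] unfolding bij_betw_def by simp
  then show ?thesis using eq unfolding complex_isomorphic_def by blast
qed

lemma spheres3_not_isomorphic:
  assumes F: "F \<in> set (drop 8 spheres3)" and G: "G \<in> set (drop 8 spheres3)"
    and iso: "complex_isomorphic (complex_of F) (complex_of G)"
  shows "F = G"
proof -
  have H: "list_all distinct H" "distinct_sets H" "\<And>h. h \<in> set H \<Longrightarrow> length h = Suc 3"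
    if "H \<in> set (drop 8 spheres3)" for H
  proof -
    have "H \<in> set (spheres3 @ [nonmanifold3])" using that set_drop_subset[of 8 spheres3] by auto
    then have "closed_facets 3 H" using closed3 unfolding list_all_iff by blast
    then show "list_all distinct H" "\<And>h. h \<in> set H \<Longrightarrow> length h = Suc 3"
      unfolding closed_facets_def list_all_iff by auto
    show "distinct_sets H" using sizes3 that unfolding list_all_iff by blast
  qed
  have faces: "faces_of_dim 3 (complex_of H) = set ` set H" if "H \<in> set (drop 8 spheres3)" for H
  proof (rule faces_down_closure)
    fix h assume "h \<in> set ` set H"
    then show "finite h \<and> card h = Suc 3"
      using H(1,3)[OF that] by (auto simp: list_all_iff distinct_card)
  qed
  have "complex_isomorphic (set ` set F) (set ` set G)"
    using complex_isomorphic_faces[OF iso, of 3] unfolding faces[OF F] faces[OF G] .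
  then have "meeting_invariant (set ` set F) = meeting_invariant (set ` set G)"
    by (rule meeting_invariant_isomorphic)
  then have "meeting_list F = meeting_list G"
    using meeting_list[OF H(1,2)[OF F]] meeting_list[OF H(1,2)[OF G]] by simp
  moreover have "inj_on meeting_list (set (drop 8 spheres3))"
    using invariants3 by (simp add: distinct_map)
  ultimately show ?thesis using F G by (simp add: inj_onD)
qed

definition number :: "label \<Rightarrow> nat" where
  "number v = (case v of V0 \<Rightarrow> 0 | V1 \<Rightarrow> 1 | V2 \<Rightarrow> 2 | V3 \<Rightarrow> 3 | V4 \<Rightarrow> 4 | V5 \<Rightarrow> 5 | V6 \<Rightarrow> 6 | V7 \<Rightarrow> 7)"

lemma inj_number: "inj number"
proof (rule injI)
  fix v w assume "number v = number w"
  then show "v = w" unfolding number_def by (cases v; cases w) simp_all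
qed

text \<open>The search runs on labels while the classes to be counted consist of complexes on
  natural numbers; this transports the representatives.\<close>

definition numbered :: "label list list \<Rightarrow> nat set set" where
  "numbered F = (\<lambda>\<sigma>. number ` \<sigma>) ` complex_of F"

lemma complex_isomorphic_numbered: "complex_isomorphic (complex_of F) (numbered F)"
proof -
  have "\<Union>(numbered F) = number ` \<Union>(complex_of F)" unfolding numbered_def by blast
  then have "bij_betw number (\<Union>(complex_of F)) (\<Union>(numbered F))"
    using inj_on_subset[OF inj_number subset_UNIV] unfolding bij_betw_def by simp
  then show ?thesis unfolding complex_isomorphic_def numbered_def by blast
qed

theorem corollary3:
  shows "card ({K :: nat set set. combinatorial_3_manifold K \<and> card (\<Union>K) = 8}
               // {(K, L). complex_isomorphic K L}) = 39
       \<and> (\<forall>K :: nat set set. combinatorial_3_manifold K \<and> card (\<Union>K) = 8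
            \<longrightarrow> combinatorial_3_sphere K)"
proof
  let ?r = "{(K :: nat set set, L :: nat set set). complex_isomorphic K L}"
  define A where "A = {K :: nat set set. combinatorial_3_manifold K \<and> card (\<Union>K) = 8}"
  define S where "S = drop 8 spheres3"
  have sph: "sphere_complex 3 (numbered F)" if "F \<in> set S" for F
  proof -
    have "F \<in> set spheres3" using that set_drop_subset[of 8 spheres3] unfolding S_def by blast
    then show ?thesis
      using sphere_complex_isomorphic[OF sphere_complex_spheres3 complex_isomorphic_numbered]
      by blast
  qed
  have SA: "numbered F \<in> A" if "F \<in> set S" for F
  proof -
    have "length (vertices F) = 8" using sizes3 that unfolding S_def list_all_iff by blast
    then have "card (\<Union>(complex_of F)) = 8"
      unfolding Union_down_closure set_vertices[symmetric]
      by (simp add: distinct_card[OF distinct_vertices])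
    then have "card (\<Union>(numbered F)) = 8"
      using complex_isomorphic_card[OF complex_isomorphic_numbered[of F]] by simp
    then show ?thesis using combinatorial_3_sphere_if_sphere_complex[OF sph[OF that]]
      unfolding A_def combinatorial_3_sphere_def by blast
  qed
  have AS: "\<exists>F\<in>set S. complex_isomorphic (numbered F) K" if "K \<in> A" for K
  proof -
    have "combinatorial_3_manifold K" "card (\<Union>K) = 8" using that unfolding A_def by simp_all
    then obtain F where F: "F \<in> set S" "complex_isomorphic (complex_of F) K"
      using combinatorial_3_manifold_8_vertices unfolding S_def by blast
    have "complex_isomorphic (numbered F) K"
      by (rule complex_isomorphic_trans[OF complex_isomorphic_sym[OF complex_isomorphic_numbered] F(2)])
    then show ?thesis using F(1) by blast
  qed
  note eqv = equiv_complex_isomorphic[where 'v = nat]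
  \<comment> \<open>Every class meets the catalogue by \<open>AS\<close>, and every numbered sphere
    on 8 vertices is in \<open>A\<close> by \<open>SA\<close>, so the classes are indexed by
    \<open>S\<close>.\<close>
  have "A // ?r = (\<lambda>F. ?r `` {numbered F}) ` set S"
  proof (intro equalityI subsetI)
    fix Q assume "Q \<in> A // ?r"
    then obtain K where K: "K \<in> A" "Q = ?r `` {K}" by (rule quotientE)
    obtain F where F: "F \<in> set S" "complex_isomorphic (numbered F) K" using AS[OF K(1)] by blast
    then have "?r `` {numbered F} = ?r `` {K}" by (intro equiv_class_eq[OF eqv]) simp
    then show "Q \<in> (\<lambda>F. ?r `` {numbered F}) ` set S" using F(1) K(2) by blast
  next
    fix Q assume "Q \<in> (\<lambda>F. ?r `` {numbered F}) ` set S"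
    then obtain F where "F \<in> set S" "Q = ?r `` {numbered F}" by blast
    then show "Q \<in> A // ?r" using SA quotientI by metis
  qed
  moreover have "inj_on (\<lambda>F. ?r `` {numbered F}) (set S)"
  proof (rule inj_onI)
    fix F G assume FG: "F \<in> set S" "G \<in> set S" "?r `` {numbered F} = ?r `` {numbered G}"
    have "(numbered F, numbered G) \<in> ?r" by (rule eq_equiv_class[OF FG(3) eqv]) simp
    then have iso: "complex_isomorphic (numbered F) (numbered G)" by simp
    have "complex_isomorphic (complex_of F) (complex_of G)"
      by (rule complex_isomorphic_trans[OF complex_isomorphic_trans[OF complex_isomorphic_numbered iso]
            complex_isomorphic_sym[OF complex_isomorphic_numbered]])
    then show "F = G" using spheres3_not_isomorphic FG(1,2) unfolding S_def by blast
  qed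
  \<comment> \<open>Different values of \<open>meeting_list\<close> also show that the 39 entries of
    the list are different.\<close>
  moreover have "card (set S) = 39"
    using invariants3 sizes3 distinct_card[of S] unfolding S_def by (simp add: distinct_map)
  ultimately show "card (A // ?r) = 39" by (simp add: card_image)
  show "\<forall>K :: nat set set. combinatorial_3_manifold K \<and> card (\<Union>K) = 8
            \<longrightarrow> combinatorial_3_sphere K"
  proof (intro allI impI)
    fix K :: "nat set set"
    assume "combinatorial_3_manifold K \<and> card (\<Union>K) = 8"
    then have "K \<in> A" unfolding A_def by blast
    then obtain F where F: "F \<in> set S" "complex_isomorphic (numbered F) K" using AS by blast
    show "combinatorial_3_sphere K" by (rule combinatorial_3_sphere_if_sphere_complex[OF
            sphere_complex_isomorphic[OF sph[OF F(1)] F(2)]])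
  qed
qed

end
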